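(* Let $n\ge 1$ be an integer and let $k$ be a positive divisor of $n$. Let $\mathbf S_k$ denote a maximal torus of $\mathrm{SL}_n(\mathbb C)/C_k$ and let $W$ (the symmetric group $\mathfrak S_n$) denote the corresponding Weyl group. There is a homotopy equivalence \[ \mathbf S_k/\!/W\;\simeq\;\coprod_\mu\ (\mathbb C^\times)^{b(\mu)-1}\times Y_\mu , \] where the disjoint union is over all partitions $\mu$ of $n$ and $Y_\mu$ is a discrete set of cardinality \[ \frac{g(\mu)}{a}\sum_{s=0}^{a-1}\gcd(a,s),\qquad a=\gcd\left(g(\mu),\frac{n}{g(\mu)},k,\frac nk\right). \] In particular, interchanging $\mathrm{SL}_n(\mathbb C)/C_k$ with its Langlands dual $\mathrm{SL}_n(\mathbb C)/C_{n/k}$ does not change the homotopy type of the extended quotient.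
   Context: $C_k$ denotes the group of $k$-th roots of unity in $\mathbb C$, identified (when $k$ divides $n$) with the subgroup $C_kI_n$ of the centre of $\mathrm{SL}_n(\mathbb C)$. For a partition $\mu$ of $n$, $g(\mu)$ is the greatest common divisor of its parts and $b(\mu)$ is the number of distinct parts. Convention: $\gcd(a,0)=a$. Extended quotient: if a finite group $\Gamma$ acts on a complex affine variety $X$ by automorphisms, set $\widetilde X=\{(\gamma,x)\in\Gamma\times X:\gamma x=x\}$, with $\Gamma$ acting by $\alpha(\gamma,x)=(\alpha\gamma\alpha^{-1},\alpha x)$; then $X/\!/\Gamma:=\widetilde X/\Gamma$. Equivalently $X/\!/\Gamma=\coprod_{\gamma} X^\gamma/Z(\gamma)$, with $\gamma$ running over representatives of the conjugacy classes of $\Gamma$ and $Z(\gamma)$ the centraliser of $\gamma$. One may take $\mathbf S_k=\mathbf S/C_k$, where $\mathbf S$ is the group of diagonal matrices in $\mathrm{SL}_n(\mathbb C)$, with $W=\mathfrak S_n$ acting by permuting the diagonal entries. Homotopy type refers to the complex-analytic (Euclidean) topology. *)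

theory Defs
  imports "HOL-Analysis.Analysis" "HOL-Algebra.Group_Action" "HOL-Library.Multiset"
begin

definition quotient_topology :: "'a topology \<Rightarrow> ('a \<Rightarrow> 'b) \<Rightarrow> 'b topology" where
  "quotient_topology X f =
     topology (\<lambda>U. U \<subseteq> f ` topspace X \<and> openin X {x \<in> topspace X. f x \<in> U})"

lemma openin_quotient_topology:
  "openin (quotient_topology X f) U \<longleftrightarrow>
     U \<subseteq> f ` topspace X \<and> openin X {x \<in> topspace X. f x \<in> U}"
proof -
  have 1: "{x \<in> topspace X. f x \<in> S \<inter> T} =
      {x \<in> topspace X. f x \<in> S} \<inter> {x \<in> topspace X. f x \<in> T}" for S T
    by auto
  have 2: "{x \<in> topspace X. f x \<in> \<Union> \<K>} = (\<Union>K\<in>\<K>. {x \<in> topspace X. f x \<in> K})" for \<K>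
    by auto
  have "istopology (\<lambda>U. U \<subseteq> f ` topspace X \<and> openin X {x \<in> topspace X. f x \<in> U})"
    unfolding istopology_def 1 2 by blast
  then show ?thesis
    by (simp add: quotient_topology_def)
qed

lemma topspace_quotient_topology [simp]:
  "topspace (quotient_topology X f) = f ` topspace X"
proof -
  have "{x \<in> topspace X. f x \<in> f ` topspace X} = topspace X"
    by auto
  then have "openin (quotient_topology X f) (f ` topspace X)"
    by (simp add: openin_quotient_topology)
  then show ?thesis
    by (metis openin_quotient_topology openin_subset openin_topspace subset_antisym)
qed

lemma quotient_map_quotient_topology: "quotient_map X (quotient_topology X f) f"
  by (auto simp: quotient_map_def openin_quotient_topology)

text \<open>
  The extended quotient of a space by a finite group \<open>G\<close> acting through \<open>\<phi>\<close>. The group is discrete.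
  For an algebraic action on a complex affine variety with its Euclidean topology, the Euclidean
  topology of the quotient variety by a finite group is the quotient topology.
\<close>

definition fixed_pairs :: "('g, 'm) monoid_scheme \<Rightarrow> 'x topology \<Rightarrow> ('g \<Rightarrow> 'x \<Rightarrow> 'x) \<Rightarrow> ('g \<times> 'x) set" where
  "fixed_pairs G X \<phi> = {(\<gamma>, x) \<in> carrier G \<times> topspace X. \<phi> \<gamma> x = x}"

definition pair_action ::
  "('g, 'm) monoid_scheme \<Rightarrow> ('g \<Rightarrow> 'x \<Rightarrow> 'x) \<Rightarrow> 'g \<Rightarrow> 'g \<times> 'x \<Rightarrow> 'g \<times> 'x" where
  "pair_action G \<phi> \<alpha> = (\<lambda>(\<gamma>, x). (\<alpha> \<otimes>\<^bsub>G\<^esub> \<gamma> \<otimes>\<^bsub>G\<^esub> inv\<^bsub>G\<^esub> \<alpha>, \<phi> \<alpha> x))"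

definition extended_quotient ::
  "('g, 'm) monoid_scheme \<Rightarrow> 'x topology \<Rightarrow> ('g \<Rightarrow> 'x \<Rightarrow> 'x) \<Rightarrow> ('g \<times> 'x) set topology" where
  "extended_quotient G X \<phi> =
     quotient_topology
       (subtopology (prod_topology (discrete_topology (carrier G)) X) (fixed_pairs G X \<phi>))
       (orbit G (pair_action G \<phi>))"

text \<open>Throughout, \<open>n = CARD('n)\<close>.\<close>

definition SL :: "(complex^'n^'n) monoid" where
  "SL = \<lparr>carrier = {A. det A = 1}, mult = (**), one = mat 1\<rparr>"

definition diagonal_torus :: "(complex^'n^'n) set" where
  "diagonal_torus = {A \<in> carrier SL. \<forall>i j. i \<noteq> j \<longrightarrow> A $ i $ j = 0}"

definition scalar_roots :: "nat \<Rightarrow> (complex^'n^'n) set" where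
  "scalar_roots k = {mat z | z. z ^ k = 1}"

text \<open>
  The maximal torus of \<open>SL Mod scalar_roots k\<close> that is the image of the diagonal torus; its points are
  cosets.
\<close>

definition quotient_torus :: "nat \<Rightarrow> (complex^'n^'n) set topology" where
  "quotient_torus k =
     quotient_topology (top_of_set diagonal_torus) (\<lambda>A. scalar_roots k #>\<^bsub>SL\<^esub> A)"

text \<open>
  Conjugation by the permutation matrix of \<open>p\<close>: the diagonal entry at \<open>i\<close> moves to \<open>p i\<close>.
\<close>

definition permute_entries :: "('n \<Rightarrow> 'n) \<Rightarrow> complex^'n^'n \<Rightarrow> complex^'n^'n" where
  "permute_entries p A = (\<chi> i j. A $ inv_into UNIV p i $ inv_into UNIV p j)"

definition torus_extended_quotient ::
  "nat \<Rightarrow> (('n \<Rightarrow> 'n) \<times> (complex^'n^'n) set) set topology" where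
  "torus_extended_quotient k =
     extended_quotient (BijGroup (UNIV :: 'n set)) (quotient_torus k) (\<lambda>p X. permute_entries p ` X)"

definition partitions :: "nat \<Rightarrow> nat multiset set" where
  "partitions n = {\<mu>. 0 \<notin># \<mu> \<and> sum_mset \<mu> = n}"

definition parts_gcd :: "nat multiset \<Rightarrow> nat" where
  "parts_gcd \<mu> = Gcd (set_mset \<mu>)"

definition num_distinct_parts :: "nat multiset \<Rightarrow> nat" where
  "num_distinct_parts \<mu> = card (set_mset \<mu>)"

text \<open>All divisions are exact when \<open>\<mu> \<in> partitions n\<close>, \<open>n > 0\<close> and \<open>k dvd n\<close>.\<close>

definition num_components :: "nat \<Rightarrow> nat \<Rightarrow> nat multiset \<Rightarrow> nat" where
  "num_components n k \<mu> =
     (let g = parts_gcd \<mu>; a = gcd (gcd g (n div g)) (gcd k (n div k))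
      in (g div a) * (\<Sum>s<a. gcd a s))"

definition punctured_plane :: "complex topology" where
  "punctured_plane = top_of_set (UNIV - {0})"

end

theory Submission
  imports Defs "HOL-Computational_Algebra.Fundamental_Theorem_Algebra"
begin

text \<open>
  The extended quotient is the disjoint union, over cycle types of permutations \<open>p\<close> and roots of unity
  \<open>\<zeta>\<close> with \<open>\<zeta>\<^sup>k = 1\<close>, of the quotients of \<open>{x. x \<circ> p\<^sup>-\<^sup>1 = \<zeta> x}\<close> by the centraliser of \<open>p\<close> and by \<open>C\<^sub>k\<close>.
  Let \<open>d\<close> be the order of \<open>\<zeta>\<close>. Such an \<open>x\<close> is determined by one coordinate \<open>x\<^sub>c\<close> per cycle \<open>c\<close>; rotating a
  cycle multiplies \<open>x\<^sub>c\<close> by powers of \<open>\<zeta>\<close>, and the remaining permutations exchange cycles of equal length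
  \<open>m\<close>. So the quotient by the centraliser is the space of coefficients of the polynomials
  \<open>\<Prod>\<^sub>c (X - x\<^sub>c\<^sup>d)\<close>, one for each \<open>m\<close>; the map to coefficients is a quotient map because it is proper.
  Scaling all coefficients except the constant terms \<open>t\<^sub>m\<close> down to \<open>0\<close> is compatible with \<open>C\<^sub>k\<close> and leaves
  \<open>{t. \<Prod>\<^sub>m t\<^sub>m\<^bsup>m/d\<^esup> = const}\<close> modulo \<open>C\<^sub>k\<close>. By Euclid's algorithm, applied to the exponents and then to the
  weights of \<open>C\<^sub>k\<close>, unimodular substitutions turn this into a product of a torus of dimension \<open>b(\<mu>) - 1\<close>
  and \<open>gcd(g(\<mu>)/d, n/k)\<close> points. Adding these numbers over all \<open>\<zeta>\<close> with \<open>\<zeta>\<^bsup>gcd(g(\<mu>), k)\<^esup> = 1\<close> gives the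
  cardinality of \<open>Y\<^sub>\<mu>\<close>, which is visibly symmetric in \<open>k\<close> and \<open>n/k\<close>.
\<close>

section \<open>Homotopy equivalences of quotients and disjoint unions\<close>

text \<open>The action has fixed points, so the deformation is made upstairs, by maps that respect
  orbits, and then pushed down along a quotient map. It acts on coefficients and not on the x_c: the
  latter must stay nonzero, while every non-constant coefficient may vanish. The count of points
  rests on two quantities that the unimodular substitutions preserve: the gcd of the exponents,
  which is g/d, and the sum of exponent times weight. With l_m cycles of length m, the exponent of
  t_m is m/d and its weight under C_k is d l_m, so this sum is the sum of the m l_m, which is n;
  divided by k it gives the n/k in gcd(g/d, n/k). Euclid's algorithm on the weights has an obstacle.
  Once a single coordinate carries all exponents, it takes finitely many values, and any
  substitution that changes its weight by means of another coordinate would spread the exponents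
  again. So the weights cannot in general be cleared from all free coordinates; a case of two
  coordinates remains, which is settled by an explicit invariant monomial.\<close>

lemma quotient_homotopy_equivalent_space:
  assumes \<pi>: "quotient_map B E \<pi>" and \<theta>: "quotient_map (subtopology B C) F \<theta>"
    and C: "C \<subseteq> topspace B"
    and r: "continuous_map (prod_topology (top_of_set {0..1::real}) B) B r"
    and r0: "\<And>b. b \<in> topspace B \<Longrightarrow> r (0, b) \<in> C" and r1: "\<And>b. b \<in> topspace B \<Longrightarrow> r (1, b) = b"
    and rC: "\<And>b. b \<in> C \<Longrightarrow> r (0, b) = b"
    and fib: "\<And>t b b'. \<lbrakk>t \<in> {0..1}; b \<in> topspace B; b' \<in> topspace B; \<pi> b = \<pi> b'\<rbrakk> \<Longrightarrow> \<pi> (r (t, b)) = \<pi> (r (t, b'))"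
    and fibC: "\<And>b b'. \<lbrakk>b \<in> C; b' \<in> C\<rbrakk> \<Longrightarrow> \<theta> b = \<theta> b' \<longleftrightarrow> \<pi> b = \<pi> b'"
  shows "E homotopy_equivalent_space F"
proof -
  let ?I = "top_of_set {0..1::real}"
  have tC: "topspace (subtopology B C) = C"
    using C by (simp add: inf.absorb2)
  have c0: "continuous_map B (subtopology B C) (\<lambda>b. r (0, b))"
  proof -
    have "continuous_map B B (r \<circ> Pair 0)"
      by (rule continuous_map_o_Pair [OF r]) simp
    then show ?thesis
      using r0 by (simp add: continuous_map_in_subtopology o_def image_subset_iff)
  qed
  have "continuous_map B F (\<theta> \<circ> (\<lambda>b. r (0, b)))"
    using c0 \<theta> continuous_map_compose quotient_imp_continuous_map by blast
  then obtain f where f: "continuous_map E F f" "\<And>b. b \<in> topspace B \<Longrightarrow> f (\<pi> b) = \<theta> (r (0, b))"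
  proof (rule quotient_map_lift_exists [OF \<pi>])
    show "(\<theta> \<circ> (\<lambda>b. r (0, b))) b = (\<theta> \<circ> (\<lambda>b. r (0, b))) b'"
      if "b \<in> topspace B" "b' \<in> topspace B" "\<pi> b = \<pi> b'" for b b'
      using fibC[OF r0 r0] fib[of 0 b b'] that by simp
  qed (use that in simp)
  have "continuous_map (subtopology B C) E \<pi>"
    using \<pi> continuous_map_from_subtopology quotient_imp_continuous_map by blast
  then obtain g where g: "continuous_map F E g" "\<And>b. b \<in> C \<Longrightarrow> g (\<theta> b) = \<pi> b"
  proof (rule quotient_map_lift_exists [OF \<theta>])
    show "\<pi> b = \<pi> b'" if "b \<in> topspace (subtopology B C)" "b' \<in> topspace (subtopology B C)" "\<theta> b = \<theta> b'" for b b'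
      using fibC that tC by simp
  qed (use tC in auto)
  \<comment> \<open>The interval is locally compact Hausdorff, so its product with
    \<open>\<pi>\<close> is again a quotient map; this makes the homotopy induced by
    \<open>r\<close> on \<open>E\<close> jointly continuous.\<close>
  have "quotient_map (prod_topology ?I B) (prod_topology ?I E) (\<lambda>(t, b). (t, \<pi> b))"
    by (rule quotient_map_prod_right [OF _ _ \<pi>])
      (auto simp: Hausdorff_space_subtopology locally_compact_space_closed_subset compact_imp_locally_compact_space
        compact_space_subtopology)
  moreover have "continuous_map (prod_topology ?I B) E (\<pi> \<circ> r)"
    by (rule continuous_map_compose [OF r quotient_imp_continuous_map [OF \<pi>]])
  ultimately obtain h where h: "continuous_map (prod_topology ?I E) E h"
    and h': "\<And>x. x \<in> topspace (prod_topology ?I B) \<Longrightarrow> h ((\<lambda>(t, b). (t, \<pi> b)) x) = (\<pi> \<circ> r) x"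
  proof (rule quotient_map_lift_exists)
    fix x y
    assume "x \<in> topspace (prod_topology ?I B)" "y \<in> topspace (prod_topology ?I B)"
      "(case x of (t, b) \<Rightarrow> (t, \<pi> b)) = (case y of (t, b) \<Rightarrow> (t, \<pi> b))"
    then show "(\<pi> \<circ> r) x = (\<pi> \<circ> r) y"
      using fib[of "fst x" "snd x" "snd y"] by (cases x; cases y) simp
  qed auto
  have h'': "h (t, \<pi> b) = \<pi> (r (t, b))" if "t \<in> {0..1}" "b \<in> topspace B" for t b
    using h'[of "(t, b)"] that by simp
  have E: "\<pi> ` topspace B = topspace E" and F: "\<theta> ` C = topspace F"
    using \<pi> \<theta> tC quotient_imp_surjective_map by metis+
  have "homotopic_with (\<lambda>x. True) E E (g \<circ> f) id"
    unfolding homotopic_with [of E "\<lambda>x. True", OF refl]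
  proof (intro exI[of _ h] conjI ballI)
    show "continuous_map (prod_topology ?I E) E h" by fact
    show "h (0, x) = (g \<circ> f) x" if x: "x \<in> topspace E" for x
    proof -
      obtain b where "b \<in> topspace B" "x = \<pi> b"
        using x E by blast
      then show ?thesis using g(2) f(2) r0 h''[of 0 b] by simp
    qed
    show "h (1, x) = id x" if x: "x \<in> topspace E" for x
    proof -
      obtain b where "b \<in> topspace B" "x = \<pi> b"
        using x E by blast
      then show ?thesis using r1 h''[of 1 b] by simp
    qed
  qed auto
  \<comment> \<open>On this side the composite is the identity on the nose, because
    \<open>r (0, _)\<close> fixes \<open>C\<close> pointwise.\<close>
  moreover have "homotopic_with (\<lambda>x. True) F F (f \<circ> g) id"
  proof (rule homotopic_with_id2)
    show "f (g x) = x" if x: "x \<in> topspace F" for x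
    proof -
      obtain b where "b \<in> C" "x = \<theta> b"
        using x F by blast
      then show ?thesis using g(2) f(2)[of b] C rC by auto
    qed
  qed
  ultimately show ?thesis
    unfolding homotopy_equivalent_space_def using f(1) g(1) by blast
qed

lemma continuous_map_glue:
  assumes "\<And>i. i \<in> I \<Longrightarrow> openin X (U i)" "topspace X \<subseteq> (\<Union>i\<in>I. U i)"
    and "\<And>i. i \<in> I \<Longrightarrow> continuous_map (subtopology X (U i)) Y f"
  shows "continuous_map X Y f"
  by (rule pasting_lemma [where I=I and T=U and f="\<lambda>_. f"]) (use assms in auto)

lemma homotopy_equivalent_space_disjoint_union:
  assumes op: "\<And>i. i \<in> I \<Longrightarrow> openin X (U i)" and disj: "disjoint_family_on U I"
    and cover: "(\<Union>i\<in>I. U i) = topspace X"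
    and he: "\<And>i. i \<in> I \<Longrightarrow> subtopology X (U i) homotopy_equivalent_space Y i"
  shows "X homotopy_equivalent_space sum_topology Y I"
proof -
  let ?J = "top_of_set {0..1::real}"
  let ?P = "\<lambda>i f g h h'. continuous_map (subtopology X (U i)) (Y i) f \<and>
    continuous_map (Y i) (subtopology X (U i)) g \<and>
    continuous_map (prod_topology ?J (subtopology X (U i))) (subtopology X (U i)) h \<and>
    (\<forall>x. h (0, x) = g (f x)) \<and> (\<forall>x. h (1, x) = x) \<and>
    continuous_map (prod_topology ?J (Y i)) (Y i) h' \<and>
    (\<forall>y. h' (0, y) = f (g y)) \<and> (\<forall>y. h' (1, y) = y)"
  have "\<exists>f g h h'. ?P i f g h h'" if "i \<in> I" for i
    using he[OF that] unfolding homotopy_equivalent_space_def homotopic_with_def o_apply id_apply by blast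
  then have "\<forall>i\<in>I. \<exists>q. ?P i (fst q) (fst (snd q)) (fst (snd (snd q))) (snd (snd (snd q)))"
    by force
  then obtain q where q: "\<forall>i\<in>I. ?P i (fst (q i)) (fst (snd (q i))) (fst (snd (snd (q i)))) (snd (snd (snd (q i))))"
    using bchoice by (metis (no_types, lifting))
  define f g h h' where "f i = fst (q i)" and "g i = fst (snd (q i))" and "h i = fst (snd (snd (q i)))"
    and "h' i = snd (snd (snd (q i)))" for i
  have
      f: "\<And>i. i \<in> I \<Longrightarrow> continuous_map (subtopology X (U i)) (Y i) (f i)"
    and g: "\<And>i. i \<in> I \<Longrightarrow> continuous_map (Y i) (subtopology X (U i)) (g i)"
    and h: "\<And>i. i \<in> I \<Longrightarrow> continuous_map (prod_topology ?J (subtopology X (U i))) (subtopology X (U i)) (h i)"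
    and h0: "\<And>i x. i \<in> I \<Longrightarrow> h i (0, x) = g i (f i x)" and h1: "\<And>i x. i \<in> I \<Longrightarrow> h i (1, x) = x"
    and h': "\<And>i. i \<in> I \<Longrightarrow> continuous_map (prod_topology ?J (Y i)) (Y i) (h' i)"
    and h'0: "\<And>i y. i \<in> I \<Longrightarrow> h' i (0, y) = f i (g i y)" and h'1: "\<And>i y. i \<in> I \<Longrightarrow> h' i (1, y) = y"
    using q unfolding f_def g_def h_def h'_def by blast+
  \<comment> \<open>The pieces are disjoint, so a point determines its index; the glued maps consult
    it to select the local map.\<close>
  define \<iota> where "\<iota> x = (THE i. i \<in> I \<and> x \<in> U i)" for x
  have \<iota>: "\<iota> x = i" if "i \<in> I" "x \<in> U i" for x i
    unfolding \<iota>_def using that disj by (intro the_equality) (auto simp: disjoint_family_on_def)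
  have UX: "U i \<subseteq> topspace X" if "i \<in> I" for i
    using that cover by blast
  define F where "F x = (\<iota> x, f (\<iota> x) x)" for x
  define G where "G = (\<lambda>(i, y). g i y)"
  define H where "H = (\<lambda>(t::real, x). h (\<iota> x) (t, x))"
  define H' where "H' = (\<lambda>(t::real, i, y). (i, h' i (t, y)))"
  have tU: "topspace (subtopology X (U i)) = U i" if "i \<in> I" for i
    using UX that by auto
  have F: "continuous_map X (sum_topology Y I) F"
  proof (rule continuous_map_glue [OF op])
    show "continuous_map (subtopology X (U i)) (sum_topology Y I) F" if "i \<in> I" for i
    proof (rule continuous_map_eq)
      show "continuous_map (subtopology X (U i)) (sum_topology Y I) (Pair i \<circ> f i)"
        by (rule continuous_map_compose [where X'="Y i"]) (simp_all add: f that continuous_map_component_injection)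
    qed (use that \<iota> F_def in auto)
  qed (use cover in auto)
  have slice: "openin (sum_topology Y I) (Pair i ` topspace (Y i))" if "i \<in> I" for i
    using that open_map_component_injection[of i I Y] by (auto simp: open_map_def)
  have emb: "embedding_map (Y i) (sum_topology Y I) (Pair i)" if "i \<in> I" for i
    using embedding_map_component_injection that by fast
  have snd_cont: "continuous_map (subtopology (sum_topology Y I) (Pair i ` topspace (Y i))) (Y i) snd" if i: "i \<in> I" for i
  proof -
    have "homeomorphic_map (Y i) (subtopology (sum_topology Y I) (Pair i ` topspace (Y i))) (Pair i)"
      using emb[OF i] by (simp add: embedding_map_def)
    then have "continuous_map (subtopology (sum_topology Y I) (Pair i ` topspace (Y i))) (Y i) snd
        \<longleftrightarrow> continuous_map (Y i) (Y i) (snd \<circ> Pair i)"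
      using emb[OF i] continuous_compose_quotient_map_eq unfolding homeomorphic_map_def by metis
    then show ?thesis by (simp add: o_def)
  qed
  have G: "continuous_map (sum_topology Y I) X G"
  proof (rule continuous_map_glue [OF slice])
    show "continuous_map (subtopology (sum_topology Y I) (Pair i ` topspace (Y i))) X G" if i: "i \<in> I" for i
    proof (rule continuous_map_eq)
      show "continuous_map (subtopology (sum_topology Y I) (Pair i ` topspace (Y i))) X (g i \<circ> snd)"
        by (rule continuous_map_compose [OF snd_cont[OF i] continuous_map_into_fulltopology [OF g[OF i]]])
    qed (auto simp: G_def)
  qed auto
  have H: "continuous_map (prod_topology ?J X) X H"
  proof (rule continuous_map_glue)
    show "openin (prod_topology ?J X) ({0..1} \<times> U i)" if "i \<in> I" for i
      using op that by (simp add: openin_prod_Times_iff)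
    show "continuous_map (subtopology (prod_topology ?J X) ({0..1} \<times> U i)) X H" if i: "i \<in> I" for i
    proof (rule continuous_map_eq)
      show "continuous_map (subtopology (prod_topology ?J X) ({0..1} \<times> U i)) X (h i)"
        using h[OF i] continuous_map_into_fulltopology
        by (simp add: subtopology_Times subtopology_subtopology)
    qed (use i \<iota> H_def in auto)
  qed (use cover in auto)
  have H': "continuous_map (prod_topology ?J (sum_topology Y I)) (sum_topology Y I) H'"
  proof (rule continuous_map_glue)
    show "openin (prod_topology ?J (sum_topology Y I)) ({0..1} \<times> (Pair i ` topspace (Y i)))" if "i \<in> I" for i
      using slice that by (simp add: openin_prod_Times_iff)
    show "continuous_map (subtopology (prod_topology ?J (sum_topology Y I)) ({0..1} \<times> (Pair i ` topspace (Y i))))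
        (sum_topology Y I) H'" if i: "i \<in> I" for i
    proof (rule continuous_map_eq)
      have "continuous_map (prod_topology ?J (subtopology (sum_topology Y I) (Pair i ` topspace (Y i))))
          (prod_topology ?J (Y i)) (\<lambda>(t, y). (t, snd y))"
        using snd_cont[OF i] by (auto simp: continuous_map_prod_top)
      then have "continuous_map (prod_topology ?J (subtopology (sum_topology Y I) (Pair i ` topspace (Y i))))
          (sum_topology Y I) (Pair i \<circ> (h' i \<circ> (\<lambda>(t, y). (t, snd y))))"
        by (rule continuous_map_compose [OF continuous_map_compose [OF _ h'[OF i]], where X''="sum_topology Y I"])
          (simp_all add: i continuous_map_component_injection)
      then show "continuous_map (subtopology (prod_topology ?J (sum_topology Y I)) ({0..1} \<times> (Pair i ` topspace (Y i))))
          (sum_topology Y I) (Pair i \<circ> (h' i \<circ> (\<lambda>(t, y). (t, snd y))))"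
        by (simp add: subtopology_Times subtopology_subtopology)
    qed (auto simp: H'_def)
  qed auto
  have gU: "g i y \<in> U i" if "i \<in> I" "y \<in> topspace (Y i)" for i y
    using continuous_map_image_subset_topspace[OF g[OF that(1)]] that tU by blast
  have "homotopic_with (\<lambda>x. True) X X (G \<circ> F) id"
    unfolding homotopic_with [of X "\<lambda>x. True", OF refl]
    by (intro exI[of _ H] conjI ballI H) (auto simp flip: cover simp: H_def G_def F_def h0 h1 \<iota>)
  moreover have "homotopic_with (\<lambda>x. True) (sum_topology Y I) (sum_topology Y I) (F \<circ> G) id"
    unfolding homotopic_with [of "sum_topology Y I" "\<lambda>x. True", OF refl]
    by (intro exI[of _ H'] conjI ballI H') (auto simp: H'_def G_def F_def h'0 h'1 \<iota>[OF _ gU])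
  ultimately show ?thesis
    unfolding homotopy_equivalent_space_def using F G by blast
qed

text \<open>All pieces share the factor \<open>A\<close>, so only their numbers of points add up.
  Both sides are compared with the same \<open>sum_topology\<close>: the labels of the target are
  cut into consecutive blocks, with \<open>c i\<close> labels for piece \<open>i\<close>.\<close>

lemma homotopy_equivalent_space_disjoint_union_discrete:
  fixes c :: "nat \<Rightarrow> nat"
  assumes "\<And>i. i < v \<Longrightarrow> openin X (U i)" "disjoint_family_on U {..<v}" "(\<Union>i<v. U i) = topspace X"
    and "\<And>i. i < v \<Longrightarrow> subtopology X (U i) homotopy_equivalent_space prod_topology A (discrete_topology {..<c i})"
  shows "X homotopy_equivalent_space prod_topology A (discrete_topology {..<\<Sum>i<v. c i})"
proof -
  let ?P = "prod_topology A (discrete_topology {..<\<Sum>i<v. c i})"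
  define s where "s i = (\<Sum>j<i. c j)" for i
  define V where "V i = topspace A \<times> {s i..<s (Suc i)}" for i
  have s: "s i \<le> s j" if "i \<le> j" for i j
    unfolding s_def using that by (intro sum_mono2) auto
  have "?P homotopy_equivalent_space sum_topology (\<lambda>i. prod_topology A (discrete_topology {..<c i})) {..<v}"
  proof (rule homotopy_equivalent_space_disjoint_union)
    fix i assume i: "i \<in> {..<v}"
    have sub: "{s i..<s (Suc i)} \<subseteq> {..<\<Sum>i<v. c i}"
      using s[of "Suc i" v] i by (auto simp: s_def)
    then show "openin ?P (V i)"
      by (simp add: V_def openin_prod_Times_iff)
    have "homeomorphic_map (discrete_topology {..<c i}) (discrete_topology {s i..<s (Suc i)}) (\<lambda>j. s i + j)"
    proof -
      have "(\<lambda>j. s i + j) ` {..<c i} = {s i..<s i + c i}"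
        by (metis add.commute image_add_atLeastLessThan lessThan_atLeast0 add_0)
      then show ?thesis
        by (intro bijective_open_imp_homeomorphic_map) (auto simp: open_map_def s_def lessThan_Suc image_subset_iff)
    qed
    then have "discrete_topology {..<c i} homeomorphic_space discrete_topology {s i..<s (Suc i)}"
      by (rule homeomorphic_map_imp_homeomorphic_space)
    then have "prod_topology A (discrete_topology {..<c i}) homeomorphic_space
        prod_topology A (discrete_topology {s i..<s (Suc i)})"
      by (simp add: homeomorphic_space_prod_topology homeomorphic_space_refl)
    moreover have "subtopology ?P (V i) = prod_topology A (discrete_topology {s i..<s (Suc i)})"
      using sub by (simp add: V_def subtopology_Times inf.absorb2 Int_absorb1)
    ultimately show "subtopology ?P (V i) homotopy_equivalent_space prod_topology A (discrete_topology {..<c i})"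
      using homeomorphic_imp_homotopy_equivalent_space homeomorphic_space_sym by metis
  next
    have "V i \<inter> V j = {}" if "i < j" for i j
      using s[of "Suc i" j] that by (auto simp: V_def)
    then show "disjoint_family_on V {..<v}"
      unfolding disjoint_family_on_def by (metis inf_commute linorder_neqE_nat)
    have "(\<Union>i<v. {s i..<s (Suc i)}) = {..<s v}"
    proof (induction v)
      case (Suc v)
      then show ?case using s[of v "Suc v"] by (auto simp: lessThan_Suc)
    qed (simp add: s_def)
    moreover have "(\<Union>i<v. V i) = topspace A \<times> (\<Union>i<v. {s i..<s (Suc i)})"
      unfolding V_def by blast
    ultimately show "(\<Union>i<v. V i) = topspace ?P"
      by (simp add: s_def)
  qed
  moreover have "X homotopy_equivalent_space sum_topology (\<lambda>i. prod_topology A (discrete_topology {..<c i})) {..<v}"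
    by (rule homotopy_equivalent_space_disjoint_union [where U=U]) (use assms in auto)
  ultimately show ?thesis
    using homotopy_eqv_trans homotopy_equivalent_space_sym by blast
qed

section \<open>Quotients of monomial level sets by roots of unity\<close>

lemma topspace_punctured_plane [simp]: "topspace punctured_plane = - {0}"
  by (auto simp: punctured_plane_def)

lemma continuous_map_punctured_plane:
  "continuous_map (top_of_set S) punctured_plane f \<longleftrightarrow> continuous_on S f \<and> (\<forall>x\<in>S. f x \<noteq> 0)"
  by (auto simp: punctured_plane_def continuous_map_in_subtopology)

lemma continuous_map_mult_powi:
  assumes "continuous_map X punctured_plane f" "continuous_map X punctured_plane g"
  shows "continuous_map X punctured_plane (\<lambda>x. f x * g x powi q)"
proof -
  have "prod_topology punctured_plane punctured_plane = top_of_set ((- {0}) \<times> (- {0}))"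
    by (simp add: punctured_plane_def Compl_eq_Diff_UNIV flip: subtopology_Times)
  then have "continuous_map (prod_topology punctured_plane punctured_plane) punctured_plane (\<lambda>(z, w). z * w powi q)"
    by (auto simp: continuous_map_punctured_plane case_prod_unfold intro!: continuous_intros)
  moreover have "continuous_map X (prod_topology punctured_plane punctured_plane) (\<lambda>x. (f x, g x))"
    using assms by (simp add: continuous_map_paired)
  ultimately have "continuous_map X punctured_plane ((\<lambda>(z, w). z * w powi q) \<circ> (\<lambda>x. (f x, g x)))"
    by (rule continuous_map_compose [rotated])
  then show ?thesis by (simp add: o_def)
qed

lemma homeomorphic_maps_product_topology_insert:
  assumes a: "a \<notin> I"
  shows "homeomorphic_maps (prod_topology (product_topology X I) (X a)) (product_topology X (insert a I))
    (\<lambda>(f, z). f(a := z)) (\<lambda>f. (restrict f I, f a))"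
  unfolding homeomorphic_maps_def
proof (intro conjI)
  show "continuous_map (prod_topology (product_topology X I) (X a)) (product_topology X (insert a I)) (\<lambda>(f, z). f(a := z))"
    unfolding continuous_map_componentwise
  proof (intro conjI ballI)
    show "(\<lambda>(f, z). f(a := z)) ` topspace (prod_topology (product_topology X I) (X a)) \<subseteq> extensional (insert a I)"
      by (auto simp: extensional_def PiE_def)
    have fst: "continuous_map (prod_topology (product_topology X I) (X a)) (X i) (\<lambda>x. fst x i)" if "i \<in> I" for i
      using continuous_map_compose [OF continuous_map_fst continuous_map_product_projection [OF that]]
      by (simp add: o_def)
    show "continuous_map (prod_topology (product_topology X I) (X a)) (X i) (\<lambda>x. (case x of (f, z) \<Rightarrow> f(a := z)) i)"
      if "i \<in> insert a I" for i
      using that fst continuous_map_snd a by (cases "i = a") (auto simp: case_prod_unfold)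
  qed
  show "continuous_map (product_topology X (insert a I)) (prod_topology (product_topology X I) (X a)) (\<lambda>f. (restrict f I, f a))"
    by (auto simp: continuous_map_paired continuous_map_componentwise intro!: continuous_map_product_projection)
qed (use a in \<open>auto simp: PiE_def extensional_def fun_eq_iff\<close>)

text \<open>The image of C_k under the power \<open>w\<close> is the group of roots of unity of
  order dividing k / gcd(k, w). For a preimage of \<open>\<rho>\<close>, take a root of
  \<open>\<rho>\<close> of degree gcd(k, w), which is itself a k-th root of unity, and raise it to
  the Bezout coefficient that inverts \<open>w\<close> up to this gcd modulo k.\<close>

lemma root_of_unity_powi_exists:
  fixes \<rho> :: complex and k :: nat and w :: int
  assumes k: "k > 0" and \<rho>: "\<rho> ^ (k div nat (gcd (int k) w)) = 1"
  shows "\<exists>\<eta>. \<eta> ^ k = 1 \<and> \<eta> powi w = \<rho>"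
proof -
  define g where "g = nat (gcd (int k) w)"
  have g: "int g = gcd (int k) w" "g > 0" "g dvd k"
    using k by (simp_all add: g_def) (metis gcd_dvd1 gcd_ge_0_int int_dvd_int_iff int_nat_eq)
  obtain u v where uv: "u * int k + v * w = gcd (int k) w"
    using bezout_int by blast
  have "\<rho> \<noteq> 0"
    using \<rho> g k by (metis dvd_div_eq_0_iff g_def not_gr_zero power_0_left zero_neq_one)
  obtain \<theta> where \<theta>: "\<rho> = \<theta> ^ g"
    using exists_complex_root [of g \<rho>] g(2) by auto
  have "\<theta> ^ k = (\<theta> ^ g) ^ (k div g)"
    using g(3) by (metis dvd_mult_div_cancel power_mult)
  then have "\<theta> ^ k = 1"
    using \<rho> \<theta> by (simp add: g_def)
  then have k1: "\<theta> powi (int k) = 1" and "\<theta> \<noteq> 0"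
    using k by (auto simp: power_0_left)
  have "(\<theta> powi v) ^ k = 1"
    using k1 by (simp add: power_int_power' mult.commute[of v] power_int_mult)
  moreover have "v * w = int g - u * int k"
    using uv g(1) by linarith
  then have "(\<theta> powi v) powi w = \<theta> powi (int g - u * int k)"
    by (simp flip: power_int_mult)
  then have "(\<theta> powi v) powi w = \<rho>"
    using \<open>\<theta> \<noteq> 0\<close> \<theta> k1 by (simp add: power_int_diff mult.commute[of u] power_int_mult)
  ultimately show ?thesis by blast
qed

definition monomial_level :: "'i set \<Rightarrow> ('i \<Rightarrow> int) \<Rightarrow> complex \<Rightarrow> ('i \<Rightarrow> complex) topology" where
  "monomial_level I \<alpha> c = subtopology (product_topology (\<lambda>_. punctured_plane) I) {t. (\<Prod>i\<in>I. t i powi \<alpha> i) = c}"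

definition torus_times_discrete :: "nat \<Rightarrow> nat \<Rightarrow> ((nat \<Rightarrow> complex) \<times> nat) topology" where
  "torus_times_discrete b m =
     prod_topology (product_topology (\<lambda>_. punctured_plane) {..<b}) (discrete_topology {..<m})"

text \<open>The quotient of the level set by C_k, with weight \<open>w i\<close> on coordinate
  \<open>i\<close>, is described by a quotient map whose fibres are the orbits. In this form it can
  be precomposed with substitutions, and it supplies the map \<open>\<theta>\<close> that
  \<open>quotient_homotopy_equivalent_space\<close> asks for.\<close>

definition root_quotient ::
  "nat \<Rightarrow> 'i set \<Rightarrow> ('i \<Rightarrow> int) \<Rightarrow> ('i \<Rightarrow> int) \<Rightarrow> complex \<Rightarrow> nat \<Rightarrow> nat \<Rightarrow> (('i \<Rightarrow> complex) \<Rightarrow> (nat \<Rightarrow> complex) \<times> nat) \<Rightarrow> bool" where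
  "root_quotient k I \<alpha> w c b m \<theta> \<longleftrightarrow>
     quotient_map (monomial_level I \<alpha> c) (torus_times_discrete b m) \<theta> \<and>
     (\<forall>s\<in>topspace (monomial_level I \<alpha> c). \<forall>t\<in>topspace (monomial_level I \<alpha> c).
        \<theta> s = \<theta> t \<longleftrightarrow> (\<exists>\<eta>. \<eta> ^ k = 1 \<and> (\<forall>i\<in>I. t i = \<eta> powi w i * s i)))"

lemma topspace_monomial_level:
  "topspace (monomial_level I \<alpha> c) = {t \<in> I \<rightarrow>\<^sub>E - {0}. (\<Prod>i\<in>I. t i powi \<alpha> i) = c}"
  by (auto simp: monomial_level_def)

text \<open>The extra factor \<open>t j powi (q * \<alpha> i)\<close> coming from coordinate
  \<open>i\<close> is cancelled by the lowered exponent of coordinate \<open>j\<close>.\<close>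

lemma prod_fun_upd_mult_powi:
  fixes t :: "'i \<Rightarrow> complex"
  assumes I: "finite I" "i \<in> I" "j \<in> I" "i \<noteq> j" and t: "\<And>x. x \<in> I \<Longrightarrow> t x \<noteq> 0"
  shows "(\<Prod>x\<in>I. (t(i := t i * t j powi q)) x powi (\<alpha>(j := \<alpha> j - q * \<alpha> i)) x) = (\<Prod>x\<in>I. t x powi \<alpha> x)"
proof -
  have eq: "(\<Prod>x\<in>I. f x) = f i * (f j * (\<Prod>x\<in>I - {i} - {j}. f x))" for f :: "'i \<Rightarrow> complex"
    using I by (simp add: prod.remove[of I i] prod.remove[of "I - {i}" j])
  have "(\<Prod>x\<in>I - {i} - {j}. (t(i := t i * t j powi q)) x powi (\<alpha>(j := \<alpha> j - q * \<alpha> i)) x)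
      = (\<Prod>x\<in>I - {i} - {j}. t x powi \<alpha> x)"
    by (intro prod.cong) auto
  moreover have "t j powi (\<alpha> j - q * \<alpha> i) = t j powi \<alpha> j / t j powi (q * \<alpha> i)"
    using t I by (simp add: power_int_diff)
  ultimately show ?thesis
    using I t unfolding eq by (simp add: power_int_mult_distrib power_int_mult field_simps)
qed

text \<open>
  The substitution \<open>t\<^sub>i \<mapsto> t\<^sub>i t\<^sub>j\<^sup>q\<close> is one step of Euclid's algorithm, on the exponents \<open>\<alpha>\<close> or on the weights \<open>w\<close>.
\<close>

lemma root_quotient_elementary:
  assumes I: "finite I" "i \<in> I" "j \<in> I" "i \<noteq> j" and k: "k > 0"
    and ex: "\<exists>\<theta>. root_quotient k I (\<alpha>(j := \<alpha> j - q * \<alpha> i)) (w(i := w i + q * w j)) c b m \<theta>"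
  shows "\<exists>\<theta>. root_quotient k I \<alpha> w c b m \<theta>"
proof -
  let ?\<alpha> = "\<alpha>(j := \<alpha> j - q * \<alpha> i)" and ?w = "w(i := w i + q * w j)"
  let ?T = "product_topology (\<lambda>_. punctured_plane) I"
  obtain \<theta> where \<theta>: "root_quotient k I ?\<alpha> ?w c b m \<theta>"
    using ex by blast
  define \<phi> where "\<phi> p t = t(i := t i * t j powi p)" for p and t :: "'a \<Rightarrow> complex"
  have cont: "continuous_map ?T ?T (\<phi> p)" for p
    unfolding continuous_map_componentwise
  proof (intro conjI ballI)
    show "\<phi> p ` topspace ?T \<subseteq> extensional I"
      using I by (auto simp: \<phi>_def extensional_def PiE_def)
    show "continuous_map ?T punctured_plane (\<lambda>t. \<phi> p t x)" if "x \<in> I" for x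
      using that I by (cases "x = i") (auto simp: \<phi>_def intro!: continuous_map_mult_powi continuous_map_product_projection)
  qed
  have inv: "\<phi> (- p) (\<phi> p t) = t" if "t \<in> topspace ?T" for p t
    using that I by (auto simp: \<phi>_def fun_eq_iff power_int_minus PiE_iff)
  have hom: "homeomorphic_maps ?T ?T (\<phi> q) (\<phi> (- q))"
    unfolding homeomorphic_maps_def using cont inv[of _ q] inv[of _ "- q"] by simp
  have lev: "(\<Prod>x\<in>I. \<phi> q t x powi ?\<alpha> x) = (\<Prod>x\<in>I. t x powi \<alpha> x)" if "t \<in> topspace ?T" for t
    unfolding \<phi>_def by (rule prod_fun_upd_mult_powi) (use I that in \<open>auto simp: PiE_iff\<close>)
  have sub: "\<phi> q ` topspace ?T \<subseteq> topspace ?T" "\<phi> (- q) ` topspace ?T \<subseteq> topspace ?T"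
    by (intro continuous_map_image_subset_topspace cont)+
  have "homeomorphic_maps (monomial_level I \<alpha> c) (monomial_level I ?\<alpha> c) (\<phi> q) (\<phi> (- q))"
    unfolding monomial_level_def
  proof (intro homeomorphic_maps_subtopologies_alt hom)
    show "\<phi> q ` (topspace ?T \<inter> {t. (\<Prod>i\<in>I. t i powi \<alpha> i) = c}) \<subseteq> {t. (\<Prod>i\<in>I. t i powi ?\<alpha> i) = c}"
      using lev by (simp add: image_subset_iff)
    show "\<phi> (- q) ` (topspace ?T \<inter> {t. (\<Prod>i\<in>I. t i powi ?\<alpha> i) = c}) \<subseteq> {t. (\<Prod>i\<in>I. t i powi \<alpha> i) = c}"
    proof (clarify)
      fix t assume t: "t \<in> topspace ?T"
      then have "(\<Prod>i\<in>I. \<phi> (- q) t i powi \<alpha> i) = (\<Prod>i\<in>I. \<phi> q (\<phi> (- q) t) i powi ?\<alpha> i)"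
        using lev[of "\<phi> (- q) t"] sub by (metis image_subset_iff)
      also have "\<phi> q (\<phi> (- q) t) = t"
        using inv[OF t, of "- q"] by simp
      finally show "(\<Prod>i\<in>I. \<phi> (- q) t i powi \<alpha> i) = (\<Prod>i\<in>I. t i powi ?\<alpha> i)" .
    qed
  qed
  then have hom: "homeomorphic_map (monomial_level I \<alpha> c) (monomial_level I ?\<alpha> c) (\<phi> q)"
    using homeomorphic_map_maps by blast
  have "root_quotient k I \<alpha> w c b m (\<theta> \<circ> \<phi> q)"
    unfolding root_quotient_def
  proof (intro conjI ballI)
    show "quotient_map (monomial_level I \<alpha> c) (torus_times_discrete b m) (\<theta> \<circ> \<phi> q)"
      using hom \<theta> unfolding root_quotient_def homeomorphic_map_def by (blast intro: quotient_map_compose)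
    fix s t
    assume s: "s \<in> topspace (monomial_level I \<alpha> c)" and t: "t \<in> topspace (monomial_level I \<alpha> c)"
    have "\<phi> q s \<in> topspace (monomial_level I ?\<alpha> c)" "\<phi> q t \<in> topspace (monomial_level I ?\<alpha> c)"
      using s t hom homeomorphic_imp_surjective_map by blast+
    then have "(\<theta> \<circ> \<phi> q) s = (\<theta> \<circ> \<phi> q) t \<longleftrightarrow> (\<exists>\<eta>. \<eta> ^ k = 1 \<and> (\<forall>x\<in>I. \<phi> q t x = \<eta> powi ?w x * \<phi> q s x))"
      using \<theta> by (simp add: root_quotient_def)
    also have "\<dots> \<longleftrightarrow> (\<exists>\<eta>. \<eta> ^ k = 1 \<and> (\<forall>x\<in>I. t x = \<eta> powi w x * s x))"
    proof (intro ex_cong1 conj_cong refl)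
      fix \<eta> :: complex
      assume "\<eta> ^ k = 1"
      then have \<eta>: "\<eta> \<noteq> 0"
        using k by (auto simp: power_0_left)
      \<comment> \<open>The new coordinate is the product of \<open>t i\<close> and a power of
        \<open>t j\<close>, so its weight is \<open>w i + q * w j\<close>. Given the relation at
        \<open>j\<close>, where nothing vanishes, the relation at \<open>i\<close> before the
        substitution is equivalent to the one after it.\<close>
      have eq: "\<eta> powi (w i + q * w j) * (s i * s j powi q) = (\<eta> powi w i * s i) * (\<eta> powi w j * s j) powi q"
        using \<eta> by (simp add: power_int_add power_int_mult_distrib mult.commute[of q "w j"] power_int_mult)
      have ij: "t i = \<eta> powi w i * s i" if "t j = \<eta> powi w j * s j" "t i * t j powi q = \<eta> powi (w i + q * w j) * (s i * s j powi q)"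
      proof -
        have "t j \<noteq> 0" using t I by (auto simp: topspace_monomial_level PiE_iff)
        then show ?thesis
          using that unfolding eq by (metis mult_right_cancel power_int_eq_0_iff)
      qed
      have ij': "t i * t j powi q = \<eta> powi (w i + q * w j) * (s i * s j powi q)" if "t j = \<eta> powi w j * s j" "t i = \<eta> powi w i * s i"
        using that unfolding eq by simp
      show "(\<forall>x\<in>I. \<phi> q t x = \<eta> powi ?w x * \<phi> q s x) \<longleftrightarrow> (\<forall>x\<in>I. t x = \<eta> powi w x * s x)" (is "?L \<longleftrightarrow> ?R")
      proof
        assume L: ?L
        then have "t j = \<eta> powi w j * s j" "t i * t j powi q = \<eta> powi (w i + q * w j) * (s i * s j powi q)"
          using I by (auto simp: \<phi>_def split: if_splits)
        then have "t i = \<eta> powi w i * s i" by (rule ij)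
        moreover have "t x = \<eta> powi w x * s x" if "x \<in> I" "x \<noteq> i" for x
          using L[rule_format, OF that(1)] that(2) by (simp add: \<phi>_def)
        ultimately show ?R by blast
      next
        assume ?R
        then have R: "t x = \<eta> powi w x * s x" if "x \<in> I" for x
          using that by blast
        have "\<phi> q t x = \<eta> powi ?w x * \<phi> q s x" if "x \<in> I" for x
          using R[OF that] ij'[OF R[OF I(3)] R[OF I(2)]] by (cases "x = i") (simp_all add: \<phi>_def)
        then show ?L by blast
      qed
    qed
    finally show "(\<theta> \<circ> \<phi> q) s = (\<theta> \<circ> \<phi> q) t \<longleftrightarrow> (\<exists>\<eta>. \<eta> ^ k = 1 \<and> (\<forall>x\<in>I. t x = \<eta> powi w x * s x))" .
  qed
  then show ?thesis by blast
qed

text \<open>As \<open>\<eta>\<close> runs through C_k, \<open>\<eta> powi w\<close> runs through the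
  roots of unity of order dividing M = k / gcd(k, w). So the class of a root \<open>s\<close> is
  recorded by \<open>s ^ M\<close>, which runs through the solutions of an equation of degree
  |\<gamma>| / M.\<close>

lemma root_class_map_exists:
  fixes k :: nat and \<gamma> w :: int and c :: complex
  assumes k: "k > 0" and \<gamma>: "\<gamma> \<noteq> 0" and c: "c \<noteq> 0" and dvd: "int k dvd \<gamma> * w"
  shows "finite {s. s powi \<gamma> = c} \<and> (\<exists>\<kappa>. \<kappa> ` {s. s powi \<gamma> = c} = {..<nat (gcd \<gamma> (\<gamma> * w div int k))} \<and>
    (\<forall>s t. s powi \<gamma> = c \<longrightarrow> t powi \<gamma> = c \<longrightarrow> \<kappa> s = \<kappa> t \<longleftrightarrow> (\<exists>\<eta>. \<eta> ^ k = 1 \<and> t = \<eta> powi w * s)))"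
proof -
  define G where "G = nat \<bar>\<gamma>\<bar>"
  \<comment> \<open>Inverting \<open>c\<close> turns a negative exponent into a positive
    one.\<close>
  define c' where "c' = (if \<gamma> \<ge> 0 then c else inverse c)"
  have G: "G > 0" "int G = \<bar>\<gamma>\<bar>" and c': "c' \<noteq> 0"
    using \<gamma> c by (auto simp: G_def c'_def)
  have D: "s powi \<gamma> = c \<longleftrightarrow> s ^ G = c'" for s
    by (auto simp: c'_def G_def power_int_def field_simps power_inverse inverse_eq_iff_eq)
  define g where "g = nat (gcd (int k) w)"
  define M where "M = k div g"
  define m where "m = nat (gcd \<gamma> (\<gamma> * w div int k))"
  have g: "int g = gcd (int k) w" "g > 0"
    using k by (simp_all add: g_def)
  then have gk: "g dvd k"
    by (metis gcd_dvd1 int_dvd_int_iff)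
  have kM: "k = M * g" and M: "M > 0"
    using gk k by (auto simp: M_def)
  \<comment> \<open>Both sides become |\<gamma>| gcd(k, w), and dividing by k identifies the claimed
    number of classes with |\<gamma>| / M.\<close>
  have "int k * gcd \<gamma> (\<gamma> * w div int k) = gcd (int k * \<gamma>) (\<gamma> * w)"
  proof -
    obtain q where "\<gamma> * w = int k * q"
      using dvd by blast
    then show ?thesis
      using gcd_mult_distrib_int [of "int k" \<gamma> q] k by simp
  qed
  also have "\<dots> = int g * int G"
    unfolding g(1) G(2) using gcd_mult_distrib_int [of \<gamma> "int k" w] by (simp only: mult.commute)
  finally have "int k * int m = int g * int G"
    by (simp add: m_def)
  then have "M * g * m = g * G"
    unfolding kM by (metis of_nat_eq_iff of_nat_mult)
  then have Gm: "G = M * m"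
    using g(2) by simp
  then have m: "m > 0"
    using G(1) by (cases m) auto
  have "card {z. z ^ m = c'} = m"
    using card_nth_roots [of c' m] c' m by simp
  moreover have "finite {z. z ^ m = c'}"
    using calculation m card_ge_0_finite by force
  ultimately obtain \<beta> where \<beta>: "bij_betw \<beta> {z. z ^ m = c'} {..<m}"
    by (metis bij_betw_iff_card card_lessThan finite_lessThan)
  define \<kappa> where "\<kappa> s = \<beta> (s ^ M)" for s
  have im: "(\<lambda>s. s ^ M) ` {s. s ^ G = c'} = {z. z ^ m = c'}"
  proof (intro equalityI subsetI)
    fix z assume "z \<in> {z. z ^ m = c'}"
    moreover obtain s where "z = s ^ M"
      using exists_complex_root [of M z] M by auto
    ultimately show "z \<in> (\<lambda>s. s ^ M) ` {s. s ^ G = c'}"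
      by (auto simp: Gm power_mult)
  qed (auto simp: Gm power_mult)
  have "\<kappa> ` {s. s ^ G = c'} = {..<m}"
    using \<beta> unfolding \<kappa>_def bij_betw_def im[symmetric] image_image by simp
  moreover have "\<kappa> s = \<kappa> t \<longleftrightarrow> (\<exists>\<eta>. \<eta> ^ k = 1 \<and> t = \<eta> powi w * s)" if st: "s ^ G = c'" "t ^ G = c'" for s t
  proof -
    have s0: "s \<noteq> 0" and t0: "t \<noteq> 0" using st c' G by (auto simp: power_0_left)
    have "s ^ M \<in> {z. z ^ m = c'}" "t ^ M \<in> {z. z ^ m = c'}"
      using st by (simp_all add: Gm power_mult)
    then have "\<kappa> s = \<kappa> t \<longleftrightarrow> s ^ M = t ^ M"
      unfolding \<kappa>_def by (rule inj_on_eq_iff [OF bij_betw_imp_inj_on [OF \<beta>]])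
    also have "\<dots> \<longleftrightarrow> (\<exists>\<eta>. \<eta> ^ k = 1 \<and> t = \<eta> powi w * s)"
    proof
      assume "s ^ M = t ^ M"
      then have "(t / s) ^ M = 1"
        using s0 t0 by (simp add: power_divide)
      then obtain \<eta> where "\<eta> ^ k = 1" "\<eta> powi w = t / s"
        using root_of_unity_powi_exists [OF k] unfolding M_def g_def by blast
      then show "\<exists>\<eta>. \<eta> ^ k = 1 \<and> t = \<eta> powi w * s"
        using s0 by (intro exI[of _ \<eta>]) simp
    next
      assume "\<exists>\<eta>. \<eta> ^ k = 1 \<and> t = \<eta> powi w * s"
      then obtain \<eta> where \<eta>: "\<eta> ^ k = 1" "t = \<eta> powi w * s"
        by blast
      obtain w' where w': "w = int g * w'"
        using g(1) by (metis dvdE gcd_dvd2)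
      have "(\<eta> powi w) ^ M = (\<eta> ^ k) powi w'"
        by (simp add: power_int_power' power_int_power kM w' mult_ac)
      then show "s ^ M = t ^ M"
        using \<eta> by (simp add: power_mult_distrib)
    qed
    finally show ?thesis .
  qed
  moreover have "finite {s. s ^ G = c'}"
    using card_nth_roots [of c' G] c' G(1) card_ge_0_finite by force
  ultimately show ?thesis
    unfolding D m_def[symmetric] by blast
qed

section \<open>Base cases: a free coordinate, a coordinate confined to roots, and a pair of
  both\<close>

lemma monomial_level_insert:
  assumes a: "a \<notin> I" and I: "finite I" and \<alpha>: "\<alpha> a = 0"
  shows "homeomorphic_maps (prod_topology (monomial_level I \<alpha> c) punctured_plane) (monomial_level (insert a I) \<alpha> c)
    (\<lambda>(f, z). f(a := z)) (\<lambda>f. (restrict f I, f a))"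
proof -
  let ?S = "{t. (\<Prod>i\<in>I. t i powi \<alpha> i) = c}"
  have upd: "(\<Prod>i\<in>I. (f(a := z)) i powi \<alpha> i) = (\<Prod>i\<in>I. f i powi \<alpha> i)" for f and z :: complex
    by (intro prod.cong) (use a in auto)
  have [simp]: "(\<Prod>i\<in>I. restrict f I i powi \<alpha> i) = (\<Prod>i\<in>I. f i powi \<alpha> i)" for f :: "'a \<Rightarrow> complex"
    by (intro prod.cong) auto
  have "prod_topology (monomial_level I \<alpha> c) punctured_plane =
      subtopology (prod_topology (product_topology (\<lambda>_. punctured_plane) I) punctured_plane) (?S \<times> UNIV)"
    by (simp add: monomial_level_def subtopology_Times)
  moreover have "monomial_level (insert a I) \<alpha> c = subtopology (product_topology (\<lambda>_. punctured_plane) (insert a I)) ?S"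
    using a I \<alpha> by (simp add: monomial_level_def)
  moreover have "homeomorphic_maps
      (subtopology (prod_topology (product_topology (\<lambda>_. punctured_plane) I) punctured_plane) (?S \<times> UNIV))
      (subtopology (product_topology (\<lambda>_. punctured_plane) (insert a I)) ?S)
      (\<lambda>(f, z). f(a := z)) (\<lambda>f. (restrict f I, f a))"
    by (intro homeomorphic_maps_subtopologies_alt homeomorphic_maps_product_topology_insert a)
      (use a I \<alpha> in \<open>auto simp: upd simp del: fun_upd_apply\<close>)
  ultimately show ?thesis
    by simp
qed

lemma punctured_plane_locally_compact: "locally_compact_space punctured_plane"
  unfolding punctured_plane_def
  by (intro locally_compact_space_open_subset) (auto simp: locally_compact_space_euclidean Hausdorff_space_euclidean)

lemma Hausdorff_space_punctured_plane: "Hausdorff_space punctured_plane"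
  unfolding punctured_plane_def by (simp add: Hausdorff_space_subtopology)

text \<open>A coordinate with exponent 0 and weight 0 is neither constrained nor moved, so it splits
  off as a factor. The product of \<open>\<theta>\<close> with the identity is a quotient map
  because the punctured plane is locally compact Hausdorff.\<close>

lemma root_quotient_insert:
  assumes a: "a \<notin> I" and I: "finite I" and \<alpha>: "\<alpha> a = 0" and w: "w a = 0"
    and ex: "\<exists>\<theta>. root_quotient k I \<alpha> w c b m \<theta>"
  shows "\<exists>\<theta>. root_quotient k (insert a I) \<alpha> w c (Suc b) m \<theta>"
proof -
  obtain \<theta> where \<theta>: "root_quotient k I \<alpha> w c b m \<theta>"
    using ex by blast
  let ?L = "monomial_level I \<alpha> c" and ?L' = "monomial_level (insert a I) \<alpha> c"
  let ?P = "product_topology (\<lambda>_. punctured_plane) {..<b} :: (nat \<Rightarrow> complex) topology"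
    and ?D = "discrete_topology {..<m}"
  have 1: "homeomorphic_map ?L' (prod_topology ?L punctured_plane) (\<lambda>f. (restrict f I, f a))"
    using monomial_level_insert [of a I \<alpha> c, OF a I \<alpha>] homeomorphic_maps_sym homeomorphic_map_maps by blast
  have 2: "quotient_map (prod_topology ?L punctured_plane) (prod_topology (prod_topology ?P ?D) punctured_plane) (\<lambda>(t, z). (\<theta> t, z))"
    using \<theta> by (intro quotient_map_prod_left)
      (auto simp: root_quotient_def torus_times_discrete_def punctured_plane_locally_compact Hausdorff_space_punctured_plane)
  have hm: "homeomorphic_maps (prod_topology ?P punctured_plane) (product_topology (\<lambda>_. punctured_plane) {..<Suc b})
      (\<lambda>(f, z). f(b := z)) (\<lambda>f. (restrict f {..<b}, f b))"
    using homeomorphic_maps_product_topology_insert [of b "{..<b}" "\<lambda>_. punctured_plane"] by (simp add: lessThan_Suc)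
  define \<sigma> where "\<sigma> = (\<lambda>((u :: nat \<Rightarrow> complex, d :: nat), z). (u(b := z), d))"
  have 3: "homeomorphic_map (prod_topology (prod_topology ?P ?D) punctured_plane) (torus_times_discrete (Suc b) m) \<sigma>"
  proof (subst homeomorphic_map_maps, intro exI, unfold homeomorphic_maps_def, intro conjI)
    let ?X = "prod_topology (prod_topology ?P ?D) punctured_plane" and ?Y = "torus_times_discrete (Suc b) m"
    let ?\<tau> = "\<lambda>(v :: nat \<Rightarrow> complex, d :: nat). ((restrict v {..<b}, d), v b)"
    have "continuous_map ?X (prod_topology ?P punctured_plane) (\<lambda>x. (fst (fst x), snd x))"
      unfolding continuous_map_paired
      by (intro conjI continuous_map_snd continuous_map_compose [OF continuous_map_fst continuous_map_fst, unfolded o_def])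
    then have "continuous_map ?X (product_topology (\<lambda>_. punctured_plane) {..<Suc b}) ((\<lambda>(f, z). f(b := z)) \<circ> (\<lambda>x. (fst (fst x), snd x)))"
      by (rule continuous_map_compose) (use hm in \<open>simp add: homeomorphic_maps_def\<close>)
    then have A: "continuous_map ?X (product_topology (\<lambda>_. punctured_plane) {..<Suc b}) (\<lambda>x. (fst (fst x))(b := snd x))"
      unfolding o_def by simp
    have B: "continuous_map ?X ?D (\<lambda>x. snd (fst x))"
      using continuous_map_compose [OF continuous_map_fst continuous_map_snd] by (simp add: o_def)
    show "continuous_map ?X ?Y \<sigma>"
      using A B by (simp add: torus_times_discrete_def \<sigma>_def continuous_map_pairwise o_def case_prod_unfold)
    have C: "continuous_map ?Y (prod_topology ?P punctured_plane) (\<lambda>x. (restrict (fst x) {..<b}, fst x b))"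
      using continuous_map_compose [OF continuous_map_fst conjunct1 [OF conjunct2 [OF hm [unfolded homeomorphic_maps_def]]]]
      by (simp add: o_def torus_times_discrete_def)
    have "continuous_map ?Y ?D snd"
      by (simp add: torus_times_discrete_def continuous_map_snd)
    with C show "continuous_map ?Y ?X ?\<tau>"
      by (simp add: continuous_map_pairwise o_def case_prod_unfold)
    show "\<forall>x\<in>topspace ?X. ?\<tau> (\<sigma> x) = x"
      by (auto simp: \<sigma>_def PiE_def extensional_def fun_eq_iff)
    show "\<forall>y\<in>topspace ?Y. \<sigma> (?\<tau> y) = y"
      by (auto simp: \<sigma>_def torus_times_discrete_def PiE_def extensional_def fun_eq_iff)
  qed
  let ?\<theta> = "\<sigma> \<circ> ((\<lambda>(t, z). (\<theta> t, z)) \<circ> (\<lambda>f. (restrict f I, f a)))"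
  have "quotient_map ?L' (torus_times_discrete (Suc b) m) ?\<theta>"
    using 1 2 3 unfolding homeomorphic_map_def by (blast intro: quotient_map_compose)
  moreover have "?\<theta> s = ?\<theta> t \<longleftrightarrow> (\<exists>\<eta>. \<eta> ^ k = 1 \<and> (\<forall>i\<in>insert a I. t i = \<eta> powi w i * s i))"
    if s: "s \<in> topspace ?L'" and t: "t \<in> topspace ?L'" for s t
  proof -
    have r: "(restrict x I, x a) \<in> topspace (prod_topology ?L punctured_plane)" if "x \<in> topspace ?L'" for x
      using homeomorphic_imp_surjective_map [OF 1] that by blast
    have q: "(\<theta> (restrict x I), x a) \<in> topspace (prod_topology (prod_topology ?P ?D) punctured_plane)" if "x \<in> topspace ?L'" for x
      using imageI [OF r [OF that], of "\<lambda>(t, z). (\<theta> t, z)"] unfolding quotient_imp_surjective_map [OF 2] by simp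
    have "?\<theta> s = ?\<theta> t \<longleftrightarrow> (\<theta> (restrict s I), s a) = (\<theta> (restrict t I), t a)"
      using inj_on_eq_iff [OF homeomorphic_imp_injective_map [OF 3] q[OF s] q[OF t]]
      by (simp only: o_def case_prod_conv)
    also have "\<dots> \<longleftrightarrow> (\<exists>\<eta>. \<eta> ^ k = 1 \<and> (\<forall>i\<in>I. t i = \<eta> powi w i * s i)) \<and> s a = t a"
      using \<theta> r[OF s] r[OF t] unfolding root_quotient_def by simp
    finally show ?thesis using w by auto
  qed
  ultimately show ?thesis
    unfolding root_quotient_def by blast
qed

lemma quotient_map_discrete: "quotient_map (discrete_topology A) (discrete_topology B) f \<longleftrightarrow> f ` A = B"
  by (auto simp: quotient_map_def)

text \<open>A nonzero exponent confines the coordinate to finitely many roots, all nonzero because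
  \<open>c\<close> is, and a finite Hausdorff space is discrete.\<close>

lemma monomial_level_axis_discrete:
  assumes \<gamma>: "\<alpha> i \<noteq> 0" and c: "c \<noteq> 0"
  shows "monomial_level {i} \<alpha> c = discrete_topology {t \<in> {i} \<rightarrow>\<^sub>E UNIV. t i powi \<alpha> i = c}"
proof -
  let ?T = "{t \<in> {i} \<rightarrow>\<^sub>E UNIV. t i powi \<alpha> i = c}"
  have T: "topspace (monomial_level {i} \<alpha> c) = ?T"
    using \<gamma> c by (auto simp: topspace_monomial_level PiE_iff)
  have "inj_on (\<lambda>t. t i) ?T"
  proof (rule inj_onI)
    fix s t assume "s \<in> ?T" "t \<in> ?T" "s i = t i"
    then show "s = t"
      by (intro PiE_ext [of s "{i}" "\<lambda>_. UNIV" t]) auto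
  qed
  moreover have "(\<lambda>t. t i) ` ?T \<subseteq> {s. s powi \<alpha> i = c}"
    by auto
  moreover have "finite {s. s powi \<alpha> i = c}"
    using root_class_map_exists [of 1 "\<alpha> i" c 1] \<gamma> c by simp
  ultimately have "finite ?T"
    using finite_subset finite_imageD by meson
  moreover have "Hausdorff_space (monomial_level {i} \<alpha> c)"
    unfolding monomial_level_def
    by (intro Hausdorff_space_subtopology) (simp add: Hausdorff_space_product_topology Hausdorff_space_punctured_plane)
  ultimately show ?thesis
    using finite_t1_space_imp_discrete_topology Hausdorff_imp_t1_space T by metis
qed

lemma root_quotient_singleton:
  assumes \<gamma>: "\<alpha> i \<noteq> 0" and c: "c \<noteq> 0" and k: "k > 0" and dvd: "int k dvd \<alpha> i * w i"
  shows "\<exists>\<theta>. root_quotient k {i} \<alpha> w c 0 (nat (gcd (\<alpha> i) (\<alpha> i * w i div int k))) \<theta>"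
proof -
  let ?m = "nat (gcd (\<alpha> i) (\<alpha> i * w i div int k))"
  let ?T = "{t \<in> {i} \<rightarrow>\<^sub>E UNIV. t i powi \<alpha> i = c}"
  obtain \<kappa> where \<kappa>: "\<kappa> ` {s. s powi \<alpha> i = c} = {..<?m}"
    and fib: "\<forall>s t. s powi \<alpha> i = c \<longrightarrow> t powi \<alpha> i = c \<longrightarrow> \<kappa> s = \<kappa> t \<longleftrightarrow> (\<exists>\<eta>. \<eta> ^ k = 1 \<and> t = \<eta> powi w i * s)"
    using root_class_map_exists [OF k \<gamma> c dvd] by blast
  \<comment> \<open>The torus of dimension 0 is one point, the only extensional function on the
    empty index set.\<close>
  define \<theta> where "\<theta> t = ((\<lambda>x::nat. undefined :: complex), \<kappa> (t i))" for t
  have "(\<lambda>t. t i) ` ?T = {s. s powi \<alpha> i = c}"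
  proof (intro equalityI subsetI)
    fix s assume "s \<in> {s. s powi \<alpha> i = c}"
    then show "s \<in> (\<lambda>t. t i) ` ?T"
      by (intro image_eqI[of _ _ "\<lambda>j\<in>{i}. s"]) auto
  qed auto
  moreover have "\<theta> ` ?T = Pair (\<lambda>x. undefined) ` \<kappa> ` (\<lambda>t. t i) ` ?T"
    unfolding \<theta>_def image_image ..
  ultimately have "\<theta> ` ?T = Pair (\<lambda>x. undefined) ` {..<?m}"
    using \<kappa> by simp
  then have "\<theta> ` ?T = {\<lambda>x. undefined} \<times> {..<?m}"
    by auto
  then have "quotient_map (monomial_level {i} \<alpha> c) (torus_times_discrete 0 ?m) \<theta>"
    unfolding monomial_level_axis_discrete [of \<alpha> i c, OF \<gamma> c] torus_times_discrete_def
    by (simp add: product_topology_empty_discrete quotient_map_discrete flip: prod_topology_discrete_topology)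
  moreover have "\<theta> s = \<theta> t \<longleftrightarrow> (\<exists>\<eta>. \<eta> ^ k = 1 \<and> (\<forall>j\<in>{i}. t j = \<eta> powi w j * s j))"
    if "s \<in> ?T" "t \<in> ?T" for s t
    using fib that by (simp add: \<theta>_def)
  ultimately show ?thesis
    unfolding root_quotient_def monomial_level_axis_discrete [of \<alpha> i c, OF \<gamma> c]
    by (intro exI[of _ \<theta>] conjI ballI) simp_all
qed

text \<open>Power maps are coverings of the punctured plane, hence open, and multiplication by a
  nonzero constant is a homeomorphism.\<close>

lemma open_map_power_times:
  assumes e: "e > 0" and a: "a \<noteq> 0"
  shows "open_map punctured_plane punctured_plane (\<lambda>z. z ^ e * a)"
  unfolding open_map_def
proof (intro allI impI)
  have o: "open (- {0 :: complex})"
    by (simp add: open_Compl)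
  fix U assume "openin punctured_plane U"
  then have U: "openin (top_of_set (- {0})) U"
    by (simp add: punctured_plane_def Compl_eq_Diff_UNIV)
  have "openin (top_of_set (- {0})) ((\<lambda>z. z ^ e) ` U)"
    by (rule covering_space_open_map [OF covering_space_power_punctured_plane [OF e] U])
  then have V: "open ((\<lambda>z. z ^ e) ` U)" "(\<lambda>z. z ^ e) ` U \<subseteq> - {0}"
    by (simp_all add: openin_open_eq [OF o])
  have "(\<lambda>z. z ^ e * a) ` U = (\<lambda>z. z / a) -` ((\<lambda>z. z ^ e) ` U)"
    using a by (force simp: image_iff field_simps)
  moreover have "open ((\<lambda>z. z / a) -` ((\<lambda>z. z ^ e) ` U))"
    by (rule open_vimage [OF V(1)]) (use a in \<open>auto intro!: continuous_intros\<close>)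
  ultimately have "open ((\<lambda>z. z ^ e * a) ` U)" by simp
  moreover have "(\<lambda>z. z ^ e * a) ` U \<subseteq> - {0}"
    using V(2) a by force
  ultimately show "openin punctured_plane ((\<lambda>z. z ^ e * a) ` U)"
    unfolding punctured_plane_def Compl_eq_Diff_UNIV[symmetric] by (simp add: openin_open_eq [OF o])
qed

lemma homeomorphic_map_product_lessThan_1:
  "homeomorphic_map X (product_topology (\<lambda>_. X) {..<1::nat}) (\<lambda>y. \<lambda>i\<in>{..<1}. y)"
  unfolding homeomorphic_map_maps homeomorphic_maps_def
  by (intro exI[of _ "\<lambda>f. f 0"])
    (auto simp: continuous_map_componentwise PiE_def extensional_def fun_eq_iff intro!: continuous_map_product_projection)

text \<open>The case that Euclid's algorithm on the weights cannot reduce: \<open>t i\<close> is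
  confined to roots and the free coordinate \<open>t j\<close> has arbitrary weight. The orbits are
  separated by the class of \<open>t i\<close> and by one invariant monomial, a power
  \<open>e\<close> of \<open>t j\<close> corrected by a power \<open>f\<close> of
  \<open>t i\<close>.\<close>

lemma root_quotient_pair:
  assumes ij: "i \<noteq> j" and \<gamma>: "\<alpha> i \<noteq> 0" and \<alpha>j: "\<alpha> j = 0" and c: "c \<noteq> 0" and k: "k > 0" and dvd: "int k dvd \<alpha> i * w i"
  shows "\<exists>\<theta>. root_quotient k {j, i} \<alpha> w c 1 (nat (gcd (\<alpha> i) (\<alpha> i * w i div int k))) \<theta>"
proof -
  let ?m = "nat (gcd (\<alpha> i) (\<alpha> i * w i div int k))"
  let ?T = "{t \<in> {i} \<rightarrow>\<^sub>E UNIV. t i powi \<alpha> i = c}"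
  let ?D = "discrete_topology {..<?m}"
  obtain \<kappa> where \<kappa>: "\<kappa> ` {s. s powi \<alpha> i = c} = {..<?m}"
    and fib: "\<forall>s t. s powi \<alpha> i = c \<longrightarrow> t powi \<alpha> i = c \<longrightarrow> \<kappa> s = \<kappa> t \<longleftrightarrow> (\<exists>\<eta>. \<eta> ^ k = 1 \<and> t = \<eta> powi w i * s)"
    using root_class_map_exists [OF k \<gamma> c dvd] by blast
  \<comment> \<open>\<open>r\<close> is the order of the stabiliser in C_k of a value of
    \<open>t i\<close>, and \<open>e\<close> is the order of the group through which this stabiliser
    acts on \<open>t j\<close>; so \<open>e\<close> is the least power of \<open>t j\<close> that
    the stabiliser leaves alone.\<close>
  define r where "r = nat (gcd (int k) (w i))"
  define e where "e = r div nat (gcd (int r) (w j))"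
  have r: "int r = gcd (int k) (w i)" "r > 0"
    using k by (simp_all add: r_def)
  have "int (nat (gcd (int r) (w j))) dvd int r" "nat (gcd (int r) (w j)) > 0"
    using r(2) by simp_all
  then have er: "e * nat (gcd (int r) (w j)) = r" and e: "e > 0"
    using r(2) unfolding e_def int_dvd_int_iff by (simp_all add: dvd_imp_le div_greater_zero_iff)
  have "int r dvd int e * w j"
  proof -
    obtain q where "w j = gcd (int r) (w j) * q"
      by (metis dvdE gcd_dvd2)
    then have "int e * w j = int (e * nat (gcd (int r) (w j))) * q"
      by simp
    then show ?thesis unfolding er by simp
  qed
  then obtain q where q: "int e * w j = int r * q" by blast
  obtain u v where uv: "u * int k + v * w i = int r"
    unfolding r(1) using bezout_int by blast
  define f where "f = - (v * q)"
  have ef: "int e * w j + f * w i = int k * (u * q)"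
    unfolding q f_def uv[symmetric] by (simp add: algebra_simps)
  define h where "h t z = z ^ e * (t i powi f)" for t :: "'a \<Rightarrow> complex" and z :: complex
  define \<psi> where "\<psi> = (\<lambda>(t, z). (h t z, \<kappa> (t i)))"
  let ?X = "prod_topology (discrete_topology ?T) punctured_plane"
  have t0: "t i \<noteq> 0" if "t \<in> ?T" for t
    using that \<gamma> c by auto
  have "continuous_map ?X punctured_plane (\<lambda>x. 1 * snd x powi int e * fst x i powi f)"
  proof (intro continuous_map_mult_powi)
    have "continuous_map (discrete_topology ?T) punctured_plane (\<lambda>t. t i)"
      using t0 by auto
    from continuous_map_compose [OF continuous_map_fst this]
    show "continuous_map ?X punctured_plane (\<lambda>x. fst x i)"
      by (simp add: o_def)
  qed (simp_all add: continuous_map_snd)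
  moreover have "continuous_map (discrete_topology ?T) ?D (\<lambda>t. \<kappa> (t i))"
    using \<kappa> by auto
  from continuous_map_compose [OF continuous_map_fst this]
  have "continuous_map ?X ?D (\<lambda>x. \<kappa> (fst x i))"
    by (simp add: o_def)
  ultimately have cont: "continuous_map ?X (prod_topology punctured_plane ?D) \<psi>"
    by (simp add: \<psi>_def h_def case_prod_unfold continuous_map_paired)
  \<comment> \<open>Over the discrete factor an open set is a union of slices, and on each slice the
    first component is a power map times a nonzero constant.\<close>
  have opn: "open_map ?X (prod_topology punctured_plane ?D) \<psi>"
    unfolding open_map_def
  proof (intro allI impI)
    fix W assume W: "openin ?X W"
    then have sub: "W \<subseteq> ?T \<times> - {0}"
      using openin_subset [OF W] by simp
    have "\<psi> ` W = (\<Union>t\<in>?T. h t ` {z \<in> topspace punctured_plane. (t, z) \<in> W} \<times> {\<kappa> (t i)})"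
    proof (intro equalityI subsetI)
      fix x assume "x \<in> \<psi> ` W"
      then obtain t z where tz: "(t, z) \<in> W" "x = (h t z, \<kappa> (t i))"
        by (auto simp: \<psi>_def)
      then have "t \<in> ?T" "z \<in> topspace punctured_plane"
        using sub by auto
      then show "x \<in> (\<Union>t\<in>?T. h t ` {z \<in> topspace punctured_plane. (t, z) \<in> W} \<times> {\<kappa> (t i)})"
        using tz by blast
    next
      fix x assume "x \<in> (\<Union>t\<in>?T. h t ` {z \<in> topspace punctured_plane. (t, z) \<in> W} \<times> {\<kappa> (t i)})"
      then obtain t z where "(t, z) \<in> W" "x = (h t z, \<kappa> (t i))"
        by blast
      then show "x \<in> \<psi> ` W"
        unfolding \<psi>_def by (intro image_eqI[of _ _ "(t, z)"]) simp_all
    qed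
    moreover have "openin (prod_topology punctured_plane ?D) (h t ` {z \<in> topspace punctured_plane. (t, z) \<in> W} \<times> {\<kappa> (t i)})"
      if t: "t \<in> ?T" for t
    proof -
      have "continuous_map punctured_plane ?X (Pair t)"
        using t by (auto simp: continuous_map_paired)
      then have "openin punctured_plane {z \<in> topspace punctured_plane. (t, z) \<in> W}"
        using W openin_continuous_map_preimage by fastforce
      then have "openin punctured_plane (h t ` {z \<in> topspace punctured_plane. (t, z) \<in> W})"
        using open_map_power_times [OF e, of "t i powi f"] t0 [OF t] unfolding open_map_def h_def by simp
      then show ?thesis
        using t \<kappa> by (auto simp: openin_prod_Times_iff)
    qed
    ultimately show "openin (prod_topology punctured_plane ?D) (\<psi> ` W)"
      by auto
  qed
  have surj: "\<psi> ` topspace ?X = topspace (prod_topology punctured_plane ?D)"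
  proof (intro equalityI subsetI)
    fix x assume "x \<in> topspace (prod_topology punctured_plane ?D)"
    then obtain y d where x: "x = (y, d)" "y \<noteq> 0" "d < ?m"
      by auto
    then have "d \<in> \<kappa> ` {s. s powi \<alpha> i = c}"
      unfolding \<kappa> by simp
    then obtain s where s: "s powi \<alpha> i = c" "\<kappa> s = d"
      by blast
    define t where "t = (\<lambda>x\<in>{i}. s)"
    have t: "t \<in> ?T" "t i = s"
      using s by (auto simp: t_def)
    then have "s \<noteq> 0" using t0 [of t] by simp
    moreover obtain z where z: "y / s powi f = z ^ e"
      using exists_complex_root [of e "y / s powi f"] e by auto
    ultimately have "z ^ e * s powi f = y" "z ^ e \<noteq> 0"
      unfolding z[symmetric] using x(2) by simp_all
    then have "\<psi> (t, z) = x" "z \<noteq> 0"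
      using t s x e by (auto simp: \<psi>_def h_def)
    then show "x \<in> \<psi> ` topspace ?X"
      using t by (intro image_eqI[of _ _ "(t, z)"]) simp_all
  qed (use continuous_map_image_subset_topspace [OF cont] in blast)
  have quot: "quotient_map ?X (prod_topology punctured_plane ?D) \<psi>"
    by (rule continuous_open_imp_quotient_map [OF cont opn surj])
  have unit: "(\<eta> powi w j) ^ e * (\<eta> powi w i) powi f = 1" if \<eta>: "\<eta> ^ k = 1" for \<eta> :: complex
  proof -
    have \<eta>0: "\<eta> \<noteq> 0" using \<eta> k by (auto simp: power_0_left)
    have "(\<eta> powi w j) ^ e * (\<eta> powi w i) powi f = \<eta> powi (int e * w j) * \<eta> powi (f * w i)"
      unfolding mult.commute[of _ "w j"] mult.commute[of _ "w i"] by (simp add: power_int_mult)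
    also have "\<dots> = \<eta> powi (int k * (u * q))"
      using \<eta>0 by (simp flip: power_int_add add: ef)
    also have "\<dots> = 1"
      unfolding power_int_mult [of \<eta> "int k"] using \<eta> by simp
    finally show ?thesis .
  qed
  have fibre: "\<psi> (s, y) = \<psi> (t, z) \<longleftrightarrow> (\<exists>\<eta>. \<eta> ^ k = 1 \<and> t i = \<eta> powi w i * s i \<and> z = \<eta> powi w j * y)"
    if st: "s \<in> ?T" "t \<in> ?T" and yz: "y \<noteq> 0" "z \<noteq> 0" for s t y z
  proof
    assume eq: "\<psi> (s, y) = \<psi> (t, z)"
    then have "\<kappa> (s i) = \<kappa> (t i)" by (simp add: \<psi>_def)
    then obtain \<eta> where \<eta>: "\<eta> ^ k = 1" "t i = \<eta> powi w i * s i"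
      using fib st by auto
    have \<eta>0: "\<eta> \<noteq> 0" using \<eta>(1) k by (auto simp: power_0_left)
    have \<eta>k: "\<eta> powi int k = 1" using \<eta>(1) by simp
    \<comment> \<open>\<open>\<eta>\<close> already matches coordinate \<open>i\<close>;
      \<open>\<rho>\<close> is its error at coordinate \<open>j\<close>. Equality of the invariant
      monomials makes \<open>\<rho>\<close> an e-th root of unity, so it can be corrected by an
      element of order dividing \<open>r\<close>, which does not affect coordinate
      \<open>i\<close>.\<close>
    define \<rho> where "\<rho> = z / (\<eta> powi w j * y)"
    have "y ^ e * s i powi f = z ^ e * (\<eta> powi w i * s i) powi f"
      using eq \<eta>(2) by (simp add: \<psi>_def h_def)
    also have "\<dots> = (z ^ e * (\<eta> powi w i) powi f) * s i powi f"
      by (simp add: power_int_mult_distrib)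
    finally have y: "y ^ e = z ^ e * (\<eta> powi w i) powi f"
      using t0[OF st(1)] by simp
    have "(\<eta> powi w j) ^ e * y ^ e = z ^ e * ((\<eta> powi w j) ^ e * (\<eta> powi w i) powi f)"
      unfolding y by (simp only: mult.left_commute)
    then have "(\<eta> powi w j) ^ e * y ^ e = z ^ e"
      by (simp add: unit [OF \<eta>(1)])
    then have "\<rho> ^ e = 1"
      using yz \<eta>0 by (simp add: \<rho>_def power_divide power_mult_distrib)
    then obtain \<zeta> where \<zeta>: "\<zeta> ^ r = 1" "\<zeta> powi w j = \<rho>"
      using root_of_unity_powi_exists [OF r(2)] unfolding e_def by blast
    have \<zeta>r: "\<zeta> powi int r = 1" using \<zeta>(1) by simp
    obtain a b where ab: "int k = int r * a" "w i = int r * b"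
      using r(1) by (metis gcd_dvd1 gcd_dvd2 dvdE)
    have "\<zeta> powi int k = 1" "\<zeta> powi w i = 1"
      unfolding ab power_int_mult \<zeta>r by simp_all
    then have "(\<eta> * \<zeta>) ^ k = 1" "t i = (\<eta> * \<zeta>) powi w i * s i" "z = (\<eta> * \<zeta>) powi w j * y"
      using \<eta> \<zeta> yz \<eta>0 by (simp_all add: power_mult_distrib power_int_mult_distrib \<rho>_def)
    then show "\<exists>\<eta>. \<eta> ^ k = 1 \<and> t i = \<eta> powi w i * s i \<and> z = \<eta> powi w j * y"
      by blast
  next
    assume "\<exists>\<eta>. \<eta> ^ k = 1 \<and> t i = \<eta> powi w i * s i \<and> z = \<eta> powi w j * y"
    then obtain \<eta> where \<eta>: "\<eta> ^ k = 1" "t i = \<eta> powi w i * s i" "z = \<eta> powi w j * y"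
      by blast
    have \<eta>0: "\<eta> \<noteq> 0" using \<eta>(1) k by (auto simp: power_0_left)
    have \<eta>k: "\<eta> powi int k = 1" using \<eta>(1) by simp
    have "h t z = h s y * ((\<eta> powi w j) ^ e * (\<eta> powi w i) powi f)"
      unfolding h_def \<eta> by (simp add: power_mult_distrib power_int_mult_distrib)
    then have "h t z = h s y"
      by (simp add: unit [OF \<eta>(1)])
    moreover have "\<kappa> (s i) = \<kappa> (t i)"
      using fib st \<eta> by auto
    ultimately show "\<psi> (s, y) = \<psi> (t, z)"
      by (simp add: \<psi>_def)
  qed
  have "homeomorphic_map (monomial_level {j, i} \<alpha> c) (prod_topology (monomial_level {i} \<alpha> c) punctured_plane)
      (\<lambda>f. (restrict f {i}, f j))"
    using monomial_level_insert [of j "{i}" \<alpha> c] ij \<alpha>j homeomorphic_maps_sym homeomorphic_map_maps by blast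
  then have lev: "homeomorphic_map (monomial_level {j, i} \<alpha> c) ?X (\<lambda>f. (restrict f {i}, f j))"
    unfolding monomial_level_axis_discrete [of \<alpha> i c, OF \<gamma> c] .
  define \<sigma> where "\<sigma> = (\<lambda>(y :: complex, d :: nat). ((\<lambda>i\<in>{..<1::nat}. y), d))"
  have \<sigma>: "homeomorphic_map (prod_topology punctured_plane ?D) (torus_times_discrete 1 ?m) \<sigma>"
  proof -
    obtain g where "homeomorphic_maps punctured_plane (product_topology (\<lambda>_. punctured_plane) {..<1::nat}) (\<lambda>y. \<lambda>i\<in>{..<1}. y) g"
      using homeomorphic_map_product_lessThan_1 homeomorphic_map_maps by blast
    then have "homeomorphic_maps (prod_topology punctured_plane ?D) (torus_times_discrete 1 ?m) \<sigma> (\<lambda>(x, y). (g x, y))"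
      unfolding torus_times_discrete_def \<sigma>_def homeomorphic_maps_prod by (simp add: homeomorphic_maps_def)
    then show ?thesis
      using homeomorphic_map_maps by blast
  qed
  let ?\<theta> = "\<sigma> \<circ> (\<psi> \<circ> (\<lambda>f. (restrict f {i}, f j)))"
  have "quotient_map (monomial_level {j, i} \<alpha> c) (torus_times_discrete 1 ?m) ?\<theta>"
    using lev quot \<sigma> unfolding homeomorphic_map_def by (blast intro: quotient_map_compose)
  moreover have "?\<theta> s = ?\<theta> t \<longleftrightarrow> (\<exists>\<eta>. \<eta> ^ k = 1 \<and> (\<forall>l\<in>{j, i}. t l = \<eta> powi w l * s l))"
    if s: "s \<in> topspace (monomial_level {j, i} \<alpha> c)" and t: "t \<in> topspace (monomial_level {j, i} \<alpha> c)" for s t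
  proof -
    have X: "(restrict x {i}, x j) \<in> topspace ?X" if "x \<in> topspace (monomial_level {j, i} \<alpha> c)" for x
      using homeomorphic_imp_surjective_map [OF lev] that by blast
    have "inj \<sigma>"
      by (auto simp: \<sigma>_def inj_def restrict_def fun_eq_iff)
    then have "?\<theta> s = ?\<theta> t \<longleftrightarrow> \<psi> (restrict s {i}, s j) = \<psi> (restrict t {i}, t j)"
      by (simp add: inj_eq)
    also have "\<dots> \<longleftrightarrow> (\<exists>\<eta>. \<eta> ^ k = 1 \<and> t i = \<eta> powi w i * s i \<and> t j = \<eta> powi w j * s j)"
      using fibre [of "restrict s {i}" "restrict t {i}" "s j" "t j"] X[OF s] X[OF t] by simp
    finally show ?thesis by auto
  qed
  ultimately show ?thesis
    unfolding root_quotient_def by blast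
qed

section \<open>Euclid's algorithm on weights and on exponents\<close>

lemma abs_add_sgn_mult_less:
  fixes a b :: int
  assumes "a \<noteq> 0" "b \<noteq> 0" "\<bar>b\<bar> \<le> \<bar>a\<bar>"
  shows "\<bar>a - sgn a * sgn b * b\<bar> < \<bar>a\<bar>"
proof -
  have "a - sgn a * sgn b * b = sgn a * (\<bar>a\<bar> - \<bar>b\<bar>)"
    by (simp add: algebra_simps abs_sgn mult_sgn_abs)
  then show ?thesis
    using assms by (simp add: abs_mult abs_sgn_eq)
qed

lemma sum_abs_fun_upd_less:
  fixes f :: "'i \<Rightarrow> int"
  assumes "finite I" "i \<in> I" "\<bar>b\<bar> < \<bar>f i\<bar>"
  shows "nat (\<Sum>x\<in>I. \<bar>(f(i := b)) x\<bar>) < nat (\<Sum>x\<in>I. \<bar>f x\<bar>)"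
proof -
  have "(\<Sum>x\<in>I. \<bar>(f(i := b)) x\<bar>) < (\<Sum>x\<in>I. \<bar>f x\<bar>)"
    by (rule sum_strict_mono_ex1) (use assms in auto)
  moreover have "0 \<le> (\<Sum>x\<in>I. \<bar>(f(i := b)) x\<bar>)"
    by (simp add: sum_nonneg del: fun_upd_apply)
  ultimately show ?thesis by linarith
qed

text \<open>Euclid's algorithm on the weights away from the axis \<open>i0\<close>. There all
  exponents vanish, so the substitutions leave \<open>\<alpha>\<close> as it is. Each round splits
  off a coordinate of weight 0 or shortens a weight, until at most one coordinate is left besides
  \<open>i0\<close>.\<close>

lemma root_quotient_axis:
  assumes "finite I" "i0 \<in> I" "\<alpha> i0 \<noteq> 0" "\<And>i. \<lbrakk>i \<in> I; i \<noteq> i0\<rbrakk> \<Longrightarrow> \<alpha> i = 0" "c \<noteq> 0" "k > 0"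
    and "int k dvd \<alpha> i0 * w i0"
  shows "\<exists>\<theta>. root_quotient k I \<alpha> w c (card I - 1) (nat (gcd (\<alpha> i0) (\<alpha> i0 * w i0 div int k))) \<theta>"
  using assms
proof (induction "card I + nat (\<Sum>i\<in>I - {i0}. \<bar>w i\<bar>)" arbitrary: I w rule: less_induct)
  case less
  let ?m = "nat (gcd (\<alpha> i0) (\<alpha> i0 * w i0 div int k))"
  consider (zero) i where "i \<in> I - {i0}" "w i = 0"
    | (two) i j where "i \<in> I - {i0}" "j \<in> I - {i0}" "i \<noteq> j" "w i \<noteq> 0" "w j \<noteq> 0" "\<bar>w j\<bar> \<le> \<bar>w i\<bar>"
    | (one) "I = {i0}"
    | (pair) j where "I = {j, i0}" "j \<noteq> i0"
  proof (cases "\<exists>i\<in>I - {i0}. w i = 0")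
    case False
    then have w: "w i \<noteq> 0" if "i \<in> I - {i0}" for i
      using that by blast
    consider "I - {i0} = {}" | j where "I - {i0} = {j}" | i j where "i \<in> I - {i0}" "j \<in> I - {i0}" "i \<noteq> j"
      by blast
    then show ?thesis
    proof cases
      case 1
      then show ?thesis using one less.prems(2) by blast
    next
      case (2 j)
      then show ?thesis using pair[of j] less.prems(2) by blast
    next
      case (3 i j)
      show ?thesis
      proof (cases "\<bar>w j\<bar> \<le> \<bar>w i\<bar>")
        case True
        then show ?thesis
          by (rule two [OF 3 w [OF 3(1)] w [OF 3(2)]])
      next
        case False
        then show ?thesis
          using two [OF 3(2) 3(1) 3(3) [symmetric] w [OF 3(2)] w [OF 3(1)]] by linarith
      qed
    qed
  qed (use zero in blast)
  then show ?case
  proof cases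
    case zero
    have "card (I - {i}) < card I"
      using zero less.prems(1) by (intro card_Diff1_less) auto
    moreover have "(\<Sum>x\<in>I - {i} - {i0}. \<bar>w x\<bar>) = (\<Sum>x\<in>I - {i0}. \<bar>w x\<bar>)"
      by (rule sum.mono_neutral_left) (use zero less.prems(1) in auto)
    ultimately have "\<exists>\<theta>. root_quotient k (I - {i}) \<alpha> w c (card (I - {i}) - 1) ?m \<theta>"
      by (intro less.hyps) (use zero less.prems in auto)
    then have "\<exists>\<theta>. root_quotient k (insert i (I - {i})) \<alpha> w c (Suc (card (I - {i}) - 1)) ?m \<theta>"
      by (intro root_quotient_insert) (use zero less.prems in auto)
    \<comment> \<open>The truncated subtraction is harmless because \<open>i0\<close> survives the
      removal of \<open>i\<close>.\<close>
    moreover have "Suc (card (I - {i}) - 1) = card I - 1"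
    proof -
      have "i0 \<in> I - {i}" "finite (I - {i})"
        using zero less.prems by auto
      then have "card (I - {i}) > 0"
        unfolding card_gt_0_iff by blast
      moreover have "card (I - {i}) = card I - 1"
        using zero by (simp add: card_Diff_singleton)
      ultimately show ?thesis by linarith
    qed
    moreover have "insert i (I - {i}) = I"
      using zero by blast
    ultimately show ?thesis
      by (simp only:)
  next
    case two
    define q where "q = - (sgn (w i) * sgn (w j))"
    have "\<bar>w i + q * w j\<bar> < \<bar>w i\<bar>"
      using abs_add_sgn_mult_less [OF two(4) two(5) two(6)] by (simp add: q_def)
    then have "nat (\<Sum>x\<in>I - {i0}. \<bar>(w(i := w i + q * w j)) x\<bar>) < nat (\<Sum>x\<in>I - {i0}. \<bar>w x\<bar>)"
      using two less.prems(1) by (intro sum_abs_fun_upd_less) auto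
    then have "\<exists>\<theta>. root_quotient k I \<alpha> (w(i := w i + q * w j)) c (card I - 1)
        (nat (gcd (\<alpha> i0) (\<alpha> i0 * (w(i := w i + q * w j)) i0 div int k))) \<theta>"
      by (intro less.hyps) (use two less.prems in auto)
    moreover have "\<alpha>(j := \<alpha> j - q * \<alpha> i) = \<alpha>"
      using two less.prems by auto
    moreover have "(w(i := w i + q * w j)) i0 = w i0"
      using two(1) by auto
    ultimately have ex: "\<exists>\<theta>. root_quotient k I (\<alpha>(j := \<alpha> j - q * \<alpha> i)) (w(i := w i + q * w j)) c (card I - 1) ?m \<theta>"
      by (simp only:)
    show ?thesis
      by (rule root_quotient_elementary [OF less.prems(1) _ _ two(3) less.prems(6) ex]) (use two in auto)
  next
    case one
    then show ?thesis
      using root_quotient_singleton [of \<alpha> i0 c k w] less.prems by simp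
  next
    case pair
    then show ?thesis
      using root_quotient_pair [of i0 j \<alpha> c k w] less.prems by simp
  qed
qed

text \<open>Euclid's algorithm on the exponents, until one coordinate carries them all. The number
  of points is written in terms of quantities that every substitution preserves. The divisibility
  hypothesis ensures that C_k preserves the level set, since \<open>\<eta>\<close> multiplies the
  monomial by its power with exponent the sum of the \<open>\<alpha> i * w i\<close>.\<close>

lemma root_quotient_exists:
  assumes "finite I" "\<exists>i\<in>I. \<alpha> i \<noteq> 0" "c \<noteq> 0" "k > 0" "int k dvd (\<Sum>i\<in>I. \<alpha> i * w i)"
  shows "\<exists>\<theta>. root_quotient k I \<alpha> w c (card I - 1)
    (nat (gcd (Gcd (\<alpha> ` I)) ((\<Sum>i\<in>I. \<alpha> i * w i) div int k))) \<theta>"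
  using assms
proof (induction "nat (\<Sum>i\<in>I. \<bar>\<alpha> i\<bar>)" arbitrary: \<alpha> w rule: less_induct)
  case less
  obtain i0 where i0: "i0 \<in> I" "\<alpha> i0 \<noteq> 0" using less.prems by blast
  show ?case
  proof (cases "\<forall>i\<in>I. i \<noteq> i0 \<longrightarrow> \<alpha> i = 0")
    case True
    have "(\<Sum>i\<in>I. \<alpha> i * w i) = \<alpha> i0 * w i0"
      using sum.remove [OF less.prems(1) i0(1), of "\<lambda>i. \<alpha> i * w i"] True by simp
    moreover have "Gcd (\<alpha> ` I) = \<bar>\<alpha> i0\<bar>"
    proof -
      have "\<alpha> ` I \<subseteq> {\<alpha> i0, 0}" "\<alpha> i0 \<in> \<alpha> ` I" using True i0 by auto
      then have "Gcd (\<alpha> ` I) dvd \<bar>\<alpha> i0\<bar>" "\<bar>\<alpha> i0\<bar> dvd Gcd (\<alpha> ` I)"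
        by (auto intro!: Gcd_greatest Gcd_dvd)
      then show ?thesis by (intro zdvd_antisym_nonneg) simp_all
    qed
    ultimately show ?thesis
      using root_quotient_axis [of I i0 \<alpha> c k w] i0 True less.prems by simp
  next
    case False
    then obtain i j where ij: "i \<in> I" "j \<in> I" "i \<noteq> j" "\<alpha> i \<noteq> 0" "\<alpha> j \<noteq> 0" "\<bar>\<alpha> i\<bar> \<le> \<bar>\<alpha> j\<bar>"
      using i0 by (metis linear)
    define q where "q = sgn (\<alpha> j) * sgn (\<alpha> i)"
    let ?\<alpha> = "\<alpha>(j := \<alpha> j - q * \<alpha> i)" and ?w = "w(i := w i + q * w j)"
    have "\<bar>\<alpha> j - q * \<alpha> i\<bar> < \<bar>\<alpha> j\<bar>"
      using abs_add_sgn_mult_less [OF ij(5) ij(4) ij(6)] by (simp add: q_def)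
    then have less': "nat (\<Sum>x\<in>I. \<bar>?\<alpha> x\<bar>) < nat (\<Sum>x\<in>I. \<bar>\<alpha> x\<bar>)"
      using ij less.prems(1) by (intro sum_abs_fun_upd_less) auto
    have split: "(\<Sum>x\<in>I. f x) = f i + (f j + (\<Sum>x\<in>I - {i} - {j}. f x))" for f :: "'a \<Rightarrow> int"
      using ij less.prems(1) by (simp add: sum.remove[of I i] sum.remove[of "I - {i}" j])
    have "(\<Sum>x\<in>I - {i} - {j}. ?\<alpha> x * ?w x) = (\<Sum>x\<in>I - {i} - {j}. \<alpha> x * w x)"
      by (intro sum.cong) auto
    \<comment> \<open>Coordinate \<open>j\<close> loses \<open>q * \<alpha> i * w j\<close> and
      coordinate \<open>i\<close> gains exactly that.\<close>
    then have sum_eq: "(\<Sum>x\<in>I. ?\<alpha> x * ?w x) = (\<Sum>x\<in>I. \<alpha> x * w x)"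
      unfolding split using ij by (simp add: algebra_simps)
    have dvd_iff: "d dvd Gcd (?\<alpha> ` I) \<longleftrightarrow> d dvd Gcd (\<alpha> ` I)" for d
    proof -
      have "d dvd \<alpha> j - q * \<alpha> i \<longleftrightarrow> d dvd \<alpha> j" if "d dvd \<alpha> i"
        using that by (simp add: dvd_diff_left_iff)
      then show ?thesis
        using ij by (auto simp: dvd_Gcd_iff split: if_splits)
    qed
    have "Gcd (?\<alpha> ` I) dvd Gcd (\<alpha> ` I)" "Gcd (\<alpha> ` I) dvd Gcd (?\<alpha> ` I)"
      using dvd_iff[of "Gcd (?\<alpha> ` I)"] dvd_iff[of "Gcd (\<alpha> ` I)"] dvd_refl by blast+
    then have Gcd_eq: "Gcd (?\<alpha> ` I) = Gcd (\<alpha> ` I)"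
      by (rule zdvd_antisym_nonneg [OF Gcd_int_greater_eq_0 Gcd_int_greater_eq_0])
    have "\<exists>\<theta>. root_quotient k I ?\<alpha> ?w c (card I - 1)
        (nat (gcd (Gcd (?\<alpha> ` I)) ((\<Sum>i\<in>I. ?\<alpha> i * ?w i) div int k))) \<theta>"
    proof (rule less.hyps [OF less'])
      show "\<exists>x\<in>I. ?\<alpha> x \<noteq> 0" using ij by (intro bexI[of _ i]) auto
      show "int k dvd (\<Sum>i\<in>I. ?\<alpha> i * ?w i)" unfolding sum_eq by (rule less.prems)
    qed (use less.prems in auto)
    then show ?thesis
      unfolding sum_eq Gcd_eq by (rule root_quotient_elementary [OF less.prems(1) ij(1) ij(2) ij(3) less.prems(4)])
  qed
qed

section \<open>Cycle types\<close>

definition cycle_of :: "('a \<Rightarrow> 'a) \<Rightarrow> 'a \<Rightarrow> 'a set" where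
  "cycle_of p x = range (\<lambda>t. (p ^^ t) x)"

definition cycle_length :: "('a \<Rightarrow> 'a) \<Rightarrow> 'a \<Rightarrow> nat" where
  "cycle_length p x = (LEAST m. 0 < m \<and> (p ^^ m) x = x)"

text \<open>The choice depends only on the cycle as a set, so all its points get the same
  representative.\<close>

definition cycle_rep :: "('a \<Rightarrow> 'a) \<Rightarrow> 'a \<Rightarrow> 'a" where
  "cycle_rep p x = (SOME y. y \<in> cycle_of p x)"

definition cycle_reps :: "('a \<Rightarrow> 'a) \<Rightarrow> 'a set" where
  "cycle_reps p = range (cycle_rep p)"

definition cycle_type :: "('a \<Rightarrow> 'a) \<Rightarrow> nat multiset" where
  "cycle_type p = image_mset (cycle_length p) (mset_set (cycle_reps p))"

text \<open>Bijections between the fibres are glued. This serves to match cycles of equal length,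
  and later cycles on which in addition the d-th powers of two vectors agree.\<close>

lemma bij_betw_fibres:
  assumes "finite A" "finite B" and eq: "\<And>v. card {a \<in> A. f a = v} = card {b \<in> B. g b = v}"
  shows "\<exists>\<sigma>. bij_betw \<sigma> A B \<and> (\<forall>a\<in>A. g (\<sigma> a) = f a)"
proof -
  have "\<exists>h. bij_betw h {a \<in> A. f a = v} {b \<in> B. g b = v}" for v
    using assms by (intro finite_same_card_bij) auto
  then obtain h where h: "\<And>v. bij_betw (h v) {a \<in> A. f a = v} {b \<in> B. g b = v}"
    by metis
  define \<sigma> where "\<sigma> a = h (f a) a" for a
  have \<sigma>: "\<sigma> a \<in> B" "g (\<sigma> a) = f a" if "a \<in> A" for a
    using bij_betw_apply [OF h [of "f a"], of a] that by (auto simp: \<sigma>_def)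
  have "inj_on \<sigma> A"
  proof (rule inj_onI)
    fix a b assume ab: "a \<in> A" "b \<in> A" "\<sigma> a = \<sigma> b"
    then have "f a = f b" using \<sigma> by metis
    then show "a = b"
      using ab inj_onD [OF bij_betw_imp_inj_on [OF h [of "f a"]], of a b] by (simp add: \<sigma>_def)
  qed
  moreover have "b \<in> \<sigma> ` A" if b: "b \<in> B" for b
  proof -
    have "b \<in> h (g b) ` {a \<in> A. f a = g b}"
      using bij_betw_imp_surj_on [OF h [of "g b"]] b by auto
    then obtain a where "a \<in> A" "f a = g b" "b = h (g b) a" by blast
    then show ?thesis
      by (intro image_eqI[of _ _ a]) (simp_all add: \<sigma>_def)
  qed
  ultimately show ?thesis
    using \<sigma> by (intro exI[of _ \<sigma>]) (auto simp: bij_betw_def)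
qed

context
  fixes p :: "'a::finite \<Rightarrow> 'a"
  assumes p: "bij p"
begin

lemma cycle_length: "0 < cycle_length p x" "(p ^^ cycle_length p x) x = x"
proof -
  obtain m where "0 < m" "(p ^^ m) x = x"
    by (rule funpow_inj_finite [of p x]) (use p in \<open>auto simp: bij_is_inj\<close>)
  then have "\<exists>m. 0 < m \<and> (p ^^ m) x = x" by blast
  then have "0 < cycle_length p x \<and> (p ^^ cycle_length p x) x = x"
    unfolding cycle_length_def by (rule LeastI_ex)
  then show "0 < cycle_length p x" "(p ^^ cycle_length p x) x = x" by auto
qed

lemma funpow_mod_cycle_length: "(p ^^ (t mod cycle_length p x)) x = (p ^^ t) x"
  by (rule funpow_mod_eq [OF cycle_length(2)])

lemma inj_funpow: "inj (p ^^ t)"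
  using p bij_is_inj by (induction t) (auto intro: inj_compose)

lemma funpow_eq_self_iff: "(p ^^ t) x = x \<longleftrightarrow> cycle_length p x dvd t"
proof
  assume "(p ^^ t) x = x"
  then have "(p ^^ (t mod cycle_length p x)) x = x"
    by (simp add: funpow_mod_cycle_length)
  moreover have "t mod cycle_length p x < cycle_length p x"
    using cycle_length(1) by simp
  ultimately have "\<not> 0 < t mod cycle_length p x"
    using not_less_Least [of "t mod cycle_length p x" "\<lambda>m. 0 < m \<and> (p ^^ m) x = x"] by (simp add: cycle_length_def)
  then show "cycle_length p x dvd t" by (simp add: mod_eq_0_iff_dvd)
next
  assume "cycle_length p x dvd t"
  then show "(p ^^ t) x = x"
    using funpow_mod_cycle_length [of t x] by (simp add: mod_eq_0_iff_dvd [symmetric])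
qed

lemma funpow_eq_iff: "(p ^^ s) x = (p ^^ t) x \<longleftrightarrow> s mod cycle_length p x = t mod cycle_length p x"
proof (induction s t rule: linorder_wlog)
  case (le s t)
  then have "(p ^^ t) x = (p ^^ s) ((p ^^ (t - s)) x)"
    by (simp flip: funpow_add o_apply[of "p ^^ s"])
  then have "(p ^^ s) x = (p ^^ t) x \<longleftrightarrow> (p ^^ (t - s)) x = x"
    using inj_funpow by (metis injD)
  then show ?case
    using le by (simp add: funpow_eq_self_iff) (metis mod_eq_dvd_iff_nat)
qed auto

lemma cycle_of_refl: "x \<in> cycle_of p x"
  unfolding cycle_of_def by (metis funpow_0 rangeI)

lemma cycle_of_eq: "y \<in> cycle_of p x \<Longrightarrow> cycle_of p y = cycle_of p x"
proof -
  assume "y \<in> cycle_of p x"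
  then obtain t where t: "y = (p ^^ t) x" by (auto simp: cycle_of_def)
  have 1: "(p ^^ s) y = (p ^^ (s + t)) x" for s
    by (simp add: t funpow_add)
  \<comment> \<open>Going back \<open>t\<close> steps is going forward the remaining steps of
    \<open>t\<close> full turns.\<close>
  have 2: "(p ^^ s) x = (p ^^ (s + (cycle_length p x * t - t))) y" for s
  proof -
    have "t \<le> cycle_length p x * t" using cycle_length(1)[of x] by simp
    then have "s + (cycle_length p x * t - t) + t = s + cycle_length p x * t"
      by linarith
    then have "(p ^^ (s + (cycle_length p x * t - t))) y = (p ^^ (s + cycle_length p x * t)) x"
      by (simp only: 1)
    then show ?thesis by (simp add: funpow_eq_iff)
  qed
  show "cycle_of p y = cycle_of p x"
    unfolding cycle_of_def using 1 2 by (auto simp: image_iff)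
qed

lemma cycle_length_funpow: "cycle_length p ((p ^^ t) x) = cycle_length p x"
proof -
  have "(p ^^ m) ((p ^^ t) x) = (p ^^ t) x \<longleftrightarrow> (p ^^ m) x = x" for m
  proof -
    have "(p ^^ m) ((p ^^ t) x) = (p ^^ t) ((p ^^ m) x)"
      by (simp flip: funpow_add o_apply[of "p ^^ m"] o_apply[of "p ^^ t"] add: add.commute)
    then show ?thesis using inj_funpow by (metis injD)
  qed
  then show ?thesis by (simp add: cycle_length_def)
qed

lemma cycle_length_eq: "y \<in> cycle_of p x \<Longrightarrow> cycle_length p y = cycle_length p x"
  by (auto simp: cycle_of_def cycle_length_funpow)

lemma cycle_rep_in: "cycle_rep p x \<in> cycle_of p x"
  unfolding cycle_rep_def using cycle_of_refl by (rule someI)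

lemma cycle_rep_eq_iff: "cycle_rep p x = cycle_rep p y \<longleftrightarrow> x \<in> cycle_of p y"
  by (metis cycle_of_eq cycle_of_refl cycle_rep_def cycle_rep_in)

lemma cycle_rep_idem: "c \<in> cycle_reps p \<Longrightarrow> cycle_rep p c = c"
  unfolding cycle_reps_def using cycle_rep_eq_iff cycle_rep_in by auto

lemma cycle_length_rep: "cycle_length p (cycle_rep p x) = cycle_length p x"
  using cycle_length_eq cycle_rep_in by blast

lemma cycle_pos_exists: "\<exists>t. x = (p ^^ t) (cycle_rep p x)"
proof -
  have "x \<in> cycle_of p (cycle_rep p x)"
    using cycle_of_eq [OF cycle_rep_in] cycle_of_refl by blast
  then show ?thesis by (auto simp: cycle_of_def)
qed

lemma cycle_rep_funpow: "cycle_rep p ((p ^^ t) x) = cycle_rep p x"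
  using cycle_rep_eq_iff by (auto simp: cycle_of_def)

lemma bij_betw_cycle_positions:
  "bij_betw (\<lambda>(c, t). (p ^^ t) c) (SIGMA c : cycle_reps p. {..<cycle_length p c}) UNIV"
proof -
  have "inj_on (\<lambda>(c, t). (p ^^ t) c) (SIGMA c : cycle_reps p. {..<cycle_length p c})"
  proof (rule inj_onI, clarify)
    fix c s c' t
    assume c: "c \<in> cycle_reps p" "c' \<in> cycle_reps p" and st: "s < cycle_length p c" "t < cycle_length p c'"
      and eq: "(p ^^ s) c = (p ^^ t) c'"
    have "cycle_rep p ((p ^^ s) c) = cycle_rep p ((p ^^ t) c')"
      using eq by simp
    then have "c = c'"
      using c by (simp add: cycle_rep_funpow cycle_rep_idem)
    with st eq show "c = c' \<and> s = t"
      by (simp add: funpow_eq_iff)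
  qed
  moreover have "x \<in> (\<lambda>(c, t). (p ^^ t) c) ` (SIGMA c : cycle_reps p. {..<cycle_length p c})" for x
  proof -
    obtain t where "x = (p ^^ t) (cycle_rep p x)" using cycle_pos_exists by blast
    then have "x = (p ^^ (t mod cycle_length p (cycle_rep p x))) (cycle_rep p x)"
      by (simp add: funpow_mod_cycle_length)
    then show ?thesis
      using cycle_length(1) by (intro image_eqI[of _ _ "(cycle_rep p x, t mod cycle_length p (cycle_rep p x))"])
        (auto simp: cycle_reps_def)
  qed
  ultimately show ?thesis by (auto simp: bij_betw_def)
qed

lemma prod_over_cycles:
  "(\<Prod>x\<in>UNIV. f x) = (\<Prod>c\<in>cycle_reps p. \<Prod>t<cycle_length p c. f ((p ^^ t) c))"
  by (subst prod.Sigma) (auto simp: case_prod_unfold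
    simp flip: prod.reindex_bij_betw [OF bij_betw_cycle_positions, of f])

lemma sum_cycle_lengths: "(\<Sum>c\<in>cycle_reps p. cycle_length p c) = CARD('a)"
  using bij_betw_same_card [OF bij_betw_cycle_positions] by simp

text \<open>Any transversal of the cycles may replace the chosen representatives, of which nothing
  is known beyond their cycle.\<close>

lemma cycle_type_eq_image_mset:
  assumes J: "finite J" and inj: "\<And>i j. \<lbrakk>i \<in> J; j \<in> J; h i \<in> cycle_of p (h j)\<rbrakk> \<Longrightarrow> i = j"
    and cover: "\<And>x. \<exists>i\<in>J. x \<in> cycle_of p (h i)"
  shows "cycle_type p = image_mset (\<lambda>i. cycle_length p (h i)) (mset_set J)"
proof -
  have "inj_on (\<lambda>i. cycle_rep p (h i)) J"
    using inj by (auto simp: inj_on_def cycle_rep_eq_iff)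
  moreover have "(\<lambda>i. cycle_rep p (h i)) ` J = cycle_reps p"
    using cover unfolding cycle_reps_def by (auto simp: image_iff) (metis cycle_rep_eq_iff)
  ultimately have "mset_set (cycle_reps p) = image_mset (\<lambda>i. cycle_rep p (h i)) (mset_set J)"
    by (metis image_mset_mset_set)
  then show ?thesis
    by (simp add: cycle_type_def image_mset.compositionality o_def cycle_length_rep)
qed

lemma cycle_type_in_partitions: "cycle_type p \<in> partitions CARD('a)"
proof -
  have "0 \<notin># cycle_type p"
  proof
    assume "0 \<in># cycle_type p"
    then obtain c where "0 = cycle_length p c"
      unfolding cycle_type_def set_image_mset by blast
    then show False
      using cycle_length(1)[of c] by simp
  qed
  then show ?thesis
    using sum_cycle_lengths by (simp add: partitions_def cycle_type_def sum_unfold_sum_mset)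
qed

end

text \<open>Besides the matching of cycles there is a free offset \<open>s c\<close> at which each
  cycle starts. Conjugacy needs no particular offset; the offsets matter when rotations of the
  cycles have to absorb powers of a root of unity.\<close>

lemma conjugating_bijection_exists:
  fixes p p' :: "'a::finite \<Rightarrow> 'a"
  assumes p: "bij p" and p': "bij p'" and \<sigma>: "bij_betw \<sigma> (cycle_reps p) (cycle_reps p')"
    and len: "\<And>c. c \<in> cycle_reps p \<Longrightarrow> cycle_length p' (\<sigma> c) = cycle_length p c"
  shows "\<exists>\<alpha>. bij \<alpha> \<and> \<alpha> \<circ> p = p' \<circ> \<alpha> \<and> (\<forall>c\<in>cycle_reps p. \<alpha> c = (p' ^^ s c) (\<sigma> c))"
proof -
  obtain pos where pos: "\<And>x. x = (p ^^ pos x) (cycle_rep p x)"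
    using cycle_pos_exists [OF p] by metis
  define \<alpha> where "\<alpha> x = (p' ^^ (pos x + s (cycle_rep p x))) (\<sigma> (cycle_rep p x))" for x
  have rep: "cycle_rep p x \<in> cycle_reps p" for x
    by (simp add: cycle_reps_def)
  \<comment> \<open>\<open>pos\<close> selects one exponent out of many; since matched cycles have
    the same length, the formula holds for every exponent \<open>t\<close>.\<close>
  have \<alpha>: "\<alpha> ((p ^^ t) c) = (p' ^^ (t + s c)) (\<sigma> c)" if c: "c \<in> cycle_reps p" for c t
  proof -
    have r: "cycle_rep p ((p ^^ t) c) = c"
      using c by (simp add: cycle_rep_funpow [OF p] cycle_rep_idem [OF p])
    then have "(p ^^ pos ((p ^^ t) c)) c = (p ^^ t) c"
      using pos [of "(p ^^ t) c"] by simp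
    then have "pos ((p ^^ t) c) mod cycle_length p c = t mod cycle_length p c"
      by (simp add: funpow_eq_iff [OF p])
    then have "(pos ((p ^^ t) c) + s c) mod cycle_length p c = (t + s c) mod cycle_length p c"
      by (metis mod_add_left_eq)
    then show ?thesis
      using len [OF c] by (simp add: \<alpha>_def r funpow_eq_iff [OF p'])
  qed
  have comm: "\<alpha> (p x) = p' (\<alpha> x)" for x
    using \<alpha> [OF rep, of "Suc (pos x)" x] \<alpha> [OF rep, of "pos x" x] pos [of x] by simp
  have "inj \<alpha>"
  proof (rule injI)
    fix x y assume eq: "\<alpha> x = \<alpha> y"
    have "cycle_rep p' (\<alpha> z) = \<sigma> (cycle_rep p z)" for z
      unfolding \<alpha>_def using cycle_rep_idem [OF p'] bij_betw_apply [OF \<sigma> rep]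
      by (simp add: cycle_rep_funpow [OF p'])
    then have r: "cycle_rep p x = cycle_rep p y"
      using eq inj_onD [OF bij_betw_imp_inj_on [OF \<sigma>]] rep by metis
    then have "(p' ^^ s (cycle_rep p y)) ((p' ^^ pos x) (\<sigma> (cycle_rep p y))) = (p' ^^ s (cycle_rep p y)) ((p' ^^ pos y) (\<sigma> (cycle_rep p y)))"
      using eq by (simp add: \<alpha>_def funpow_add add.commute [of "pos _"])
    then have "(p' ^^ pos x) (\<sigma> (cycle_rep p y)) = (p' ^^ pos y) (\<sigma> (cycle_rep p y))"
      using inj_funpow [OF p'] by (rule injD [rotated])
    then have "pos x mod cycle_length p (cycle_rep p y) = pos y mod cycle_length p (cycle_rep p y)"
      by (simp add: funpow_eq_iff [OF p'] len rep)
    then show "x = y"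
      using pos [of x] pos [of y] r by (metis funpow_eq_iff [OF p])
  qed
  then have "bij \<alpha>"
    by (simp add: bij_def finite_UNIV_inj_surj)
  moreover have "\<alpha> c = (p' ^^ s c) (\<sigma> c)" if "c \<in> cycle_reps p" for c
    using \<alpha> [OF that, of 0] by simp
  ultimately show ?thesis
    using comm by (intro exI[of _ \<alpha>]) auto
qed

lemma conjugate_iff_cycle_type_eq:
  fixes p p' :: "'a::finite \<Rightarrow> 'a"
  assumes p: "bij p" and p': "bij p'"
  shows "(\<exists>\<alpha>. bij \<alpha> \<and> p' = \<alpha> \<circ> p \<circ> inv_into UNIV \<alpha>) \<longleftrightarrow> cycle_type p = cycle_type p'"
proof
  assume "\<exists>\<alpha>. bij \<alpha> \<and> p' = \<alpha> \<circ> p \<circ> inv_into UNIV \<alpha>"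
  then obtain \<alpha> where \<alpha>: "bij \<alpha>" "p' = \<alpha> \<circ> p \<circ> inv_into UNIV \<alpha>" by blast
  have pow: "(p' ^^ t) (\<alpha> x) = \<alpha> ((p ^^ t) x)" for t x
    by (induction t) (simp_all add: \<alpha> bij_is_inj)
  have len: "cycle_length p' (\<alpha> x) = cycle_length p x" for x
    unfolding cycle_length_def pow using \<alpha>(1) by (simp add: bij_is_inj inj_eq)
  have cyc: "\<alpha> x \<in> cycle_of p' (\<alpha> y) \<longleftrightarrow> x \<in> cycle_of p y" for x y
    unfolding cycle_of_def pow using \<alpha>(1) by (auto simp: bij_is_inj inj_eq)
  \<comment> \<open>The images of the representatives of \<open>p\<close> form a transversal for
    \<open>p'\<close>, though in general not the chosen one.\<close>
  have "cycle_type p' = image_mset (\<lambda>i. cycle_length p' (\<alpha> i)) (mset_set (cycle_reps p))"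
  proof (rule cycle_type_eq_image_mset [OF p'])
    fix i j assume "i \<in> cycle_reps p" "j \<in> cycle_reps p" "\<alpha> i \<in> cycle_of p' (\<alpha> j)"
    then show "i = j"
      using cycle_rep_eq_iff [OF p, of i j] by (simp add: cyc cycle_rep_idem [OF p])
  next
    fix x
    have "\<alpha> (inv_into UNIV \<alpha> x) \<in> cycle_of p' (\<alpha> (cycle_rep p (inv_into UNIV \<alpha> x)))"
      unfolding cyc using cycle_of_eq [OF p cycle_rep_in [OF p]] cycle_of_refl [OF p] by blast
    then show "\<exists>i\<in>cycle_reps p. x \<in> cycle_of p' (\<alpha> i)"
      using \<alpha>(1) by (auto simp: cycle_reps_def bij_is_surj surj_f_inv_f)
  qed simp
  then show "cycle_type p = cycle_type p'"
    by (simp add: len cycle_type_def)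
next
  assume eq: "cycle_type p = cycle_type p'"
  have "card {c \<in> cycle_reps p. cycle_length p c = v} = count (cycle_type p) v" for p :: "'a \<Rightarrow> 'a" and v
    by (simp add: cycle_type_def count_image_mset vimage_def Int_def conj_commute)
  then obtain \<sigma> where \<sigma>: "bij_betw \<sigma> (cycle_reps p) (cycle_reps p')" "\<forall>c\<in>cycle_reps p. cycle_length p' (\<sigma> c) = cycle_length p c"
    using bij_betw_fibres [of "cycle_reps p" "cycle_reps p'" "cycle_length p" "cycle_length p'"] eq by auto
  then obtain \<alpha> where \<alpha>: "bij \<alpha>" "\<alpha> \<circ> p = p' \<circ> \<alpha>"
    using conjugating_bijection_exists [OF p p' \<sigma>(1)] by blast
  then have "\<alpha> \<circ> p \<circ> inv_into UNIV \<alpha> = p'"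
    by (simp add: fun_eq_iff bij_is_surj surj_f_inv_f)
  then show "\<exists>\<alpha>. bij \<alpha> \<and> p' = \<alpha> \<circ> p \<circ> inv_into UNIV \<alpha>"
    using \<alpha>(1) by metis
qed

lemma cycle_type_exists:
  assumes \<mu>: "\<mu> \<in> partitions CARD('a::finite)"
  shows "\<exists>p :: 'a \<Rightarrow> 'a. bij p \<and> cycle_type p = \<mu>"
proof -
  obtain ms where ms: "mset ms = \<mu>" by (metis ex_mset)
  define r where "r = length ms"
  have pos: "ms ! i > 0" if "i < r" for i
  proof -
    have "ms ! i \<in># \<mu>"
      using that ms by (auto simp: r_def)
    then show ?thesis
      using \<mu> by (auto simp: partitions_def intro: gr0I)
  qed
  define S where "S = (SIGMA i : {..<r}. {..<ms ! i})"
  have "card S = sum_list ms"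
    by (simp add: S_def r_def sum_list_sum_nth atLeast0LessThan)
  also have "\<dots> = CARD('a)"
    using \<mu> ms by (simp add: partitions_def flip: sum_mset_sum_list)
  finally obtain \<phi> where \<phi>: "bij_betw \<phi> S (UNIV :: 'a set)"
    by (metis S_def bij_betw_iff_card finite_SigmaI finite_code finite_lessThan)
  \<comment> \<open>The model permutation rotates each block by one step; \<open>\<phi>\<close>
    transports it to the given type, whose size is the total size of the blocks.\<close>
  define q where "q = (\<lambda>(i, t). (i, Suc t mod ms ! i))"
  have qS: "q x \<in> S" if "x \<in> S" for x
    using that pos by (auto simp: S_def q_def)
  have qpow: "(q ^^ s) (i, t) = (i, (t + s) mod ms ! i)" if "(i, t) \<in> S" for i t s
    using that by (induction s) (auto simp: S_def q_def mod_Suc_eq)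
  define p where "p x = \<phi> (q (inv_into S \<phi> x))" for x
  have p\<phi>: "p (\<phi> x) = \<phi> (q x)" if "x \<in> S" for x
    using that \<phi> by (simp add: p_def bij_betw_inv_into_left)
  have ppow: "(p ^^ s) (\<phi> x) = \<phi> ((q ^^ s) x) \<and> (q ^^ s) x \<in> S" if "x \<in> S" for x s
    using that by (induction s) (auto simp: p\<phi> qS)
  have inj: "\<phi> x = \<phi> y \<longleftrightarrow> x = y" if "x \<in> S" "y \<in> S" for x y
    using \<phi> that by (meson bij_betw_imp_inj_on inj_on_eq_iff)
  have ex\<phi>: "\<exists>i t. (i, t) \<in> S \<and> x = \<phi> (i, t)" for x
    using \<phi> by (metis UNIV_I bij_betw_imp_surj_on imageE surj_pair)
  have "surj p"
  proof (rule surjI)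
    fix x
    obtain i t where it: "(i, t) \<in> S" "x = \<phi> (i, t)" using ex\<phi> by blast
    have "Suc (ms ! i - 1) = ms ! i" using it pos by (auto simp: S_def)
    then have "(p ^^ Suc (ms ! i - 1)) x = x"
      using ppow [OF it(1)] it qpow [OF it(1), of "ms ! i"] by (auto simp: S_def)
    then show "p ((\<lambda>x. (p ^^ (ms ! fst (inv_into S \<phi> x) - 1)) x) x) = x"
      using it \<phi> by (simp add: bij_betw_inv_into_left)
  qed
  then have p: "bij p"
    by (simp add: bij_def finite_UNIV_surj_inj)
  have S0: "(i, 0) \<in> S" if "i < r" for i
    using that pos by (auto simp: S_def)
  have len: "cycle_length p (\<phi> (i, 0)) = ms ! i" if i: "i < r" for i
  proof -
    have "(p ^^ s) (\<phi> (i, 0)) = \<phi> (i, 0) \<longleftrightarrow> ms ! i dvd s" for s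
      using ppow [OF S0 [OF i], of s] inj S0 [OF i] qpow [OF S0 [OF i], of s] by (auto simp: mod_eq_0_iff_dvd)
    then have "cycle_length p (\<phi> (i, 0)) dvd s \<longleftrightarrow> ms ! i dvd s" for s
      by (simp flip: funpow_eq_self_iff [OF p])
    then show ?thesis by (meson dvd_antisym dvd_refl)
  qed
  have "cycle_type p = image_mset (\<lambda>i. cycle_length p (\<phi> (i, 0))) (mset_set {..<r})"
  proof (rule cycle_type_eq_image_mset [OF p])
    fix i j assume ij: "i \<in> {..<r}" "j \<in> {..<r}" "\<phi> (i, 0) \<in> cycle_of p (\<phi> (j, 0))"
    then obtain s where s: "\<phi> (i, 0) = (p ^^ s) (\<phi> (j, 0))" by (auto simp: cycle_of_def)
    then have "(i, 0) = (j, s mod ms ! j)"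
      using ppow [OF S0, of j s] inj [OF S0] ij qpow [OF S0, of j s] by auto
    then show "i = j" by simp
  next
    fix x
    obtain i t where it: "(i, t) \<in> S" "x = \<phi> (i, t)" using ex\<phi> by blast
    then have "x = (p ^^ t) (\<phi> (i, 0))" "i < r"
      using ppow [OF S0, of i t] qpow [OF S0, of i t] by (auto simp: S_def)
    then show "\<exists>i\<in>{..<r}. x \<in> cycle_of p (\<phi> (i, 0))"
      by (auto simp: cycle_of_def)
  qed simp
  also have "\<dots> = image_mset (\<lambda>i. ms ! i) (mset_set {..<r})"
    by (intro image_mset_cong) (simp add: len)
  also have "\<dots> = \<mu>"
    unfolding ms[symmetric] r_def by (metis lessThan_atLeast0 map_nth mset_map mset_upt)
  finally show ?thesis using p by blast
qed

section \<open>The extended quotient in coordinates\<close>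

definition diagonal_matrix :: "complex^'n \<Rightarrow> complex^'n^'n" where
  "diagonal_matrix x = (\<chi> i j. if i = j then x $ i else 0)"

definition unit_torus :: "(complex^'n) set" where
  "unit_torus = {x. (\<Prod>i\<in>UNIV. x $ i) = 1}"

definition permute_coords :: "('n \<Rightarrow> 'n) \<Rightarrow> complex^'n \<Rightarrow> complex^'n" where
  "permute_coords p x = (\<chi> i. x $ inv_into UNIV p i)"

definition torus_coset :: "nat \<Rightarrow> complex^'n \<Rightarrow> (complex^'n^'n) set" where
  "torus_coset k x = scalar_roots k #>\<^bsub>SL\<^esub> diagonal_matrix x"

definition twisted_torus :: "('n \<Rightarrow> 'n) \<Rightarrow> complex \<Rightarrow> (complex^'n) set" where
  "twisted_torus p \<zeta> = {x \<in> unit_torus. permute_coords p x = \<zeta> *s x}"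

text \<open>A coset of C_k is fixed by \<open>p\<close> when the vector is fixed up to a k-th root
  of unity, the twist; see \<open>torus_coset_fixed_iff\<close>.\<close>

definition fixed_torus :: "nat \<Rightarrow> ('n \<Rightarrow> 'n) \<Rightarrow> (complex^'n) set" where
  "fixed_torus k p = (\<Union>\<zeta>\<in>{\<zeta>. \<zeta> ^ k = 1}. twisted_torus p \<zeta>)"

definition point_class :: "nat \<Rightarrow> ('n \<Rightarrow> 'n) \<Rightarrow> complex^'n \<Rightarrow> (('n \<Rightarrow> 'n) \<times> (complex^'n^'n) set) set" where
  "point_class k p x =
     orbit (BijGroup UNIV) (pair_action (BijGroup UNIV) (\<lambda>p X. permute_entries p ` X)) (p, torus_coset k x)"

lemma diagonal_matrix_inject: "diagonal_matrix x = diagonal_matrix y \<longleftrightarrow> x = y"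
proof
  assume "diagonal_matrix x = diagonal_matrix y"
  then have "diagonal_matrix x $ i $ i = diagonal_matrix y $ i $ i" for i
    by simp
  then show "x = y"
    by (simp add: diagonal_matrix_def vec_eq_iff)
qed simp

lemma mat_times_diagonal_matrix: "mat z ** diagonal_matrix x = diagonal_matrix (z *s x)"
proof -
  have "(\<Sum>l\<in>UNIV. (if i = l then z else 0) * (if l = j then x $ l else 0)) = (if i = j then z * x $ i else 0)" for i j
  proof -
    have "(\<Sum>l\<in>UNIV. (if i = l then z else 0) * (if l = j then x $ l else 0)) =
        (\<Sum>l\<in>UNIV. if l = i then z * (if i = j then x $ i else 0) else 0)"
      by (intro sum.cong) auto
    then show ?thesis by simp
  qed
  then show ?thesis
    by (simp add: diagonal_matrix_def vec_eq_iff matrix_matrix_mult_def mat_def)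
qed

lemma torus_coset_eq: "torus_coset k x = {diagonal_matrix (z *s x) | z. z ^ k = 1}"
  by (auto simp: torus_coset_def r_coset_def scalar_roots_def SL_def mat_times_diagonal_matrix)

lemma torus_coset_eq_iff:
  assumes k: "k > 0"
  shows "torus_coset k x = torus_coset k y \<longleftrightarrow> (\<exists>\<eta>. \<eta> ^ k = 1 \<and> y = \<eta> *s x)"
proof
  assume "torus_coset k x = torus_coset k y"
  moreover have "diagonal_matrix y \<in> torus_coset k y"
    by (auto simp: torus_coset_eq intro!: exI[of _ 1])
  ultimately have "diagonal_matrix y \<in> torus_coset k x"
    by simp
  then show "\<exists>\<eta>. \<eta> ^ k = 1 \<and> y = \<eta> *s x"
    by (auto simp: torus_coset_eq diagonal_matrix_inject)
next
  assume "\<exists>\<eta>. \<eta> ^ k = 1 \<and> y = \<eta> *s x"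
  then obtain \<eta> where \<eta>: "\<eta> ^ k = 1" "y = \<eta> *s x" by blast
  have \<eta>0: "\<eta> \<noteq> 0" using \<eta>(1) k by (auto simp: power_0_left)
  have "\<exists>w. w ^ k = 1 \<and> diagonal_matrix (z *s x) = diagonal_matrix (w *s y)" if "z ^ k = 1" for z
    using that \<eta> \<eta>0 by (intro exI[of _ "z / \<eta>"]) (simp add: power_divide diagonal_matrix_inject)
  moreover have "\<exists>w. w ^ k = 1 \<and> diagonal_matrix (z *s y) = diagonal_matrix (w *s x)" if "z ^ k = 1" for z
    using that \<eta> by (intro exI[of _ "z * \<eta>"]) (simp add: power_mult_distrib diagonal_matrix_inject)
  ultimately show "torus_coset k x = torus_coset k y"
    unfolding torus_coset_eq by blast
qed

lemma permute_coords_scale: "permute_coords p (z *s x) = z *s permute_coords p x"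
  by (simp add: permute_coords_def vec_eq_iff)

lemma permute_coords_comp:
  assumes "bij p" "bij q"
  shows "permute_coords p (permute_coords q x) = permute_coords (p \<circ> q) x"
  using assms by (simp add: permute_coords_def vec_eq_iff o_inv_distrib)

lemma permute_coords_id: "permute_coords id x = x"
  by (simp add: permute_coords_def vec_eq_iff)

lemma permute_coords_unit_torus:
  assumes "bij p"
  shows "permute_coords p x \<in> unit_torus \<longleftrightarrow> x \<in> unit_torus"
  using prod.reindex_bij_betw [OF bij_imp_bij_inv [OF assms], of "\<lambda>i. x $ i"]
  by (simp add: unit_torus_def permute_coords_def)

lemma permute_entries_diagonal_matrix:
  assumes "bij p"
  shows "permute_entries p (diagonal_matrix x) = diagonal_matrix (permute_coords p x)"
  using bij_is_inj [OF bij_imp_bij_inv [OF assms]]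
  by (simp add: permute_entries_def diagonal_matrix_def permute_coords_def vec_eq_iff inj_eq)

lemma permute_entries_torus_coset:
  fixes p :: "'n::finite \<Rightarrow> 'n"
  assumes "bij p"
  shows "permute_entries p ` torus_coset k x = torus_coset k (permute_coords p x)"
proof -
  have "torus_coset k y = (\<lambda>z. diagonal_matrix (z *s y)) ` {z. z ^ k = 1}" for y :: "complex^'n"
    by (auto simp: torus_coset_eq)
  then show ?thesis
    by (simp only: image_image permute_entries_diagonal_matrix [OF assms] permute_coords_scale)
qed

lemma scale_unit_torus:
  fixes x :: "complex^'n"
  assumes "\<eta> ^ CARD('n) = 1"
  shows "\<eta> *s x \<in> unit_torus \<longleftrightarrow> x \<in> unit_torus"
  using assms by (simp add: unit_torus_def prod.distrib)

lemma diagonal_torus_eq: "diagonal_torus = diagonal_matrix ` unit_torus"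
proof (intro equalityI subsetI)
  fix A :: "complex^'n^'n" assume A: "A \<in> diagonal_torus"
  then have "det A = (\<Prod>i\<in>UNIV. A $ i $ i)"
    by (intro det_diagonal) (auto simp: diagonal_torus_def)
  moreover have "A = diagonal_matrix (\<chi> i. A $ i $ i)"
    using A by (auto simp: diagonal_torus_def diagonal_matrix_def vec_eq_iff)
  ultimately show "A \<in> diagonal_matrix ` unit_torus"
    using A by (intro image_eqI[of _ _ "\<chi> i. A $ i $ i"]) (auto simp: unit_torus_def diagonal_torus_def SL_def)
next
  fix A :: "complex^'n^'n" assume "A \<in> diagonal_matrix ` unit_torus"
  then obtain x where x: "x \<in> unit_torus" "A = diagonal_matrix x" by blast
  have "det A = (\<Prod>i\<in>UNIV. A $ i $ i)"
    by (rule det_diagonal) (simp add: x diagonal_matrix_def)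
  then show "A \<in> diagonal_torus"
    using x by (simp add: diagonal_torus_def SL_def unit_torus_def diagonal_matrix_def)
qed

lemma quotient_map_torus_coset:
  "quotient_map (top_of_set unit_torus) (quotient_torus k) (torus_coset k)"
proof -
  have "homeomorphic_maps (top_of_set unit_torus) (top_of_set diagonal_torus)
      (diagonal_matrix :: complex^'n \<Rightarrow> complex^'n^'n) (\<lambda>A. \<chi> i. A $ i $ i)"
    unfolding homeomorphic_maps_def diagonal_torus_eq
  proof (intro conjI)
    have "continuous_on unit_torus (diagonal_matrix :: complex^'n \<Rightarrow> complex^'n^'n)"
      unfolding diagonal_matrix_def
    proof (intro continuous_intros)
      show "continuous_on unit_torus (\<lambda>x :: complex^'n. if i = j then x $ i else 0)" for i j
        by (cases "i = j") (auto intro!: continuous_intros)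
    qed
    then show "continuous_map (top_of_set unit_torus) (top_of_set (diagonal_matrix ` unit_torus))
        (diagonal_matrix :: complex^'n \<Rightarrow> complex^'n^'n)"
      by auto
    show "continuous_map (top_of_set (diagonal_matrix ` unit_torus)) (top_of_set unit_torus)
        (\<lambda>A :: complex^'n^'n. \<chi> i. A $ i $ i)"
      by (auto intro!: continuous_intros simp: diagonal_matrix_def unit_torus_def)
  qed (auto simp: diagonal_matrix_def vec_eq_iff)
  then have "quotient_map (top_of_set unit_torus) (top_of_set diagonal_torus) (diagonal_matrix :: complex^'n \<Rightarrow> complex^'n^'n)"
    using homeomorphic_map_maps unfolding homeomorphic_map_def by blast
  from quotient_map_compose [OF this quotient_map_quotient_topology [of _ "\<lambda>A. scalar_roots k #>\<^bsub>SL\<^esub> A"]]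
  show ?thesis
    by (simp add: quotient_torus_def o_def torus_coset_def [abs_def])
qed

lemma topspace_quotient_torus: "topspace (quotient_torus k) = torus_coset k ` unit_torus"
  using quotient_imp_surjective_map [OF quotient_map_torus_coset, of k, symmetric] by simp

text \<open>The saturation of an open set is the union of its translates by C_k, which stay in
  \<open>unit_torus\<close> because k divides n.\<close>

lemma open_map_torus_coset:
  assumes k: "k > 0" and dvd: "k dvd CARD('n)"
  shows "open_map (top_of_set (unit_torus :: (complex^'n) set)) (quotient_torus k) (torus_coset k)"
  unfolding open_map_def
proof (intro allI impI)
  fix W :: "(complex^'n) set" assume W: "openin (top_of_set unit_torus) W"
  then have sub: "W \<subseteq> unit_torus" by (simp add: openin_imp_subset)
  have n1: "\<eta> ^ CARD('n) = 1" if "\<eta> ^ k = 1" for \<eta> :: complex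
    using dvd that by (metis dvdE power_mult power_one)
  have "{x \<in> unit_torus. torus_coset k x \<in> torus_coset k ` W} = (\<Union>\<eta>\<in>{\<eta>. \<eta> ^ k = 1}. {x \<in> unit_torus. \<eta> *s x \<in> W})"
    by (auto simp: image_iff torus_coset_eq_iff [OF k])
  moreover have "openin (top_of_set unit_torus) {x \<in> unit_torus. \<eta> *s x \<in> W}" if \<eta>: "\<eta> ^ k = 1" for \<eta>
  proof -
    have *: "continuous_map (top_of_set unit_torus) (top_of_set unit_torus) (\<lambda>x :: complex^'n. \<eta> *s x)"
      using scale_unit_torus [OF n1 [OF \<eta>]] by (auto simp: vector_scalar_mult_def intro!: continuous_intros)
    show ?thesis
      using openin_continuous_map_preimage [OF * W] by simp
  qed
  ultimately have "openin (top_of_set unit_torus) {x \<in> unit_torus. torus_coset k x \<in> torus_coset k ` W}"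
    by auto
  note * = this
  show "openin (quotient_torus k) (torus_coset k ` W)"
  proof -
    have "torus_coset k ` W \<subseteq> topspace (quotient_torus k)"
      unfolding topspace_quotient_torus by (rule image_mono [OF sub])
    then have "openin (top_of_set unit_torus) {x \<in> topspace (top_of_set unit_torus). torus_coset k x \<in> torus_coset k ` W} =
        openin (quotient_torus k) (torus_coset k ` W)"
      using quotient_map_torus_coset [of k] unfolding quotient_map_def by blast
    with * show ?thesis by simp
  qed
qed

section \<open>Orbits of pairs and the topology of the extended quotient\<close>

lemma carrier_BijGroup_UNIV: "carrier (BijGroup UNIV) = {f. bij f}"
  by (auto simp: BijGroup_def Bij_def extensional_def)

lemma pair_action_BijGroup:
  assumes "bij \<alpha>" "bij p"
  shows "pair_action (BijGroup UNIV) \<phi> \<alpha> (p, X) = (\<alpha> \<circ> p \<circ> inv_into UNIV \<alpha>, \<phi> \<alpha> X)"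
proof -
  have B: "\<alpha> \<in> Bij UNIV" "p \<in> Bij UNIV" "\<alpha> \<circ> p \<in> Bij UNIV" "inv_into UNIV \<alpha> \<in> Bij UNIV"
    using assms by (auto simp: Bij_def extensional_def bij_comp bij_imp_bij_inv)
  have comp: "compose UNIV f g = f \<circ> g" for f g :: "'a \<Rightarrow> 'a"
    by (simp add: compose_def fun_eq_iff)
  have "inv\<^bsub>BijGroup UNIV\<^esub> \<alpha> = inv_into UNIV \<alpha>"
    using inv_BijGroup [OF B(1)] by (simp add: restrict_def)
  then show ?thesis
    using B by (simp add: pair_action_def BijGroup_def comp)
qed

lemma point_class_eq:
  assumes "bij p"
  shows "point_class k p x = {(\<alpha> \<circ> p \<circ> inv_into UNIV \<alpha>, torus_coset k (permute_coords \<alpha> x)) | \<alpha>. bij \<alpha>}"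
proof -
  have "pair_action (BijGroup UNIV) (\<lambda>p X. permute_entries p ` X) \<alpha> (p, torus_coset k x) =
      (\<alpha> \<circ> p \<circ> inv_into UNIV \<alpha>, torus_coset k (permute_coords \<alpha> x))" if "bij \<alpha>" for \<alpha>
    by (simp add: pair_action_BijGroup [OF that assms] permute_entries_torus_coset [OF that])
  then show ?thesis
    unfolding point_class_def orbit_def carrier_BijGroup_UNIV
    by (intro Collect_cong iff_exI) auto
qed

lemma point_class_eq_iff:
  assumes k: "k > 0" and p: "bij p" "bij q"
  shows "point_class k p x = point_class k q y \<longleftrightarrow>
    (\<exists>\<alpha> \<eta>. bij \<alpha> \<and> \<eta> ^ k = 1 \<and> q = \<alpha> \<circ> p \<circ> inv_into UNIV \<alpha> \<and> y = \<eta> *s permute_coords \<alpha> x)"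
proof
  assume "point_class k p x = point_class k q y"
  moreover have "(q, torus_coset k y) \<in> point_class k q y"
    unfolding point_class_eq [OF p(2)] by (rule CollectI, rule exI[of _ id]) (simp add: permute_coords_id)
  ultimately have "(q, torus_coset k y) \<in> point_class k p x" by simp
  then obtain \<alpha> where \<alpha>: "bij \<alpha>" "q = \<alpha> \<circ> p \<circ> inv_into UNIV \<alpha>" "torus_coset k (permute_coords \<alpha> x) = torus_coset k y"
    unfolding point_class_eq [OF p(1)] by auto
  then show "\<exists>\<alpha> \<eta>. bij \<alpha> \<and> \<eta> ^ k = 1 \<and> q = \<alpha> \<circ> p \<circ> inv_into UNIV \<alpha> \<and> y = \<eta> *s permute_coords \<alpha> x"
    unfolding torus_coset_eq_iff [OF k] by blast
next
  \<comment> \<open>One inclusion for arbitrary data suffices: the relation is reversed by the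
    inverses of \<open>\<alpha>\<close> and \<open>\<eta>\<close>.\<close>
  have sub: "point_class k q y \<subseteq> point_class k p x"
    if h: "bij p" "bij q" "bij \<alpha>" "\<eta> ^ k = 1" "q = \<alpha> \<circ> p \<circ> inv_into UNIV \<alpha>" "y = \<eta> *s permute_coords \<alpha> x"
    for p q \<alpha> :: "'a \<Rightarrow> 'a" and \<eta> x y
  proof
    fix u assume "u \<in> point_class k q y"
    then obtain \<beta> where \<beta>: "bij \<beta>" "u = (\<beta> \<circ> q \<circ> inv_into UNIV \<beta>, torus_coset k (permute_coords \<beta> y))"
      unfolding point_class_eq [OF h(2)] by blast
    have "\<beta> \<circ> q \<circ> inv_into UNIV \<beta> = (\<beta> \<circ> \<alpha>) \<circ> p \<circ> inv_into UNIV (\<beta> \<circ> \<alpha>)"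
      using \<beta>(1) h(3) by (simp add: h(5) o_inv_distrib o_assoc)
    moreover have "permute_coords \<beta> y = \<eta> *s permute_coords (\<beta> \<circ> \<alpha>) x"
      using \<beta>(1) h(3) by (simp add: h(6) permute_coords_scale permute_coords_comp)
    then have "torus_coset k (permute_coords \<beta> y) = torus_coset k (permute_coords (\<beta> \<circ> \<alpha>) x)"
      using h(4) torus_coset_eq_iff [OF k] by metis
    ultimately show "u \<in> point_class k p x"
      unfolding point_class_eq [OF h(1)] \<beta>(2) using bij_comp [OF h(3) \<beta>(1)] by auto
  qed
  assume "\<exists>\<alpha> \<eta>. bij \<alpha> \<and> \<eta> ^ k = 1 \<and> q = \<alpha> \<circ> p \<circ> inv_into UNIV \<alpha> \<and> y = \<eta> *s permute_coords \<alpha> x"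
  then obtain \<alpha> \<eta> where \<alpha>: "bij \<alpha>" "\<eta> ^ k = 1" "q = \<alpha> \<circ> p \<circ> inv_into UNIV \<alpha>" "y = \<eta> *s permute_coords \<alpha> x"
    by blast
  let ?\<beta> = "inv_into UNIV \<alpha>"
  have \<beta>: "bij ?\<beta>" "\<alpha> \<circ> ?\<beta> = id" "?\<beta> \<circ> \<alpha> = id" "inv_into UNIV ?\<beta> = \<alpha>"
    using \<alpha>(1) by (simp_all add: fun_eq_iff bij_imp_bij_inv bij_is_inj bij_is_surj surj_f_inv_f inv_inv_eq)
  have "\<eta> \<noteq> 0" using \<alpha>(2) k by (auto simp: power_0_left)
  have "p = ?\<beta> \<circ> q \<circ> inv_into UNIV ?\<beta>"
    unfolding \<alpha>(3) \<beta>(4) using \<alpha>(1) by (simp add: fun_eq_iff bij_is_inj)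
  moreover have "x = inverse \<eta> *s permute_coords ?\<beta> y"
    using \<open>\<eta> \<noteq> 0\<close> \<alpha>(1) \<beta>(1,3) by (simp add: \<alpha>(4) permute_coords_scale permute_coords_comp permute_coords_id)
  moreover have "inverse \<eta> ^ k = 1"
    using \<alpha>(2) by (simp add: power_inverse)
  ultimately have "point_class k p x \<subseteq> point_class k q y"
    using sub [OF p(2) p(1) \<beta>(1)] by blast
  then show "point_class k p x = point_class k q y"
    using sub [OF p \<alpha>] by blast
qed

lemma fixed_torus_subset: "fixed_torus k p \<subseteq> unit_torus"
  by (auto simp: fixed_torus_def twisted_torus_def)

lemma unit_torus_nonzero:
  fixes x :: "complex^'n"
  assumes "x \<in> unit_torus"
  shows "x $ i \<noteq> 0"
proof
  assume "x $ i = 0"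
  then have "(\<Prod>i\<in>UNIV. x $ i) = 0"
    by (intro prod_zero) auto
  moreover have "(\<Prod>i\<in>UNIV. x $ i) = 1"
    using assms by (simp add: unit_torus_def)
  ultimately show False
    by (metis zero_neq_one)
qed

lemma twisted_torus_disjoint:
  assumes "x \<in> twisted_torus p \<zeta>" "x \<in> twisted_torus p \<zeta>'"
  shows "\<zeta> = \<zeta>'"
proof -
  have "\<zeta> * x $ i = \<zeta>' * x $ i" "x $ i \<noteq> 0" for i
    using assms unit_torus_nonzero [of x i] by (auto simp: twisted_torus_def vec_eq_iff)
  then show ?thesis by (metis mult_right_cancel)
qed

lemma torus_coset_fixed_iff:
  assumes k: "k > 0" and p: "bij p" and x: "x \<in> unit_torus"
  shows "permute_entries p ` torus_coset k x = torus_coset k x \<longleftrightarrow> x \<in> fixed_torus k p"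
  using x torus_coset_eq_iff [OF k, of x "permute_coords p x"]
  by (auto simp: permute_entries_torus_coset [OF p] fixed_torus_def twisted_torus_def)

text \<open>\<open>permute_coords \<alpha>\<close> intertwines \<open>p\<close> with its conjugate,
  and scalars commute with permutations. Hence the twist \<open>\<zeta>\<close> is an invariant of
  the orbit.\<close>

lemma fixed_torus_scale_permute:
  fixes p :: "'n::finite \<Rightarrow> 'n"
  assumes dvd: "k dvd CARD('n)" and p: "bij p" "bij \<alpha>" and \<eta>: "\<eta> ^ k = 1" and x: "x \<in> twisted_torus p \<zeta>"
  shows "\<eta> *s permute_coords \<alpha> x \<in> twisted_torus (\<alpha> \<circ> p \<circ> inv_into UNIV \<alpha>) \<zeta>"
proof -
  have "\<eta> ^ CARD('n) = 1"
    using dvd \<eta> by (metis dvdE power_mult power_one)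
  then have "\<eta> *s permute_coords \<alpha> x \<in> unit_torus"
    using x p(2) by (simp add: scale_unit_torus permute_coords_unit_torus twisted_torus_def)
  moreover have "permute_coords (\<alpha> \<circ> p \<circ> inv_into UNIV \<alpha>) (permute_coords \<alpha> x) = permute_coords \<alpha> (permute_coords p x)"
  proof -
    have "(\<alpha> \<circ> p \<circ> inv_into UNIV \<alpha>) \<circ> \<alpha> = \<alpha> \<circ> p"
      using p(2) by (simp add: fun_eq_iff bij_is_inj)
    then show ?thesis
      using p by (simp add: permute_coords_comp bij_comp bij_imp_bij_inv)
  qed
  then have "permute_coords (\<alpha> \<circ> p \<circ> inv_into UNIV \<alpha>) (\<eta> *s permute_coords \<alpha> x) = \<zeta> *s (\<eta> *s permute_coords \<alpha> x)"
    using x by (simp add: permute_coords_scale twisted_torus_def vector_smult_assoc mult.commute)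
  ultimately show ?thesis
    by (simp add: twisted_torus_def)
qed

lemma fixed_pairs_eq:
  assumes k: "k > 0"
  shows "fixed_pairs (BijGroup (UNIV :: 'n set)) (quotient_torus k) (\<lambda>p X. permute_entries p ` X) =
    {(p, torus_coset k x) | (p :: 'n::finite \<Rightarrow> 'n) x. bij p \<and> x \<in> fixed_torus k p}"
  unfolding fixed_pairs_def carrier_BijGroup_UNIV topspace_quotient_torus
  using torus_coset_fixed_iff [OF k] fixed_torus_subset by (fastforce simp: image_iff)

lemma topspace_torus_extended_quotient:
  assumes k: "k > 0"
  shows "topspace (torus_extended_quotient k :: (('n::finite \<Rightarrow> 'n) \<times> (complex^'n^'n) set) set topology) =
    {point_class k p x | p x. bij p \<and> x \<in> fixed_torus k p}"
proof -
  let ?F = "fixed_pairs (BijGroup (UNIV :: 'n set)) (quotient_torus k) (\<lambda>p X. permute_entries p ` X)"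
  have "?F \<subseteq> carrier (BijGroup UNIV) \<times> topspace (quotient_torus k)"
    by (auto simp: fixed_pairs_def)
  then show ?thesis
    unfolding torus_extended_quotient_def extended_quotient_def
    by (simp add: inf.absorb2 fixed_pairs_eq [OF k] point_class_def) blast
qed

text \<open>The group is discrete, so openness can be tested for one permutation at a time, and
  \<open>torus_coset\<close> is open, so it can be tested on vectors instead of cosets.\<close>

lemma openin_torus_extended_quotient:
  fixes U :: "(('n::finite \<Rightarrow> 'n) \<times> (complex^'n^'n) set) set set"
  assumes k: "k > 0" and dvd: "k dvd CARD('n)"
    and U: "U \<subseteq> topspace (torus_extended_quotient k)"
  shows "openin (torus_extended_quotient k) U \<longleftrightarrow>
    (\<forall>p. bij p \<longrightarrow> openin (top_of_set (fixed_torus k p)) {x \<in> fixed_torus k p. point_class k p x \<in> U})"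
proof -
  let ?G = "BijGroup (UNIV :: 'n set)"
  let ?F = "fixed_pairs ?G (quotient_torus k) (\<lambda>p X. permute_entries p ` X)"
  let ?P = "prod_topology (discrete_topology (carrier ?G)) (quotient_torus k)"
  let ?Q = "subtopology ?P ?F"
  let ?o = "orbit ?G (pair_action ?G (\<lambda>p X. permute_entries p ` X))"
  let ?N = "{y \<in> topspace ?Q. ?o y \<in> U}"
  have tQ: "topspace ?Q = ?F"
    by (auto simp: fixed_pairs_def)
  have "openin (torus_extended_quotient k) U \<longleftrightarrow> openin ?Q ?N"
    using U unfolding torus_extended_quotient_def extended_quotient_def openin_quotient_topology
    by auto
  also have "\<dots> \<longleftrightarrow> (\<forall>p. bij p \<longrightarrow> openin (top_of_set (fixed_torus k p)) {x \<in> fixed_torus k p. point_class k p x \<in> U})"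
  proof (intro iffI allI impI)
    fix p :: "'n \<Rightarrow> 'n" assume N: "openin ?Q ?N" and p: "bij p"
    have "continuous_map (top_of_set (fixed_torus k p)) (quotient_torus k) (torus_coset k)"
      using continuous_map_from_subtopology [OF quotient_imp_continuous_map [OF quotient_map_torus_coset], of "fixed_torus k p"]
        fixed_torus_subset by (metis subtopology_subtopology inf.absorb2)
    then have "continuous_map (top_of_set (fixed_torus k p)) ?Q (\<lambda>x. (p, torus_coset k x))"
      using p unfolding continuous_map_in_subtopology continuous_map_paired fixed_pairs_eq [OF k]
      by (auto simp: carrier_BijGroup_UNIV)
    then have "openin (top_of_set (fixed_torus k p)) {x \<in> topspace (top_of_set (fixed_torus k p)). (p, torus_coset k x) \<in> ?N}"
      using N by (rule openin_continuous_map_preimage)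
    moreover have "{x \<in> topspace (top_of_set (fixed_torus k p)). (p, torus_coset k x) \<in> ?N} =
        {x \<in> fixed_torus k p. point_class k p x \<in> U}"
      using p unfolding tQ unfolding fixed_pairs_eq [OF k] by (auto simp: point_class_def)
    ultimately show "openin (top_of_set (fixed_torus k p)) {x \<in> fixed_torus k p. point_class k p x \<in> U}"
      by simp
  next
    assume *: "\<forall>p. bij p \<longrightarrow> openin (top_of_set (fixed_torus k p)) {x \<in> fixed_torus k p. point_class k p x \<in> U}"
    have ex: "\<exists>T. open T \<and> {x \<in> fixed_torus k p. point_class k p x \<in> U} = fixed_torus k p \<inter> T" if "bij p" for p
      using * that by (auto simp: openin_open)
    define T where "T p = (SOME T. open T \<and> {x \<in> fixed_torus k p. point_class k p x \<in> U} = fixed_torus k p \<inter> T)" for p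
    have T: "open (T p)" "{x \<in> fixed_torus k p. point_class k p x \<in> U} = fixed_torus k p \<inter> T p" if "bij p" for p
      using someI_ex [OF ex [OF that]] unfolding T_def by blast+
    \<comment> \<open>The sets \<open>T p\<close> are open in the ambient vector space, so
      \<open>unit_torus \<inter> T p\<close> is open in the whole torus, where
      \<open>torus_coset\<close> is known to be an open map; intersecting with the fixed pairs then
      cuts the image down.\<close>
    have "?N = ?F \<inter> (\<Union>p\<in>{p. bij p}. {p} \<times> torus_coset k ` (unit_torus \<inter> T p))"
    proof (intro equalityI subsetI)
      fix y assume y: "y \<in> ?N"
      then obtain p x where px: "y = (p, torus_coset k x)" "bij p" "x \<in> fixed_torus k p"
        unfolding tQ unfolding fixed_pairs_eq [OF k] by auto
      then have "x \<in> fixed_torus k p \<inter> T p"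
        using y T(2) [OF px(2)] by (auto simp: point_class_def)
      then show "y \<in> ?F \<inter> (\<Union>p\<in>{p. bij p}. {p} \<times> torus_coset k ` (unit_torus \<inter> T p))"
        using y px fixed_torus_subset unfolding tQ by auto
    next
      fix y assume y: "y \<in> ?F \<inter> (\<Union>p\<in>{p. bij p}. {p} \<times> torus_coset k ` (unit_torus \<inter> T p))"
      then obtain p x where px: "y = (p, torus_coset k x)" "bij p" "x \<in> unit_torus" "x \<in> T p"
        by auto
      have "permute_entries p ` torus_coset k x = torus_coset k x"
        using y px(1) by (auto simp: fixed_pairs_def)
      then have "x \<in> fixed_torus k p \<inter> T p"
        using torus_coset_fixed_iff [OF k px(2,3)] px(4) by blast
      then have "point_class k p x \<in> U"
        unfolding T(2) [OF px(2), symmetric] by blast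
      then show "y \<in> ?N"
        using y px(1) unfolding tQ by (simp add: point_class_def)
    qed
    moreover have "openin ?P (\<Union>p\<in>{p. bij p}. {p} \<times> torus_coset k ` (unit_torus \<inter> T p))"
    proof (intro openin_Union, clarify)
      fix p :: "'n \<Rightarrow> 'n" assume p: "bij p"
      have "openin (top_of_set unit_torus) (unit_torus \<inter> T p)"
        using T(1) [OF p] by (simp add: openin_open_Int)
      then have "openin (quotient_torus k) (torus_coset k ` (unit_torus \<inter> T p))"
        using open_map_torus_coset [OF k dvd] by (simp add: open_map_def)
      then show "openin ?P ({p} \<times> torus_coset k ` (unit_torus \<inter> T p))"
        using p by (simp add: openin_prod_Times_iff carrier_BijGroup_UNIV)
    qed
    ultimately show "openin ?Q ?N"
      by (simp add: openin_subtopology_Int2)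
  qed
  finally show ?thesis .
qed

lemma continuous_map_point_class:
  fixes p :: "'n::finite \<Rightarrow> 'n"
  assumes k: "k > 0" and dvd: "k dvd CARD('n)" and p: "bij p"
  shows "continuous_map (top_of_set (fixed_torus k p)) (torus_extended_quotient k) (point_class k p)"
  unfolding continuous_map_def
proof (intro conjI allI impI)
  show "point_class k p \<in> topspace (top_of_set (fixed_torus k p)) \<rightarrow> topspace (torus_extended_quotient k)"
    using p by (auto simp: topspace_torus_extended_quotient [OF k])
  fix U :: "(('n \<Rightarrow> 'n) \<times> (complex^'n^'n) set) set set" assume "openin (torus_extended_quotient k) U"
  then show "openin (top_of_set (fixed_torus k p)) {x \<in> topspace (top_of_set (fixed_torus k p)). point_class k p x \<in> U}"
    using openin_torus_extended_quotient [OF k dvd openin_subset] p by auto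
qed

text \<open>The saturation of an open set is a union of its preimages under the continuous maps
  given by a conjugating permutation and a k-th root of unity.\<close>

lemma open_map_point_class:
  fixes p :: "'n::finite \<Rightarrow> 'n"
  assumes k: "k > 0" and dvd: "k dvd CARD('n)" and p: "bij p"
  shows "open_map (top_of_set (fixed_torus k p)) (torus_extended_quotient k) (point_class k p)"
  unfolding open_map_def
proof (intro allI impI)
  fix W assume W: "openin (top_of_set (fixed_torus k p)) W"
  then have sub: "W \<subseteq> fixed_torus k p" by (simp add: openin_imp_subset)
  then have subE: "point_class k p ` W \<subseteq> topspace (torus_extended_quotient k)"
    using p by (auto simp: topspace_torus_extended_quotient [OF k])
  show "openin (torus_extended_quotient k) (point_class k p ` W)"
    unfolding openin_torus_extended_quotient [OF k dvd subE]
  proof (intro allI impI)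
    fix q :: "'n \<Rightarrow> 'n" assume q: "bij q"
    let ?I = "{(\<alpha>, \<eta>). bij \<alpha> \<and> \<eta> ^ k = 1 \<and> p = \<alpha> \<circ> q \<circ> inv_into UNIV \<alpha>}"
    have "{x \<in> fixed_torus k q. point_class k q x \<in> point_class k p ` W} =
        (\<Union>(\<alpha>, \<eta>)\<in>?I. {x \<in> fixed_torus k q. \<eta> *s permute_coords \<alpha> x \<in> W})"
      using point_class_eq_iff [OF k q p] by (fastforce simp: image_iff)
    moreover have "openin (top_of_set (fixed_torus k q)) {x \<in> fixed_torus k q. \<eta> *s permute_coords \<alpha> x \<in> W}"
      if \<alpha>: "bij \<alpha>" "\<eta> ^ k = 1" "p = \<alpha> \<circ> q \<circ> inv_into UNIV \<alpha>" for \<alpha> \<eta>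
    proof -
      have "\<eta> *s permute_coords \<alpha> x \<in> fixed_torus k p" if "x \<in> fixed_torus k q" for x
        using that fixed_torus_scale_permute [OF dvd q \<alpha>(1,2)] unfolding \<alpha>(3) fixed_torus_def by blast
      then have *: "continuous_map (top_of_set (fixed_torus k q)) (top_of_set (fixed_torus k p)) (\<lambda>x. \<eta> *s permute_coords \<alpha> x)"
        by (auto simp: permute_coords_def vector_scalar_mult_def intro!: continuous_intros)
      show ?thesis
        using openin_continuous_map_preimage [OF * W] by simp
    qed
    ultimately show "openin (top_of_set (fixed_torus k q)) {x \<in> fixed_torus k q. point_class k q x \<in> point_class k p ` W}"
      by auto
  qed
qed

lemma closed_twisted_torus:
  fixes p :: "'n::finite \<Rightarrow> 'n"
  shows "closed (twisted_torus p \<zeta>)"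
proof -
  have "closed {x :: complex^'n. (\<Prod>i\<in>UNIV. x $ i) = 1}"
    by (intro closed_Collect_eq continuous_intros)
  moreover have "closed {x :: complex^'n. permute_coords p x = \<zeta> *s x}"
    unfolding permute_coords_def vector_scalar_mult_def by (intro closed_Collect_eq continuous_intros)
  ultimately have "closed ({x :: complex^'n. (\<Prod>i\<in>UNIV. x $ i) = 1} \<inter> {x. permute_coords p x = \<zeta> *s x})"
    by (rule closed_Int)
  moreover have "{x :: complex^'n. (\<Prod>i\<in>UNIV. x $ i) = 1} \<inter> {x. permute_coords p x = \<zeta> *s x} = twisted_torus p \<zeta>"
    by (auto simp: twisted_torus_def unit_torus_def)
  ultimately show ?thesis by simp
qed

text \<open>There are finitely many twists, and their tori are closed and pairwise disjoint, so each
  is the complement of a closed set.\<close>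

lemma openin_fixed_torus_twisted_torus:
  assumes k: "k > 0" and \<zeta>: "\<zeta> ^ k = 1"
  shows "openin (top_of_set (fixed_torus k p)) (twisted_torus p \<zeta>)"
proof -
  let ?C = "\<Union>\<zeta>'\<in>{\<zeta>'. \<zeta>' ^ k = 1} - {\<zeta>}. twisted_torus p \<zeta>'"
  have "finite {\<zeta>' :: complex. \<zeta>' ^ k = 1}"
    using k by (intro finite_roots_unity) simp
  then have "closed ?C"
    by (intro closed_UN) (auto simp: closed_twisted_torus)
  moreover have "twisted_torus p \<zeta> = fixed_torus k p \<inter> - ?C"
    using \<zeta> twisted_torus_disjoint unfolding fixed_torus_def by blast
  ultimately show ?thesis
    by (metis openin_open open_Compl)
qed

lemma openin_twisted_piece:
  fixes p :: "'n::finite \<Rightarrow> 'n"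
  assumes k: "k > 0" and dvd: "k dvd CARD('n)" and p: "bij p" and \<zeta>: "\<zeta> ^ k = 1"
  shows "openin (torus_extended_quotient k) (point_class k p ` twisted_torus p \<zeta>)"
  using open_map_point_class [OF k dvd p] openin_fixed_torus_twisted_torus [OF k \<zeta>, of p] by (simp add: open_map_def)

lemma quotient_map_twisted_piece:
  fixes p :: "'n::finite \<Rightarrow> 'n"
  assumes k: "k > 0" and dvd: "k dvd CARD('n)" and p: "bij p" and \<zeta>: "\<zeta> ^ k = 1"
  shows "quotient_map (top_of_set (twisted_torus p \<zeta>))
    (subtopology (torus_extended_quotient k) (point_class k p ` twisted_torus p \<zeta>)) (point_class k p)"
proof (rule continuous_open_imp_quotient_map)
  let ?S = "subtopology (torus_extended_quotient k) (point_class k p ` twisted_torus p \<zeta>)"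
  have sub: "twisted_torus p \<zeta> \<subseteq> fixed_torus k p"
    using \<zeta> by (auto simp: fixed_torus_def)
  have "top_of_set (twisted_torus p \<zeta>) = subtopology (top_of_set (fixed_torus k p)) (twisted_torus p \<zeta>)"
    using sub by (simp add: subtopology_subtopology inf.absorb2)
  then show "continuous_map (top_of_set (twisted_torus p \<zeta>)) ?S (point_class k p)"
    using continuous_map_point_class [OF k dvd p]
    by (simp add: continuous_map_in_subtopology continuous_map_from_subtopology image_subset_iff)
  show "open_map (top_of_set (twisted_torus p \<zeta>)) ?S (point_class k p)"
    unfolding open_map_def
  proof (intro allI impI)
    fix W assume W: "openin (top_of_set (twisted_torus p \<zeta>)) W"
    then have "openin (top_of_set (fixed_torus k p)) W"
      using openin_fixed_torus_twisted_torus [OF k \<zeta>, of p] openin_trans by blast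
    then have "openin (torus_extended_quotient k) (point_class k p ` W)"
      using open_map_point_class [OF k dvd p] by (simp add: open_map_def)
    moreover have "point_class k p ` W \<subseteq> point_class k p ` twisted_torus p \<zeta>"
      using openin_imp_subset [OF W] by blast
    ultimately show "openin ?S (point_class k p ` W)"
      by (simp add: openin_subset_topspace_eq openin_open_subtopology openin_twisted_piece [OF k dvd p \<zeta>])
  qed
  show "point_class k p ` topspace (top_of_set (twisted_torus p \<zeta>)) = topspace ?S"
    using openin_subset [OF openin_twisted_piece [OF k dvd p \<zeta>]] by (simp add: inf.absorb2)
qed

text \<open>The twist and the conjugacy class are invariants of a point of the extended quotient;
  this is what makes its pieces disjoint.\<close>

lemma twisted_pieces_meet:
  assumes k: "k > 0" and p: "bij p" "bij q" and x: "x \<in> twisted_torus p \<zeta>" "y \<in> twisted_torus q \<zeta>'"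
    and dvd: "k dvd CARD('n::finite)" and eq: "point_class k p x = point_class k q (y :: complex^'n)"
  shows "\<zeta> = \<zeta>'" "\<exists>\<alpha>. bij \<alpha> \<and> q = \<alpha> \<circ> p \<circ> inv_into UNIV \<alpha>"
proof -
  obtain \<alpha> \<eta> where \<alpha>: "bij \<alpha>" "\<eta> ^ k = 1" "q = \<alpha> \<circ> p \<circ> inv_into UNIV \<alpha>" "y = \<eta> *s permute_coords \<alpha> x"
    using eq point_class_eq_iff [OF k p] by blast
  have "y \<in> twisted_torus q \<zeta>"
    unfolding \<alpha>(3,4) by (rule fixed_torus_scale_permute [OF dvd p(1) \<alpha>(1,2) x(1)])
  then show "\<zeta> = \<zeta>'"
    using twisted_torus_disjoint x(2) by blast
  show "\<exists>\<alpha>. bij \<alpha> \<and> q = \<alpha> \<circ> p \<circ> inv_into UNIV \<alpha>"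
    using \<alpha> by blast
qed

lemma point_class_conjugate:
  fixes x :: "complex^'n::finite"
  assumes k: "k > 0" and p: "bij p" "bij \<alpha>" and dvd: "k dvd CARD('n)" and x: "x \<in> twisted_torus p \<zeta>"
  shows "point_class k p x \<in> point_class k (\<alpha> \<circ> p \<circ> inv_into UNIV \<alpha>) ` twisted_torus (\<alpha> \<circ> p \<circ> inv_into UNIV \<alpha>) \<zeta>"
proof (rule image_eqI)
  show "1 *s permute_coords \<alpha> x \<in> twisted_torus (\<alpha> \<circ> p \<circ> inv_into UNIV \<alpha>) \<zeta>"
    by (rule fixed_torus_scale_permute [OF dvd p _ x]) simp
  have "bij (\<alpha> \<circ> p \<circ> inv_into UNIV \<alpha>)"
    using p by (simp add: bij_comp bij_imp_bij_inv)
  then show "point_class k p x = point_class k (\<alpha> \<circ> p \<circ> inv_into UNIV \<alpha>) (1 *s permute_coords \<alpha> x)"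
    using point_class_eq_iff [OF k p(1)] p(2) by (metis power_one)
qed

section \<open>Coefficient spaces\<close>

lemma monic_poly_eq_prod_linear:
  fixes q :: "complex poly"
  assumes "finite A" "lead_coeff q = 1" "degree q = card A"
  shows "\<exists>y. q = (\<Prod>a\<in>A. [:- y a, 1:])"
  using assms
proof (induction A arbitrary: q rule: finite_induct)
  case empty
  then show ?case by (auto elim: degree_eq_zeroE)
next
  case (insert a A)
  then have "\<not> constant (poly q)"
    by (simp add: constant_degree)
  then obtain z where "poly q z = 0"
    using fundamental_theorem_of_algebra by blast
  then obtain r where r: "q = [:- z, 1:] * r"
    unfolding poly_eq_0_iff_dvd by blast
  have "r \<noteq> 0" using insert.prems(1) r by auto
  then have "degree q = 1 + degree r"
    unfolding r by (subst degree_mult_eq) auto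
  then have "degree r = card A"
    using insert by simp
  moreover have "lead_coeff r = 1"
    using insert.prems(1) unfolding r lead_coeff_mult by simp
  ultimately obtain y where "r = (\<Prod>a\<in>A. [:- y a, 1:])"
    using insert.IH by blast
  moreover have "(\<Prod>b\<in>A. [:- (y(a := z)) b, 1:]) = (\<Prod>b\<in>A. [:- y b, 1:])"
    by (intro prod.cong) (use insert.hyps in auto)
  ultimately show ?case
    using insert.hyps r by (intro exI[of _ "y(a := z)"]) simp
qed

lemma proots_prod_linear:
  fixes y :: "'a \<Rightarrow> complex"
  assumes "finite A"
  shows "proots (\<Prod>a\<in>A. [:- y a, 1:]) = image_mset y (mset_set A)"
proof -
  have "proots (\<Prod>a\<in>A. [:- y a, 1:]) = (\<Sum>a\<in>A. {#y a#})"
    by (subst proots_prod) auto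
  also have "\<dots> = image_mset y (mset_set A)"
    using assms by (induction A rule: finite_induct) simp_all
  finally show ?thesis .
qed

lemma prod_linear_fibre_card:
  fixes y y' :: "'a \<Rightarrow> complex"
  assumes "finite A" "(\<Prod>a\<in>A. [:- y a, 1:]) = (\<Prod>a\<in>A. [:- y' a, 1:])"
  shows "card {a \<in> A. y a = v} = card {a \<in> A. y' a = v}"
proof -
  have "count (image_mset f (mset_set A)) v = card {a \<in> A. f a = v}" for f :: "'a \<Rightarrow> complex"
    using assms(1) by (simp add: count_image_mset vimage_def Int_def conj_commute)
  then show ?thesis
    using arg_cong [OF assms(2), of proots] unfolding proots_prod_linear [OF assms(1)] by metis
qed

lemma coeff_linear_mult:
  fixes a :: complex
  shows "coeff ([:a, 1:] * q) j = a * coeff q j + (if j = 0 then 0 else coeff q (j - 1))"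
  by (cases j) simp_all

text \<open>Coefficient \<open>j\<close> is homogeneous of degree \<open>card A - j\<close> in the
  roots; the factor \<open>w ^ j\<close> keeps the subtraction out of the exponent.\<close>

lemma coeff_prod_linear_scale:
  fixes y :: "'a \<Rightarrow> complex"
  assumes "finite A"
  shows "coeff (\<Prod>a\<in>A. [:- (w * y a), 1:]) j * w ^ j = w ^ card A * coeff (\<Prod>a\<in>A. [:- y a, 1:]) j"
  using assms
proof (induction A arbitrary: j rule: finite_induct)
  case empty
  then show ?case by (cases j) simp_all
next
  case (insert b A)
  have "coeff (\<Prod>a\<in>insert b A. [:- (w * y a), 1:]) j * w ^ j =
      - (w * y b) * (coeff (\<Prod>a\<in>A. [:- (w * y a), 1:]) j * w ^ j) +
      (if j = 0 then 0 else w * (coeff (\<Prod>a\<in>A. [:- (w * y a), 1:]) (j - 1) * w ^ (j - 1)))"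
    using insert.hyps by (cases j) (simp_all add: coeff_linear_mult algebra_simps del: mult_pCons_left)
  also have "\<dots> = w ^ card (insert b A) * coeff (\<Prod>a\<in>insert b A. [:- y a, 1:]) j"
    unfolding insert.IH using insert.hyps by (simp add: coeff_linear_mult algebra_simps del: mult_pCons_left)
  finally show ?case .
qed

lemma continuous_on_coeff_prod_linear:
  fixes f :: "'a \<Rightarrow> 'b::topological_space \<Rightarrow> complex"
  assumes "finite A" "\<And>a. a \<in> A \<Longrightarrow> continuous_on S (f a)"
  shows "continuous_on S (\<lambda>x. coeff (\<Prod>a\<in>A. [:- f a x, 1:]) j)"
  using assms
proof (induction A arbitrary: j rule: finite_induct)
  case (insert a A)
  then have "continuous_on S (\<lambda>x. - f a x * coeff (\<Prod>a\<in>A. [:- f a x, 1:]) j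
      + (if j = 0 then 0 else coeff (\<Prod>a\<in>A. [:- f a x, 1:]) (j - 1)))"
    by (cases "j = 0") (auto intro!: continuous_intros)
  then show ?case
    using insert.hyps by (simp add: coeff_linear_mult del: mult_pCons_left)
qed simp

lemma degree_prod_linear:
  fixes y :: "'a \<Rightarrow> complex"
  assumes "finite A"
  shows "degree (\<Prod>a\<in>A. [:- y a, 1:]) = card A" "lead_coeff (\<Prod>a\<in>A. [:- y a, 1:]) = 1"
proof -
  show "degree (\<Prod>a\<in>A. [:- y a, 1:]) = card A"
    by (subst degree_prod_eq_sum_degree) simp_all
  show "lead_coeff (\<Prod>a\<in>A. [:- y a, 1:]) = 1"
    by (simp add: lead_coeff_prod)
qed

text \<open>A Cauchy-type bound, from which the properness of the coefficient map will follow: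
  outside the unit disc the leading power equals minus the sum of the lower terms, each of norm at
  most \<open>M\<close> times the next lower power.\<close>

lemma norm_root_le:
  fixes q :: "complex poly"
  assumes "lead_coeff q = 1" "poly q z = 0" "\<And>j. j < degree q \<Longrightarrow> norm (coeff q j) \<le> M" "M \<ge> 0"
  shows "norm z \<le> 1 + real (degree q) * M"
proof (cases "norm z \<le> 1")
  case False
  let ?l = "degree q"
  have "?l \<noteq> 0"
  proof
    assume "?l = 0"
    then obtain a where "q = [:a:]" by (rule degree_eq_zeroE)
    then show False using assms(1,2) by simp
  qed
  have "{..?l} = insert ?l {..<?l}" by auto
  then have "z ^ ?l = - (\<Sum>j<?l. coeff q j * z ^ j)"
    using assms(1,2) by (simp add: poly_altdef add_eq_0_iff)
  then have "norm z ^ ?l \<le> (\<Sum>j<?l. norm (coeff q j) * norm z ^ j)"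
    by (metis (no_types, lifting) norm_minus_cancel norm_mult norm_power norm_sum sum.cong)
  also have "\<dots> \<le> (\<Sum>j<?l. M * norm z ^ (?l - 1))"
    using False assms(3,4) by (intro sum_mono mult_mono power_increasing) auto
  also have "\<dots> = real ?l * M * norm z ^ (?l - 1)"
    by simp
  finally have "norm z * norm z ^ (?l - 1) \<le> real ?l * M * norm z ^ (?l - 1)"
    using \<open>?l \<noteq> 0\<close> by (simp add: power_eq_if)
  moreover have "norm z ^ (?l - 1) > 0"
    using False by (intro zero_less_power) linarith
  ultimately show ?thesis by simp
qed (use assms(4) in \<open>auto intro: add_increasing2\<close>)

text \<open>By \<open>d\<close> and \<open>gen\<close>, \<open>\<zeta>\<close> is a primitive d-th
  root of unity. The condition \<open>d_dvd\<close> holds as soon as the twisted torus has a point: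
  one turn round a cycle multiplies a nonzero coordinate by a power of \<open>\<zeta>\<close> whose
  exponent is the length up to sign.\<close>

locale twisted_data =
  fixes p :: "'n::finite \<Rightarrow> 'n" and \<zeta> :: complex and d k :: nat
  assumes p: "bij p" and d: "d > 0" "\<zeta> ^ d = 1" and gen: "\<And>z. z ^ d = 1 \<Longrightarrow> \<exists>t. z = \<zeta> ^ t"
    and d_dvd: "\<And>i. d dvd cycle_length p i"
    and k: "k > 0" "\<zeta> ^ k = 1" "k dvd CARD('n)"
begin

definition reps_of_length :: "nat \<Rightarrow> 'n set" where
  "reps_of_length m = {c \<in> cycle_reps p. cycle_length p c = m}"

definition lengths :: "nat set" where
  "lengths = cycle_length p ` cycle_reps p"

text \<open>
  The non-leading coefficients of the polynomial of length \<open>m\<close> are as many as the cycles of length \<open>m\<close>, so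
  they can be stored in a vector of the same type as the points of the torus: \<open>slot\<close> tells which
  coefficient is stored at the representative of a cycle, and \<open>top_rep m\<close> holds the constant term.
\<close>

definition slot :: "'n \<Rightarrow> nat" where
  "slot = (SOME r. \<forall>m. bij_betw r (reps_of_length m) {..<card (reps_of_length m)})"

definition top_rep :: "nat \<Rightarrow> 'n" where
  "top_rep m = inv_into (reps_of_length m) slot 0"

definition cycle_poly :: "complex^'n \<Rightarrow> nat \<Rightarrow> complex poly" where
  "cycle_poly x m = (\<Prod>c\<in>reps_of_length m. [:- ((x $ c) ^ d), 1:])"

definition coeffs_map :: "complex^'n \<Rightarrow> complex^'n" where
  "coeffs_map x = (\<chi> i. if i \<in> cycle_reps p then coeff (cycle_poly x (cycle_length p i)) (slot i) else 0)"

definition twist_const :: complex where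
  "twist_const = (\<Prod>c\<in>cycle_reps p. \<Prod>t<cycle_length p c. inverse \<zeta> ^ t)"

text \<open>The value that the equation with product of coordinates 1 forces on the constant terms.
  \<open>twist_const\<close> collects the powers of \<open>\<zeta>\<close> met along the cycles; the
  signs arise because the constant term is the product of the negated roots.\<close>

definition level_const :: complex where
  "level_const = (\<Prod>m\<in>lengths. ((- 1) ^ card (reps_of_length m)) ^ (m div d)) / twist_const"

definition coeff_space :: "(complex^'n) set" where
  "coeff_space = {b. (\<forall>i. i \<notin> cycle_reps p \<longrightarrow> b $ i = 0) \<and> (\<Prod>m\<in>lengths. (b $ top_rep m) ^ (m div d)) = level_const}"

lemma \<zeta>_nonzero: "\<zeta> \<noteq> 0"
  using d by (auto simp: power_0_left)

lemma norm_\<zeta>: "norm \<zeta> = 1"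
  using d by (metis norm_one norm_power norm_ge_zero power_eq_1_iff not_gr_zero)

lemma finite_reps_of_length [simp]: "finite (reps_of_length m)" and finite_lengths [simp]: "finite lengths"
  by (simp_all add: lengths_def)

lemma slot: "bij_betw slot (reps_of_length m) {..<card (reps_of_length m)}"
proof -
  have "\<exists>h. bij_betw h (reps_of_length m) {..<card (reps_of_length m)}" for m
    by (intro finite_same_card_bij) simp_all
  then obtain h where h: "\<And>m. bij_betw (h m) (reps_of_length m) {..<card (reps_of_length m)}"
    by metis
  have "bij_betw (\<lambda>c. h (cycle_length p c) c) (reps_of_length m) {..<card (reps_of_length m)}" for m
    using bij_betw_cong [of "reps_of_length m" "\<lambda>c. h (cycle_length p c) c" "h m"] h by (simp add: reps_of_length_def)
  then have "\<exists>r. \<forall>m. bij_betw r (reps_of_length m) {..<card (reps_of_length m)}"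
    by blast
  then have "\<forall>m. bij_betw slot (reps_of_length m) {..<card (reps_of_length m)}"
    unfolding slot_def by (rule someI_ex)
  then show ?thesis by blast
qed

lemma mem_reps_of_length: "c \<in> cycle_reps p \<Longrightarrow> c \<in> reps_of_length (cycle_length p c)"
  by (simp add: reps_of_length_def)

lemma reps_of_lengthD: "c \<in> reps_of_length m \<Longrightarrow> c \<in> cycle_reps p \<and> cycle_length p c = m"
  by (simp add: reps_of_length_def)

lemma card_reps_pos: "m \<in> lengths \<Longrightarrow> card (reps_of_length m) > 0"
  by (auto simp: lengths_def card_gt_0_iff reps_of_length_def)

lemma slot_less: "c \<in> cycle_reps p \<Longrightarrow> slot c < card (reps_of_length (cycle_length p c))"
  using bij_betw_apply [OF slot mem_reps_of_length] by simp

lemma top_rep: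
  assumes "m \<in> lengths"
  shows "top_rep m \<in> reps_of_length m" "slot (top_rep m) = 0"
proof -
  have "0 \<in> slot ` reps_of_length m"
    using card_reps_pos [OF assms] bij_betw_imp_surj_on [OF slot] by simp
  then show "top_rep m \<in> reps_of_length m" "slot (top_rep m) = 0"
    unfolding top_rep_def by (rule inv_into_into, rule f_inv_into_f)
qed

lemma length_top_rep: "m \<in> lengths \<Longrightarrow> cycle_length p (top_rep m) = m"
  and top_rep_in: "m \<in> lengths \<Longrightarrow> top_rep m \<in> cycle_reps p"
  using top_rep reps_of_lengthD by blast+

lemma eq_top_rep: "c \<in> cycle_reps p \<Longrightarrow> slot c = 0 \<Longrightarrow> c = top_rep (cycle_length p c)"
  using top_rep [of "cycle_length p c"] mem_reps_of_length
    inj_onD [OF bij_betw_imp_inj_on [OF slot], of c "top_rep (cycle_length p c)" "cycle_length p c"]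
  by (simp add: lengths_def)

lemma length_in_lengths: "c \<in> cycle_reps p \<Longrightarrow> cycle_length p c \<in> lengths"
  by (simp add: lengths_def)

lemma lengths_pos: "m \<in> lengths \<Longrightarrow> m > 0 \<and> d dvd m \<and> m div d > 0"
  using d_dvd d cycle_length(1) [OF p] by (auto simp: lengths_def dvd_imp_le div_greater_zero_iff)

lemma twisted_iff: "permute_coords p x = \<zeta> *s x \<longleftrightarrow> (\<forall>i t. x $ ((p ^^ t) i) = inverse \<zeta> ^ t * x $ i)"
proof
  assume "permute_coords p x = \<zeta> *s x"
  then have 1: "x $ inv_into UNIV p (p i) = \<zeta> * x $ (p i)" for i
    by (simp add: permute_coords_def vec_eq_iff)
  have step: "x $ (p i) = inverse \<zeta> * x $ i" for i
  proof -
    have "inv_into UNIV p (p i) = i"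
      using p by (simp add: bij_is_inj)
    then have "x $ i = \<zeta> * x $ (p i)"
      using 1 [of i] by argo
    then show ?thesis
      by (metis \<zeta>_nonzero left_inverse mult.assoc mult_1)
  qed
  have "x $ ((p ^^ t) i) = inverse \<zeta> ^ t * x $ i" for i t
    by (induction t) (simp_all add: step)
  then show "\<forall>i t. x $ ((p ^^ t) i) = inverse \<zeta> ^ t * x $ i" by blast
next
  assume *: "\<forall>i t. x $ ((p ^^ t) i) = inverse \<zeta> ^ t * x $ i"
  have "x $ inv_into UNIV p i = \<zeta> * x $ i" for i
  proof -
    have "x $ ((p ^^ 1) (inv_into UNIV p i)) = inverse \<zeta> ^ 1 * x $ inv_into UNIV p i"
      using * by blast
    then have "x $ i = inverse \<zeta> * x $ inv_into UNIV p i"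
      using p by (simp add: bij_is_surj surj_f_inv_f)
    then show ?thesis
      by (metis \<zeta>_nonzero right_inverse mult.assoc mult_1)
  qed
  then show "permute_coords p x = \<zeta> *s x"
    by (simp add: permute_coords_def vec_eq_iff)
qed

lemma twisted_torus_coords:
  "x \<in> twisted_torus p \<zeta> \<Longrightarrow> x $ ((p ^^ t) i) = inverse \<zeta> ^ t * x $ i"
  using twisted_iff by (simp add: twisted_torus_def)

lemma twisted_torus_nonzero: "x \<in> twisted_torus p \<zeta> \<Longrightarrow> x $ i \<noteq> 0"
  using unit_torus_nonzero [of x i] by (simp add: twisted_torus_def)

lemma twist_const_nonzero: "twist_const \<noteq> 0"
  using \<zeta>_nonzero by (simp add: twist_const_def)

lemma level_const_nonzero: "level_const \<noteq> 0"
  using twist_const_nonzero by (simp add: level_const_def)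

lemma prod_by_lengths: "(\<Prod>c\<in>cycle_reps p. f c) = (\<Prod>m\<in>lengths. \<Prod>c\<in>reps_of_length m. f c)"
  unfolding lengths_def reps_of_length_def by (rule prod.image_gen) simp

lemma prod_twisted_coords:
  assumes "permute_coords p x = \<zeta> *s x"
  shows "(\<Prod>i\<in>UNIV. x $ i) = twist_const * (\<Prod>m\<in>lengths. (\<Prod>c\<in>reps_of_length m. (x $ c) ^ d) ^ (m div d))"
proof -
  have "(\<Prod>t<cycle_length p c. x $ ((p ^^ t) c)) = (\<Prod>t<cycle_length p c. inverse \<zeta> ^ t) * ((x $ c) ^ d) ^ (cycle_length p c div d)" for c
    using assms d_dvd [of c] by (simp add: twisted_iff prod.distrib flip: power_mult)
  then have "(\<Prod>i\<in>UNIV. x $ i) = twist_const * (\<Prod>c\<in>cycle_reps p. ((x $ c) ^ d) ^ (cycle_length p c div d))"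
    by (simp add: prod_over_cycles [OF p] prod.distrib twist_const_def)
  also have "(\<Prod>c\<in>cycle_reps p. ((x $ c) ^ d) ^ (cycle_length p c div d)) =
      (\<Prod>m\<in>lengths. (\<Prod>c\<in>reps_of_length m. (x $ c) ^ d) ^ (m div d))"
    unfolding prod_by_lengths prod_power_distrib
    by (intro prod.cong refl) (simp add: reps_of_length_def)
  finally show ?thesis .
qed

lemma coeffs_map_top:
  assumes "m \<in> lengths"
  shows "coeffs_map x $ top_rep m = (- 1) ^ card (reps_of_length m) * (\<Prod>c\<in>reps_of_length m. (x $ c) ^ d)"
proof -
  have "coeffs_map x $ top_rep m = coeff (cycle_poly x m) 0"
    using assms by (simp add: coeffs_map_def top_rep_in length_top_rep top_rep)
  also have "\<dots> = (\<Prod>c\<in>reps_of_length m. - 1 * (x $ c) ^ d)"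
    by (simp add: cycle_poly_def poly_prod flip: poly_0_coeff_0)
  also have "\<dots> = (- 1) ^ card (reps_of_length m) * (\<Prod>c\<in>reps_of_length m. (x $ c) ^ d)"
    unfolding prod.distrib by simp
  finally show ?thesis .
qed

lemma coeffs_map_in_iff:
  assumes "permute_coords p x = \<zeta> *s x"
  shows "coeffs_map x \<in> coeff_space \<longleftrightarrow> x \<in> twisted_torus p \<zeta>"
proof -
  let ?s = "\<Prod>m\<in>lengths. ((- 1) ^ card (reps_of_length m)) ^ (m div d) :: complex"
  let ?X = "\<Prod>m\<in>lengths. (\<Prod>c\<in>reps_of_length m. (x $ c) ^ d) ^ (m div d)"
  have s0: "?s \<noteq> 0" by simp
  have cancel: "s * X = s / t \<longleftrightarrow> t * X = 1" if "s \<noteq> 0" "t \<noteq> 0" for s t X :: complex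
    using that by (auto simp: field_simps)
  have "coeffs_map x \<in> coeff_space \<longleftrightarrow> (\<Prod>m\<in>lengths. (coeffs_map x $ top_rep m) ^ (m div d)) = level_const"
    by (simp add: coeff_space_def) (simp add: coeffs_map_def)
  also have "(\<Prod>m\<in>lengths. (coeffs_map x $ top_rep m) ^ (m div d)) = ?s * ?X"
    unfolding prod.distrib [symmetric]
    by (intro prod.cong refl) (simp add: coeffs_map_top power_mult_distrib)
  also have "?s * ?X = level_const \<longleftrightarrow> twist_const * ?X = 1"
    unfolding level_const_def by (rule cancel [OF s0 twist_const_nonzero])
  also have "\<dots> \<longleftrightarrow> x \<in> twisted_torus p \<zeta>"
    using assms by (simp add: twisted_torus_def unit_torus_def prod_twisted_coords)
  finally show ?thesis .
qed

lemma continuous_coeffs_map: "continuous_on S coeffs_map"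
  unfolding coeffs_map_def
proof (rule continuous_on_vec_lambda)
  fix i
  show "continuous_on S (\<lambda>x. if i \<in> cycle_reps p then coeff (cycle_poly x (cycle_length p i)) (slot i) else 0)"
    unfolding cycle_poly_def
    by (cases "i \<in> cycle_reps p") (auto intro!: continuous_on_coeff_prod_linear continuous_intros)
qed

text \<open>At a representative the d-th power of the coordinate is a root of a monic polynomial
  with bounded coefficients; along a cycle the modulus is constant because \<open>\<zeta>\<close>
  has norm 1.\<close>

lemma norm_coord_le:
  fixes x :: "complex^'n"
  assumes x: "x \<in> twisted_torus p \<zeta>" and M: "norm (coeffs_map x) \<le> M"
  shows "norm (x $ i) \<le> 1 + real CARD('n) * M"
proof -
  let ?c = "cycle_rep p i" and ?l = "cycle_length p (cycle_rep p i)"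
  have M0: "M \<ge> 0" using M norm_ge_zero order_trans by blast
  have c: "?c \<in> cycle_reps p" by (simp add: cycle_reps_def)
  obtain t where t: "i = (p ^^ t) ?c" using cycle_pos_exists [OF p] by blast
  have "x $ i = inverse \<zeta> ^ t * x $ ?c"
    by (subst t) (rule twisted_torus_coords [OF x])
  then have eq: "norm (x $ i) = norm (x $ ?c)"
    by (simp add: norm_mult norm_power norm_inverse norm_\<zeta>)
  let ?q = "cycle_poly x ?l"
  have q: "degree ?q = card (reps_of_length ?l)" "lead_coeff ?q = 1"
    unfolding cycle_poly_def by (rule degree_prod_linear, simp)+
  have "norm (coeff ?q j) \<le> M" if "j < degree ?q" for j
  proof -
    have "j \<in> slot ` reps_of_length ?l"
      using that bij_betw_imp_surj_on [OF slot] q by simp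
    then obtain c' where c': "c' \<in> reps_of_length ?l" "slot c' = j" by blast
    then have "coeff ?q j = coeffs_map x $ c'"
      using reps_of_lengthD [OF c'(1)] by (simp add: coeffs_map_def)
    then show ?thesis
      using M Finite_Cartesian_Product.norm_nth_le [of "coeffs_map x" c'] by simp
  qed
  moreover have "poly ?q ((x $ ?c) ^ d) = 0"
    using mem_reps_of_length [OF c] by (auto simp: cycle_poly_def poly_prod)
  ultimately have "norm ((x $ ?c) ^ d) \<le> 1 + real (degree ?q) * M"
    by (intro norm_root_le) (use q M0 in auto)
  also have "\<dots> \<le> 1 + real CARD('n) * M"
    using q(1) M0 card_mono [of UNIV "reps_of_length ?l"] by (simp add: mult_right_mono)
  finally have le: "norm (x $ ?c) ^ d \<le> 1 + real CARD('n) * M"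
    by (simp add: norm_power)
  \<comment> \<open>To pass from the d-th power to the coordinate: norms up to 1 satisfy the bound
    anyway, and larger ones are at most their d-th power.\<close>
  show ?thesis
  proof (cases "norm (x $ ?c) \<le> 1")
    case True
    then show ?thesis unfolding eq using M0 by (simp add: add_increasing2)
  next
    case False
    then have "norm (x $ ?c) \<le> norm (x $ ?c) ^ d"
      using d(1) by (intro self_le_power) auto
    then show ?thesis unfolding eq using le by linarith
  qed
qed

text \<open>Properness of the coefficient map, by which it becomes a closed map.\<close>

lemma compact_coeffs_map_preimage:
  assumes "compact U"
  shows "compact (twisted_torus p \<zeta> \<inter> coeffs_map -` U)"
proof -
  obtain M where M: "\<And>u. u \<in> U \<Longrightarrow> norm u \<le> M"
    using compact_imp_bounded [OF assms] bounded_iff by blast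
  have "closed (twisted_torus p \<zeta> \<inter> coeffs_map -` U)"
    by (rule continuous_closed_preimage [OF continuous_coeffs_map closed_twisted_torus compact_imp_closed [OF assms]])
  moreover have "bounded (twisted_torus p \<zeta> \<inter> coeffs_map -` U)"
    unfolding bounded_iff
  proof (intro exI ballI)
    fix x assume x: "x \<in> twisted_torus p \<zeta> \<inter> coeffs_map -` U"
    have "norm x \<le> (\<Sum>i\<in>UNIV. norm (x $ i))"
      by (simp add: norm_vec_def L2_set_le_sum)
    also have "\<dots> \<le> (\<Sum>i\<in>(UNIV :: 'n set). 1 + real CARD('n) * M)"
      by (intro sum_mono norm_coord_le) (use x M in auto)
    finally show "norm x \<le> (\<Sum>i\<in>(UNIV :: 'n set). 1 + real CARD('n) * M)" .
  qed
  ultimately show ?thesis by (simp add: compact_eq_bounded_closed)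
qed

lemma coeffs_map_surj:
  assumes b: "b \<in> coeff_space"
  shows "\<exists>x\<in>twisted_torus p \<zeta>. coeffs_map x = b"
proof -
  \<comment> \<open>The intended \<open>cycle_poly x m\<close>. Its roots have to be the d-th powers
    of the coordinates at the representatives, so a d-th root of each is extracted next.\<close>
  define q where "q m = monom 1 (card (reps_of_length m)) + (\<Sum>c\<in>reps_of_length m. monom (b $ c) (slot c))" for m
  have coeff_ge: "coeff (\<Sum>c\<in>reps_of_length m. monom (b $ c) (slot c)) j = 0" if "j \<ge> card (reps_of_length m)" for m j
  proof -
    have "slot c < card (reps_of_length m)" if "c \<in> reps_of_length m" for c
      using bij_betw_apply [OF slot that] by simp
    then show ?thesis
      using that by (force simp: coeff_sum intro!: sum.neutral)
  qed
  have q: "coeff (q m) (card (reps_of_length m)) = 1" "degree (q m) = card (reps_of_length m)" for m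
  proof -
    show 1: "coeff (q m) (card (reps_of_length m)) = 1"
      by (simp add: q_def coeff_ge)
    show "degree (q m) = card (reps_of_length m)"
    proof (rule antisym)
      show "degree (q m) \<le> card (reps_of_length m)"
        by (rule degree_le) (simp add: q_def coeff_ge)
      show "card (reps_of_length m) \<le> degree (q m)"
        by (rule le_degree) (simp add: 1)
    qed
  qed
  have "\<exists>y. q m = (\<Prod>c\<in>reps_of_length m. [:- y c, 1:])" for m
    by (rule monic_poly_eq_prod_linear) (simp_all add: q)
  then obtain y where y: "\<And>m. q m = (\<Prod>c\<in>reps_of_length m. [:- y m c, 1:])" by metis
  have "\<exists>r. y (cycle_length p c) c = r ^ d" for c
    using exists_complex_root [of d "y (cycle_length p c) c"] d(1) by auto
  then obtain r where r: "\<And>c. y (cycle_length p c) c = r c ^ d" by metis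
  obtain pos where pos: "\<And>x. x = (p ^^ pos x) (cycle_rep p x)"
    using cycle_pos_exists [OF p] by metis
  \<comment> \<open>The value at the representative is propagated along the cycle by the twist. The
    arbitrary choice of \<open>pos\<close> does no harm, because the power of \<open>\<zeta>\<close>
    belonging to a full turn is 1.\<close>
  define x where "x = (\<chi> i. inverse \<zeta> ^ pos i * r (cycle_rep p i))"
  have \<zeta>_mod: "inverse \<zeta> ^ s = inverse \<zeta> ^ t" if "s mod cycle_length p i = t mod cycle_length p i" for s t i
  proof -
    have "inverse \<zeta> ^ cycle_length p i = 1"
      using d_dvd [of i] d(2) by (metis dvdE power_inverse inverse_1 power_mult power_one)
    then have "inverse \<zeta> ^ s = inverse \<zeta> ^ (s mod cycle_length p i)" for s
      by (metis mod_mult_div_eq mult.right_neutral power_add power_mult power_one)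
    then show ?thesis using that by metis
  qed
  have x: "x $ ((p ^^ t) i) = inverse \<zeta> ^ t * x $ i" for i t
  proof -
    have "(p ^^ pos ((p ^^ t) i)) (cycle_rep p i) = (p ^^ t) i"
      using pos [of "(p ^^ t) i"] by (simp add: cycle_rep_funpow [OF p])
    also have "\<dots> = (p ^^ (t + pos i)) (cycle_rep p i)"
      using pos [of i] by (simp add: funpow_add)
    finally have "inverse \<zeta> ^ pos ((p ^^ t) i) = inverse \<zeta> ^ (t + pos i)"
      unfolding funpow_eq_iff [OF p] by (rule \<zeta>_mod)
    then show ?thesis
      by (simp add: x_def cycle_rep_funpow [OF p] power_add mult.assoc)
  qed
  have xc: "x $ c ^ d = y (cycle_length p c) c" if "c \<in> cycle_reps p" for c
  proof -
    have "(inverse \<zeta> ^ pos c) ^ d = 1"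
      using d(2) by (metis mult.commute power_inverse inverse_1 power_mult power_one)
    then show ?thesis
      using that by (simp add: x_def cycle_rep_idem [OF p] power_mult_distrib r)
  qed
  have poly: "cycle_poly x m = q m" for m
    unfolding cycle_poly_def y by (intro prod.cong refl) (use xc reps_of_lengthD in auto)
  have "coeffs_map x $ i = b $ i" for i
  proof (cases "i \<in> cycle_reps p")
    case True
    let ?m = "cycle_length p i"
    have "(\<Sum>c\<in>reps_of_length ?m. coeff (monom (b $ c) (slot c)) (slot i)) =
        (\<Sum>c\<in>reps_of_length ?m. if c = i then b $ c else 0)"
      using inj_on_eq_iff [OF bij_betw_imp_inj_on [OF slot]] mem_reps_of_length [OF True]
      by (intro sum.cong refl) auto
    also have "\<dots> = b $ i"
      using mem_reps_of_length [OF True] by simp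
    finally show ?thesis
      using True slot_less [OF True] by (simp add: coeffs_map_def poly q_def coeff_sum)
  next
    case False
    then show ?thesis using b by (simp add: coeffs_map_def coeff_space_def)
  qed
  then have eq: "coeffs_map x = b" by (simp add: vec_eq_iff)
  have "permute_coords p x = \<zeta> *s x"
    using x twisted_iff by blast
  then have "x \<in> twisted_torus p \<zeta>"
    using coeffs_map_in_iff b eq by blast
  then show ?thesis using eq by blast
qed

lemma quotient_map_coeffs_map:
  "quotient_map (top_of_set (twisted_torus p \<zeta>)) (top_of_set coeff_space) coeffs_map"
proof (rule continuous_closed_imp_quotient_map)
  have im: "coeffs_map ` twisted_torus p \<zeta> = coeff_space"
    using coeffs_map_surj coeffs_map_in_iff by (fastforce simp: twisted_torus_def)
  then show "coeffs_map ` topspace (top_of_set (twisted_torus p \<zeta>)) = topspace (top_of_set coeff_space)"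
    by simp
  show "continuous_map (top_of_set (twisted_torus p \<zeta>)) (top_of_set coeff_space) coeffs_map"
    using im by (auto simp: continuous_coeffs_map)
  show "closed_map (top_of_set (twisted_torus p \<zeta>)) (top_of_set coeff_space) coeffs_map"
    unfolding closed_map_def
    by (intro allI impI proper_map) (use im compact_coeffs_map_preimage in auto)
qed

end

section \<open>Orbits of the centraliser and of C_k in terms of coefficients\<close>

context twisted_data
begin

text \<open>Scaling the vector by \<open>\<eta>\<close> scales all roots by
  \<open>\<eta> ^ d\<close>, so by homogeneity coefficient j of a polynomial of degree l picks up
  the power of \<open>\<eta>\<close> with exponent d (l - j).\<close>

definition weight :: "'n \<Rightarrow> nat" where
  "weight i = d * (card (reps_of_length (cycle_length p i)) - slot i)"

lemma coeffs_map_scale: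
  assumes i: "i \<in> cycle_reps p" and \<eta>: "\<eta> ^ k = 1"
  shows "coeffs_map (\<eta> *s x) $ i = \<eta> ^ weight i * coeffs_map x $ i"
proof -
  let ?A = "reps_of_length (cycle_length p i)" and ?w = "\<eta> ^ d"
  have w0: "?w \<noteq> 0" using \<eta> k(1) by (auto simp: power_0_left)
  have "cycle_poly (\<eta> *s x) (cycle_length p i) = (\<Prod>c\<in>?A. [:- (?w * (x $ c) ^ d), 1:])"
    by (simp add: cycle_poly_def power_mult_distrib)
  then have "coeff (cycle_poly (\<eta> *s x) (cycle_length p i)) (slot i) * ?w ^ slot i =
      ?w ^ card ?A * coeff (cycle_poly x (cycle_length p i)) (slot i)"
    using coeff_prod_linear_scale [of ?A ?w "\<lambda>c. (x $ c) ^ d" "slot i"] by (simp add: cycle_poly_def)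
  also have "?w ^ card ?A = ?w ^ (card ?A - slot i) * ?w ^ slot i"
    using slot_less [OF i] by (simp flip: power_add)
  finally have "coeff (cycle_poly (\<eta> *s x) (cycle_length p i)) (slot i) * ?w ^ slot i =
      (?w ^ (card ?A - slot i) * coeff (cycle_poly x (cycle_length p i)) (slot i)) * ?w ^ slot i"
    by (simp only: mult_ac)
  moreover have "?w ^ slot i \<noteq> 0"
    using w0 by simp
  ultimately have "coeff (cycle_poly (\<eta> *s x) (cycle_length p i)) (slot i) =
      ?w ^ (card ?A - slot i) * coeff (cycle_poly x (cycle_length p i)) (slot i)"
    using mult_right_cancel by blast
  then show ?thesis
    using i by (simp add: coeffs_map_def weight_def power_mult)
qed

lemma commute_funpow:
  assumes "\<beta> \<circ> p = p \<circ> \<beta>"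
  shows "\<beta> ((p ^^ t) x) = (p ^^ t) (\<beta> x)"
  using assms by (induction t) (simp_all add: fun_eq_iff)

lemma commute_inv:
  assumes "bij \<alpha>" "\<alpha> \<circ> p = p \<circ> \<alpha>"
  shows "inv_into UNIV \<alpha> \<circ> p = p \<circ> inv_into UNIV \<alpha>"
proof
  fix x
  have "\<alpha> (p (inv_into UNIV \<alpha> x)) = p x"
    using fun_cong [OF assms(2), of "inv_into UNIV \<alpha> x"] bij_is_surj [OF assms(1)] by (simp add: surj_f_inv_f)
  then show "(inv_into UNIV \<alpha> \<circ> p) x = (p \<circ> inv_into UNIV \<alpha>) x"
    using assms(1) by (metis bij_inv_eq_iff o_apply)
qed

lemma twisted_coord_power:
  assumes x: "x \<in> twisted_torus p \<zeta>"
  shows "(x $ i) ^ d = (x $ cycle_rep p i) ^ d"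
proof -
  obtain t where t: "i = (p ^^ t) (cycle_rep p i)" using cycle_pos_exists [OF p] by blast
  have "x $ i = inverse \<zeta> ^ t * x $ cycle_rep p i"
    by (subst t) (rule twisted_torus_coords [OF x])
  moreover have "(inverse \<zeta> ^ t) ^ d = 1"
    using d(2) by (metis mult.commute power_inverse inverse_1 power_mult power_one)
  ultimately show ?thesis by (simp add: power_mult_distrib)
qed

text \<open>\<open>\<alpha>\<close> permutes the cycles of length \<open>m\<close> but may carry a
  representative to another point of the target cycle. This does not change the roots, because d-th
  powers of coordinates are constant along cycles.\<close>

lemma cycle_poly_permute:
  assumes \<alpha>: "bij \<alpha>" "\<alpha> \<circ> p = p \<circ> \<alpha>" and x: "x \<in> twisted_torus p \<zeta>"
  shows "cycle_poly (permute_coords \<alpha> x) m = cycle_poly x m"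
proof -
  define \<beta> where "\<beta> = inv_into UNIV \<alpha>"
  have \<beta>: "bij \<beta>" "\<beta> \<circ> p = p \<circ> \<beta>"
    unfolding \<beta>_def using commute_inv [OF \<alpha>] \<alpha>(1) by (simp_all add: bij_imp_bij_inv)
  define h where "h c = cycle_rep p (\<beta> c)" for c
  have len: "cycle_length p (\<beta> c) = cycle_length p c" for c
    unfolding cycle_length_def commute_funpow [OF \<beta>(2), symmetric] using \<beta>(1) by (simp add: bij_is_inj inj_eq)
  have inj: "inj_on h (reps_of_length m)"
  proof (rule inj_onI)
    fix c c' assume c: "c \<in> reps_of_length m" "c' \<in> reps_of_length m" "h c = h c'"
    then have "\<beta> c \<in> cycle_of p (\<beta> c')"
      using cycle_rep_eq_iff [OF p] by (simp add: h_def)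
    then obtain t where "\<beta> c = \<beta> ((p ^^ t) c')"
      by (auto simp: cycle_of_def commute_funpow [OF \<beta>(2)])
    then have "c = (p ^^ t) c'"
      using \<beta>(1) by (simp add: bij_is_inj inj_eq)
    then show "c = c'"
      using c reps_of_lengthD cycle_rep_idem [OF p] cycle_rep_funpow [OF p] by metis
  qed
  moreover have "h ` reps_of_length m \<subseteq> reps_of_length m"
    by (auto simp: h_def reps_of_length_def cycle_reps_def cycle_length_rep [OF p] len)
  ultimately have "bij_betw h (reps_of_length m) (reps_of_length m)"
    by (simp add: bij_betw_def endo_inj_surj)
  then have "cycle_poly x m = (\<Prod>c\<in>reps_of_length m. [:- ((x $ h c) ^ d), 1:])"
    unfolding cycle_poly_def by (rule prod.reindex_bij_betw [symmetric])
  also have "\<dots> = cycle_poly (permute_coords \<alpha> x) m"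
    unfolding cycle_poly_def permute_coords_def h_def twisted_coord_power [OF x, symmetric] by (simp add: \<beta>_def)
  finally show ?thesis ..
qed

lemma coeffs_map_permute:
  assumes "bij \<alpha>" "\<alpha> \<circ> p = p \<circ> \<alpha>" "x \<in> twisted_torus p \<zeta>"
  shows "coeffs_map (permute_coords \<alpha> x) = coeffs_map x"
  by (simp add: coeffs_map_def cycle_poly_permute [OF assms] cong: if_cong)

lemma coeffs_map_eq_imp_cycle_poly_eq:
  assumes "coeffs_map x = coeffs_map y"
  shows "cycle_poly x m = cycle_poly y m"
proof (rule poly_eqI)
  fix j
  let ?l = "card (reps_of_length m)"
  have q: "degree (cycle_poly z m) = ?l" "coeff (cycle_poly z m) ?l = 1" for z
    using degree_prod_linear [of "reps_of_length m" "\<lambda>c. (z $ c) ^ d"] by (simp_all add: cycle_poly_def)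
  consider "j < ?l" | "j = ?l" | "j > ?l" by linarith
  then show "coeff (cycle_poly x m) j = coeff (cycle_poly y m) j"
  proof cases
    case 1
    then have "j \<in> slot ` reps_of_length m"
      using bij_betw_imp_surj_on [OF slot] by simp
    then obtain c where c: "c \<in> reps_of_length m" "slot c = j" by blast
    have "coeff (cycle_poly z m) j = coeffs_map z $ c" for z
      using c reps_of_lengthD [OF c(1)] by (simp add: coeffs_map_def)
    then show ?thesis using assms by simp
  next
    case 2
    then show ?thesis by (simp add: q)
  next
    case 3
    then show ?thesis by (simp add: coeff_eq_0 q)
  qed
qed

text \<open>Equal coefficients give equal roots with multiplicity, so the cycles of each length can
  be matched with agreeing d-th powers. Matched coordinates then differ by a d-th root of unity; by
  \<open>gen\<close> it is a power of \<open>\<zeta>\<close>, and rotating the cycle absorbs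
  it.\<close>

lemma coeffs_map_eq_imp_permute:
  assumes x: "x \<in> twisted_torus p \<zeta>" and y: "y \<in> twisted_torus p \<zeta>" and eq: "coeffs_map x = coeffs_map y"
  shows "\<exists>\<alpha>. bij \<alpha> \<and> \<alpha> \<circ> p = p \<circ> \<alpha> \<and> y = permute_coords \<alpha> x"
proof -
  have "card {c \<in> cycle_reps p. (cycle_length p c, (y $ c) ^ d) = v} = card {c \<in> cycle_reps p. (cycle_length p c, (x $ c) ^ d) = v}" for v
  proof -
    have "{c \<in> cycle_reps p. (cycle_length p c, (z $ c) ^ d) = v} = {c \<in> reps_of_length (fst v). (z $ c) ^ d = snd v}" for z :: "complex^'n"
      by (auto simp: reps_of_length_def)
    moreover have "card {c \<in> reps_of_length (fst v). (y $ c) ^ d = snd v} = card {c \<in> reps_of_length (fst v). (x $ c) ^ d = snd v}"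
      using coeffs_map_eq_imp_cycle_poly_eq [OF eq, of "fst v"] unfolding cycle_poly_def
      by (intro prod_linear_fibre_card) simp_all
    ultimately show ?thesis by simp
  qed
  then obtain \<sigma> where \<sigma>: "bij_betw \<sigma> (cycle_reps p) (cycle_reps p)"
    and \<sigma>': "\<forall>c\<in>cycle_reps p. (cycle_length p (\<sigma> c), (x $ \<sigma> c) ^ d) = (cycle_length p c, (y $ c) ^ d)"
    using bij_betw_fibres [of "cycle_reps p" "cycle_reps p" "\<lambda>c. (cycle_length p c, (y $ c) ^ d)"
        "\<lambda>c. (cycle_length p c, (x $ c) ^ d)"] by auto
  have "\<exists>s. y $ c = inverse \<zeta> ^ s * x $ \<sigma> c" if c: "c \<in> cycle_reps p" for c
  proof -
    have "(x $ \<sigma> c / y $ c) ^ d = 1"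
      using \<sigma>' c twisted_torus_nonzero [OF y] by (simp add: power_divide)
    then obtain s where "x $ \<sigma> c / y $ c = \<zeta> ^ s" using gen by blast
    then have "y $ c = inverse \<zeta> ^ s * x $ \<sigma> c"
      using \<zeta>_nonzero twisted_torus_nonzero [OF y, of c] by (simp add: field_simps power_inverse)
    then show ?thesis ..
  qed
  then obtain s where s: "\<And>c. c \<in> cycle_reps p \<Longrightarrow> y $ c = inverse \<zeta> ^ s c * x $ \<sigma> c" by metis
  obtain \<beta> where \<beta>: "bij \<beta>" "\<beta> \<circ> p = p \<circ> \<beta>" "\<forall>c\<in>cycle_reps p. \<beta> c = (p ^^ s c) (\<sigma> c)"
    using conjugating_bijection_exists [OF p p \<sigma>, of s] \<sigma>' by auto
  have "y $ i = x $ \<beta> i" for i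
  proof -
    obtain t where t: "i = (p ^^ t) (cycle_rep p i)" using cycle_pos_exists [OF p] by blast
    have c: "cycle_rep p i \<in> cycle_reps p" by (simp add: cycle_reps_def)
    have "y $ i = inverse \<zeta> ^ t * y $ cycle_rep p i"
      by (subst t) (rule twisted_torus_coords [OF y])
    also have "y $ cycle_rep p i = x $ \<beta> (cycle_rep p i)"
      using s [OF c] \<beta>(3) c by (simp add: twisted_torus_coords [OF x])
    also have "inverse \<zeta> ^ t * x $ \<beta> (cycle_rep p i) = x $ \<beta> ((p ^^ t) (cycle_rep p i))"
      by (simp add: commute_funpow [OF \<beta>(2)] twisted_torus_coords [OF x])
    finally show ?thesis using t by simp
  qed
  then have "y = permute_coords (inv_into UNIV \<beta>) x"
    using \<beta>(1) by (simp add: permute_coords_def vec_eq_iff inv_inv_eq)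
  then show ?thesis
    using commute_inv [OF \<beta>(1,2)] \<beta>(1) bij_imp_bij_inv by blast
qed

lemma point_class_eq_iff_coeffs:
  assumes x: "x \<in> twisted_torus p \<zeta>" and y: "y \<in> twisted_torus p \<zeta>"
  shows "point_class k p x = point_class k p y \<longleftrightarrow>
    (\<exists>\<eta>. \<eta> ^ k = 1 \<and> (\<forall>i\<in>cycle_reps p. coeffs_map y $ i = \<eta> ^ weight i * coeffs_map x $ i))"
proof
  assume "point_class k p x = point_class k p y"
  then obtain \<alpha> \<eta> where \<alpha>: "bij \<alpha>" "\<eta> ^ k = 1" "p = \<alpha> \<circ> p \<circ> inv_into UNIV \<alpha>" "y = \<eta> *s permute_coords \<alpha> x"
    using point_class_eq_iff [OF k(1) p p] by blast
  have "\<alpha> (p i) = p (\<alpha> i)" for i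
    using fun_cong [OF \<alpha>(3), of "\<alpha> i"] \<alpha>(1) by (simp add: bij_is_inj)
  then have "\<alpha> \<circ> p = p \<circ> \<alpha>" by auto
  then have "coeffs_map (permute_coords \<alpha> x) = coeffs_map x"
    using coeffs_map_permute \<alpha>(1) x by blast
  then show "\<exists>\<eta>. \<eta> ^ k = 1 \<and> (\<forall>i\<in>cycle_reps p. coeffs_map y $ i = \<eta> ^ weight i * coeffs_map x $ i)"
    using coeffs_map_scale [OF _ \<alpha>(2), of _ "permute_coords \<alpha> x"] \<alpha>(2,4) by auto
next
  assume "\<exists>\<eta>. \<eta> ^ k = 1 \<and> (\<forall>i\<in>cycle_reps p. coeffs_map y $ i = \<eta> ^ weight i * coeffs_map x $ i)"
  then obtain \<eta> where \<eta>: "\<eta> ^ k = 1" "\<forall>i\<in>cycle_reps p. coeffs_map y $ i = \<eta> ^ weight i * coeffs_map x $ i"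
    by blast
  have "id \<circ> p \<circ> inv_into UNIV id = p" by simp
  then have "\<eta> *s x \<in> twisted_torus p \<zeta>"
    using fixed_torus_scale_permute [OF k(3) p bij_id \<eta>(1) x] by (simp add: permute_coords_id)
  moreover have "coeffs_map (\<eta> *s x) = coeffs_map y"
  proof -
    have "coeffs_map (\<eta> *s x) $ i = coeffs_map y $ i" for i
    proof (cases "i \<in> cycle_reps p")
      case True
      then show ?thesis using coeffs_map_scale [OF True \<eta>(1)] \<eta>(2) by simp
    next
      case False
      then show ?thesis by (simp add: coeffs_map_def)
    qed
    then show ?thesis by (simp add: vec_eq_iff)
  qed
  ultimately obtain \<alpha> where \<alpha>: "bij \<alpha>" "\<alpha> \<circ> p = p \<circ> \<alpha>" "y = permute_coords \<alpha> (\<eta> *s x)"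
    using coeffs_map_eq_imp_permute y by blast
  have "p = \<alpha> \<circ> p \<circ> inv_into UNIV \<alpha>"
    unfolding \<alpha>(2) using \<alpha>(1) by (simp add: fun_eq_iff bij_is_surj surj_f_inv_f)
  then show "point_class k p x = point_class k p y"
    unfolding point_class_eq_iff [OF k(1) p p]
    using \<alpha>(1,3) \<eta>(1) by (intro exI[of _ \<alpha>] exI[of _ \<eta>]) (simp add: permute_coords_scale)
qed

section \<open>Contraction onto the constant terms\<close>

definition top_space :: "(complex^'n) set" where
  "top_space = {b \<in> coeff_space. \<forall>i\<in>cycle_reps p. slot i \<noteq> 0 \<longrightarrow> b $ i = 0}"

lemma coeff_space_top_nonzero:
  assumes "b \<in> coeff_space" "m \<in> lengths"
  shows "b $ top_rep m \<noteq> 0"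
proof
  assume "b $ top_rep m = 0"
  then have "(\<Prod>m\<in>lengths. (b $ top_rep m) ^ (m div d)) = 0"
    using assms(2) lengths_pos [OF assms(2)] by (intro prod_zero) auto
  moreover have "(\<Prod>m\<in>lengths. (b $ top_rep m) ^ (m div d)) = level_const"
    using assms(1) by (simp add: coeff_space_def)
  ultimately show False
    using level_const_nonzero by metis
qed

lemma homeomorphic_map_top_space:
  "homeomorphic_map (top_of_set top_space) (monomial_level lengths (\<lambda>m. int (m div d)) level_const)
    (\<lambda>b. \<lambda>m\<in>lengths. b $ top_rep m)"
proof (unfold homeomorphic_map_maps, intro exI, unfold homeomorphic_maps_def, intro conjI)
  let ?L = "monomial_level lengths (\<lambda>m. int (m div d)) level_const"
  let ?f = "\<lambda>b::complex^'n. \<lambda>m\<in>lengths. b $ top_rep m"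
  let ?g = "\<lambda>t. \<Sum>m\<in>lengths. axis (top_rep m) (t m) :: complex^'n"
  have top_rep_inj: "top_rep m = top_rep m' \<longleftrightarrow> m = m'" if "m \<in> lengths" "m' \<in> lengths" for m m'
    using length_top_rep that by metis
  have g_top: "?g t $ top_rep m = t m" if "m \<in> lengths" for t m
  proof -
    have "?g t $ top_rep m = (\<Sum>m'\<in>lengths. if m' = m then t m' else 0)"
      using that by (auto simp: axis_def top_rep_inj intro!: sum.cong)
    then show ?thesis using that by simp
  qed
  have g_other: "?g t $ i = 0" if "\<And>m. m \<in> lengths \<Longrightarrow> i \<noteq> top_rep m" for t i
    using that by (auto simp: axis_def intro!: sum.neutral)
  show "continuous_map (top_of_set top_space) ?L ?f"
    unfolding monomial_level_def continuous_map_in_subtopology continuous_map_componentwise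
    by (auto simp: continuous_map_punctured_plane coeff_space_top_nonzero top_space_def coeff_space_def
        intro!: continuous_intros)
  have "continuous_map ?L euclidean (\<lambda>t. axis (top_rep m) (t m) :: complex^'n)" if "m \<in> lengths" for m
  proof -
    have "continuous_map ?L punctured_plane (\<lambda>t. t m)"
      unfolding monomial_level_def
      by (intro continuous_map_from_subtopology continuous_map_product_projection that)
    then have 1: "continuous_map ?L euclidean (\<lambda>t. t m)"
      unfolding punctured_plane_def by (rule continuous_map_into_fulltopology)
    have "continuous_on UNIV (\<lambda>z. axis (top_rep m) z :: complex^'n)"
      unfolding axis_def
    proof (rule continuous_on_vec_lambda)
      show "continuous_on UNIV (\<lambda>z. if i = top_rep m then z else 0)" for i
        by (cases "i = top_rep m") (auto intro!: continuous_intros)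
    qed
    then have 2: "continuous_map euclidean euclidean (\<lambda>z. axis (top_rep m) z :: complex^'n)"
      by simp
    show ?thesis
      using continuous_map_compose [OF 1 2] by (simp add: o_def)
  qed
  then have "continuous_map ?L euclidean ?g"
    by (intro continuous_map_sum) auto
  moreover have "?g t \<in> top_space" if t: "t \<in> topspace ?L" for t
  proof -
    have "?g t $ i = 0" if "i \<notin> cycle_reps p \<or> slot i \<noteq> 0" for i
      using that top_rep_in top_rep(2) by (intro g_other) auto
    moreover have "(\<Prod>m\<in>lengths. (?g t $ top_rep m) ^ (m div d)) = level_const"
      using t by (simp add: g_top topspace_monomial_level del: sum_component)
    ultimately show ?thesis
      by (auto simp: top_space_def coeff_space_def simp del: sum_component)
  qed
  ultimately show "continuous_map ?L (top_of_set top_space) ?g"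
    by (auto simp: continuous_map_in_subtopology)
  show "\<forall>b\<in>topspace (top_of_set top_space). ?g (?f b) = b"
  proof
    fix b assume b: "b \<in> topspace (top_of_set top_space)"
    have "?g (?f b) $ i = b $ i" for i
    proof (cases "i \<in> cycle_reps p \<and> slot i = 0")
      case True
      then have "i = top_rep (cycle_length p i)" "cycle_length p i \<in> lengths"
        using eq_top_rep length_in_lengths by blast+
      then show ?thesis
        using g_top [of "cycle_length p i" "?f b"] by simp
    next
      case False
      then have "b $ i = 0"
        using b by (auto simp: top_space_def coeff_space_def)
      moreover have "?g (?f b) $ i = 0"
        by (rule g_other) (use False top_rep_in top_rep(2) in auto)
      ultimately show ?thesis by simp
    qed
    then show "?g (?f b) = b" by (simp add: vec_eq_iff del: sum_component)
  qed
  show "\<forall>t\<in>topspace ?L. ?f (?g t) = t"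
    by (auto simp: g_top topspace_monomial_level PiE_iff extensional_def fun_eq_iff simp del: sum_component)
qed

lemma sum_by_lengths: "(\<Sum>m\<in>lengths. m * card (reps_of_length m)) = CARD('n)"
proof -
  have "(\<Sum>c\<in>cycle_reps p. cycle_length p c) = (\<Sum>m\<in>lengths. \<Sum>c\<in>reps_of_length m. cycle_length p c)"
    unfolding lengths_def reps_of_length_def by (rule sum.image_gen) simp
  also have "\<dots> = (\<Sum>m\<in>lengths. m * card (reps_of_length m))"
    by (intro sum.cong refl) (simp add: reps_of_length_def)
  finally show ?thesis
    using sum_cycle_lengths [OF p] by simp
qed

lemma Gcd_lengths_div: "Gcd ((\<lambda>m. int (m div d)) ` lengths) = int (Gcd lengths div d)"
proof -
  have "lengths = (*) d ` (\<lambda>m. m div d) ` lengths"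
    using lengths_pos by (force simp: image_image)
  then have "Gcd lengths = d * Gcd ((\<lambda>m. m div d) ` lengths)"
    by (metis Gcd_mult normalize_nat_def id_apply normalize_idem unit_factor_nat_def normalize_mult)
  then have "Gcd ((\<lambda>m. m div d) ` lengths) = Gcd lengths div d"
    using d(1) by simp
  then show ?thesis
    using Gcd_int_eq [of "(\<lambda>m. m div d) ` lengths"] by (simp add: image_image)
qed

lemma lengths_nonempty: "lengths \<noteq> {}"
  by (auto simp: lengths_def cycle_reps_def)

lemma piece_homotopy_equivalent:
  "subtopology (torus_extended_quotient k) (point_class k p ` twisted_torus p \<zeta>) homotopy_equivalent_space
    torus_times_discrete (card lengths - 1) (gcd (Gcd lengths div d) (CARD('n) div k))"
proof -
  let ?E = "subtopology (torus_extended_quotient k) (point_class k p ` twisted_torus p \<zeta>)"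
  let ?B = "top_of_set coeff_space"
  let ?\<alpha> = "\<lambda>m. int (m div d)" and ?w = "\<lambda>m. int (d * card (reps_of_length m))"
  have q: "quotient_map (top_of_set (twisted_torus p \<zeta>)) ?E (point_class k p)"
    by (rule quotient_map_twisted_piece [OF k(1) k(3) p k(2)])
  have lift: "point_class k p x = point_class k p y"
    if "x \<in> twisted_torus p \<zeta>" "y \<in> twisted_torus p \<zeta>" "coeffs_map x = coeffs_map y" for x y
    unfolding point_class_eq_iff_coeffs [OF that(1,2)] using that(3) by (intro exI[of _ 1]) simp
  obtain \<pi> where \<pi>_cont: "continuous_map ?B ?E \<pi>"
    and \<pi>: "\<And>x. x \<in> twisted_torus p \<zeta> \<Longrightarrow> \<pi> (coeffs_map x) = point_class k p x"
    using quotient_map_lift_exists [OF quotient_map_coeffs_map quotient_imp_continuous_map [OF q]] lift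
    by (metis topspace_euclidean_subtopology)
  have "quotient_map (top_of_set (twisted_torus p \<zeta>)) ?E (\<pi> \<circ> coeffs_map)"
    by (rule quotient_map_eq [OF q]) (simp add: \<pi>)
  \<comment> \<open>\<open>\<pi>\<close> is a second factor of a quotient map whose first factor is
    a quotient map, so it is one itself.\<close>
  then have \<pi>_quot: "quotient_map ?B ?E \<pi>"
    using quotient_map_compose_eq [OF quotient_map_coeffs_map] by blast
  have \<pi>_iff: "\<pi> b = \<pi> b' \<longleftrightarrow> (\<exists>\<eta>. \<eta> ^ k = 1 \<and> (\<forall>i\<in>cycle_reps p. b' $ i = \<eta> ^ weight i * b $ i))"
    if b: "b \<in> coeff_space" "b' \<in> coeff_space" for b b'
  proof -
    obtain x y where "x \<in> twisted_torus p \<zeta>" "coeffs_map x = b" "y \<in> twisted_torus p \<zeta>" "coeffs_map y = b'"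
      using coeffs_map_surj b by metis
    then show ?thesis
      using point_class_eq_iff_coeffs \<pi> by metis
  qed
  \<comment> \<open>The d in the weight cancels the d in the exponent, which leaves the sum of all
    cycle lengths. Divided by k it yields the n/k in the number of points.\<close>
  have sum_eq: "(\<Sum>m\<in>lengths. ?\<alpha> m * ?w m) = int CARD('n)"
  proof -
    have "?\<alpha> m * ?w m = int (m * card (reps_of_length m))" if "m \<in> lengths" for m
      using lengths_pos [OF that] by (metis dvd_div_mult_self mult.assoc of_nat_mult)
    then have "(\<Sum>m\<in>lengths. ?\<alpha> m * ?w m) = (\<Sum>m\<in>lengths. int (m * card (reps_of_length m)))"
      by (intro sum.cong refl)
    then show ?thesis
      by (simp only: sum_by_lengths flip: of_nat_sum)
  qed
  have "\<exists>\<theta>. root_quotient k lengths ?\<alpha> ?w level_const (card lengths - 1)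
      (nat (gcd (Gcd (?\<alpha> ` lengths)) ((\<Sum>m\<in>lengths. ?\<alpha> m * ?w m) div int k))) \<theta>"
  proof (rule root_quotient_exists)
    show "\<exists>m\<in>lengths. ?\<alpha> m \<noteq> 0"
      using lengths_nonempty lengths_pos by fastforce
    show "int k dvd (\<Sum>m\<in>lengths. ?\<alpha> m * ?w m)"
      unfolding sum_eq using k(3) by simp
  qed (simp_all add: level_const_nonzero k(1))
  moreover have "nat (gcd (Gcd (?\<alpha> ` lengths)) ((\<Sum>m\<in>lengths. ?\<alpha> m * ?w m) div int k)) =
      gcd (Gcd lengths div d) (CARD('n) div k)"
    unfolding sum_eq Gcd_lengths_div by (simp flip: zdiv_int)
  ultimately obtain \<theta> where \<theta>: "root_quotient k lengths ?\<alpha> ?w level_const (card lengths - 1)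
      (gcd (Gcd lengths div d) (CARD('n) div k)) \<theta>"
    by metis
  let ?h = "\<lambda>b::complex^'n. \<lambda>m\<in>lengths. b $ top_rep m"
  \<comment> \<open>The equation of \<open>coeff_space\<close> involves only the constant terms,
    which \<open>r\<close> does not touch, so \<open>r\<close> stays inside. Each coordinate is
    multiplied by a factor independent of \<open>b\<close>, so an \<open>\<eta>\<close> relating two
    points also relates their images.\<close>
  define r where "r = (\<lambda>(t::real, b::complex^'n). \<chi> i. if i \<in> cycle_reps p \<and> slot i = 0 then b $ i else of_real t * b $ i)"
  have r_nth: "r (t, b) $ i = (if i \<in> cycle_reps p \<and> slot i = 0 then b $ i else of_real t * b $ i)" for t b i
    by (simp add: r_def)
  have r_top: "r (t, b) $ top_rep m = b $ top_rep m" if "m \<in> lengths" for t b m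
    using that by (simp add: r_nth top_rep_in top_rep(2))
  have r_B: "r (t, b) \<in> coeff_space" if "b \<in> coeff_space" for t b
    using that by (simp add: coeff_space_def r_top) (simp add: r_nth)
  have sub: "top_space \<subseteq> coeff_space"
    by (auto simp: top_space_def)
  show ?thesis
  proof (rule quotient_homotopy_equivalent_space [OF \<pi>_quot])
    show "quotient_map (subtopology ?B top_space) (torus_times_discrete (card lengths - 1) (gcd (Gcd lengths div d) (CARD('n) div k))) (\<theta> \<circ> ?h)"
    proof (rule quotient_map_compose)
      show "quotient_map (subtopology ?B top_space) (monomial_level lengths ?\<alpha> level_const) ?h"
        using homeomorphic_map_top_space sub by (simp add: homeomorphic_map_def subtopology_subtopology inf.absorb2)
    qed (use \<theta> in \<open>simp add: root_quotient_def\<close>)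
    show "top_space \<subseteq> topspace ?B" using sub by simp
    show "continuous_map (prod_topology (top_of_set {0..1}) ?B) ?B r"
    proof -
      have "continuous_on ({0..1} \<times> coeff_space) r"
        unfolding r_def case_prod_unfold
      proof (rule continuous_on_vec_lambda)
        show "continuous_on ({0..1} \<times> coeff_space) (\<lambda>x. if i \<in> cycle_reps p \<and> slot i = 0 then snd x $ i else of_real (fst x) * snd x $ i)" for i
          by (cases "i \<in> cycle_reps p \<and> slot i = 0") (auto intro!: continuous_intros)
      qed
      moreover have "prod_topology (top_of_set {0..1::real}) ?B = top_of_set ({0..1} \<times> coeff_space)"
        by (simp flip: subtopology_Times)
      ultimately show ?thesis
        using r_B by auto
    qed
    show "r (0, b) \<in> top_space" if "b \<in> topspace ?B" for b
      using that r_B [of b 0] by (simp add: top_space_def r_nth)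
    show "r (1, b) = b" if "b \<in> topspace ?B" for b
      by (simp add: vec_eq_iff r_nth)
    show "r (0, b) = b" if "b \<in> top_space" for b
    proof -
      have "r (0, b) $ i = b $ i" for i
        using that by (cases "i \<in> cycle_reps p") (auto simp: r_nth top_space_def coeff_space_def)
      then show ?thesis by (simp add: vec_eq_iff)
    qed
    show "\<pi> (r (t, b)) = \<pi> (r (t, b'))" if h: "t \<in> {0..1}" "b \<in> topspace ?B" "b' \<in> topspace ?B" "\<pi> b = \<pi> b'" for t b b'
    proof -
      have B: "b \<in> coeff_space" "b' \<in> coeff_space" using h(2,3) by simp_all
      then obtain \<eta> where \<eta>: "\<eta> ^ k = 1" "\<forall>i\<in>cycle_reps p. b' $ i = \<eta> ^ weight i * b $ i"
        using \<pi>_iff h(4) by blast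
      show ?thesis
        unfolding \<pi>_iff [OF r_B [OF B(1)] r_B [OF B(2)]]
        using \<eta> by (intro exI[of _ \<eta>]) (simp add: r_nth)
    qed
    show "(\<theta> \<circ> ?h) b = (\<theta> \<circ> ?h) b' \<longleftrightarrow> \<pi> b = \<pi> b'" if b: "b \<in> top_space" "b' \<in> top_space" for b b'
    proof -
      have "?h c \<in> topspace (monomial_level lengths ?\<alpha> level_const)" if "c \<in> top_space" for c
        using homeomorphic_imp_surjective_map [OF homeomorphic_map_top_space] that by auto
      then have "(\<theta> \<circ> ?h) b = (\<theta> \<circ> ?h) b' \<longleftrightarrow> (\<exists>\<eta>. \<eta> ^ k = 1 \<and> (\<forall>m\<in>lengths. ?h b' m = \<eta> powi ?w m * ?h b m))"
        using \<theta> b unfolding root_quotient_def by simp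
      \<comment> \<open>On \<open>top_space\<close> the coordinates with nonzero slot vanish, so the
        orbit relation concerns the constant terms only, where slot 0 gives the weight
        \<open>?w\<close>.\<close>
      also have "\<dots> \<longleftrightarrow> (\<exists>\<eta>. \<eta> ^ k = 1 \<and> (\<forall>i\<in>cycle_reps p. b' $ i = \<eta> ^ weight i * b $ i))"
      proof (intro ex_cong1 conj_cong refl)
        fix \<eta> :: complex
        have w: "\<eta> ^ weight (top_rep m) = \<eta> powi ?w m" if "m \<in> lengths" for m
          using that by (simp add: weight_def length_top_rep top_rep(2) del: of_nat_mult)
        show "(\<forall>m\<in>lengths. ?h b' m = \<eta> powi ?w m * ?h b m) \<longleftrightarrow> (\<forall>i\<in>cycle_reps p. b' $ i = \<eta> ^ weight i * b $ i)"
        proof (intro iffI ballI)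
          fix i assume *: "\<forall>m\<in>lengths. ?h b' m = \<eta> powi ?w m * ?h b m" and i: "i \<in> cycle_reps p"
          show "b' $ i = \<eta> ^ weight i * b $ i"
          proof (cases "slot i = 0")
            case True
            then have "i = top_rep (cycle_length p i)" "cycle_length p i \<in> lengths"
              using eq_top_rep length_in_lengths i by blast+
            then show ?thesis
              using * w by (metis restrict_apply')
          next
            case False
            then show ?thesis
              using b i by (simp add: top_space_def)
          qed
        next
          fix m assume *: "\<forall>i\<in>cycle_reps p. b' $ i = \<eta> ^ weight i * b $ i" and m: "m \<in> lengths"
          then show "?h b' m = \<eta> powi ?w m * ?h b m"
            using w [OF m] top_rep_in [OF m] by simp
        qed
      qed
      also have "\<dots> \<longleftrightarrow> \<pi> b = \<pi> b'"
        using \<pi>_iff b sub by blast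
      finally show ?thesis .
    qed
  qed
qed

end

section \<open>Counting components\<close>

text \<open>The function \<open>gcd a\<close> has period \<open>a\<close>, and the range of
  summation consists of v / a periods.\<close>

lemma sum_gcd_periodic:
  fixes a v :: nat
  assumes "a dvd v"
  shows "(\<Sum>j<v. gcd a j) = (v div a) * (\<Sum>j<a. gcd a j)"
proof (cases "a = 0")
  case False
  have "(\<Sum>j<m * a. gcd a j) = m * (\<Sum>j<a. gcd a j)" for m
  proof (induction m)
    case (Suc m)
    have "(\<Sum>j<Suc m * a. gcd a j) = (\<Sum>j\<in>{0..<m * a}. gcd a j) + (\<Sum>j\<in>{m * a..<m * a + a}. gcd a j)"
      unfolding lessThan_atLeast0 mult_Suc add.commute [of a] by (rule sum.atLeastLessThan_concat [symmetric]) simp_all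
    also have "(\<Sum>j\<in>{m * a..<m * a + a}. gcd a j) = (\<Sum>j\<in>{0..<a}. gcd a (j + m * a))"
      using sum.shift_bounds_nat_ivl [of "gcd a" 0 "m * a" a] by (simp add: add.commute)
    also have "\<dots> = (\<Sum>j<a. gcd a j)"
    proof -
      have "gcd a (j + m * a) = gcd a j" for j
        using gcd_add_mult [of a m j] by (simp add: add.commute)
      then show ?thesis by (simp add: lessThan_atLeast0)
    qed
    finally show ?case using Suc by (simp add: lessThan_atLeast0)
  qed simp
  from this[of "v div a"] show ?thesis
    using assms by simp
qed (use assms in simp)

text \<open>
  The left-hand side is the number of components summed over the twists \<open>\<zeta> = exp(2\<pi>\<i>j/v)\<close> with
  \<open>v = gcd(g, k)\<close>: the order of \<open>\<zeta>\<close> is \<open>d = v / gcd(v, j)\<close>, so \<open>g/d = (g/v) gcd(v, j)\<close>.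
\<close>

lemma sum_gcd_eq_num_components:
  fixes g n k :: nat
  assumes n: "n > 0" and g: "g dvd n" and k: "k dvd n"
  shows "(\<Sum>j<gcd g k. gcd (g div gcd g k * gcd (gcd g k) j) (n div k)) =
    (g div gcd (gcd g (n div g)) (gcd k (n div k))) *
      (\<Sum>s<gcd (gcd g (n div g)) (gcd k (n div k)). gcd (gcd (gcd g (n div g)) (gcd k (n div k))) s)"
proof -
  define v u k' where "v = gcd g k" and "u = g div v" and "k' = n div k"
  define a where "a = gcd (gcd g (n div g)) (gcd k k')"
  have pos: "g > 0" "k > 0" "v > 0" "k' > 0" "n div g > 0"
    using n g k by (auto simp: v_def k'_def dvd_imp_le intro!: Nat.gr0I)
  have uv: "g = u * v" "n = k * k'" "n = g * (n div g)"
    using g k by (simp_all add: u_def v_def k'_def)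
  \<comment> \<open>Leads to \<open>u dvd k'\<close>: g divides n, and cancelling v turns this into
    \<open>u\<close> dividing \<open>(k div v) * k'\<close>, whose first factor is prime to
    \<open>u\<close>.\<close>
  have "coprime u (k div v)"
    unfolding u_def v_def using pos(1) by (intro div_gcd_coprime) auto
  moreover have "u dvd (k div v) * k'"
  proof -
    have "u * v dvd (k div v) * k' * v"
      using g unfolding uv(1)[symmetric] by (simp add: uv(2) v_def mult.commute mult.left_commute)
    then show ?thesis using pos(3) by simp
  qed
  ultimately have "u dvd k'"
    by (simp add: coprime_dvd_mult_right_iff)
  then obtain q where q: "k' = u * q" by blast
  \<comment> \<open>With k' = u q one finds n/g = (k/v) q. Since u and k/v are coprime, gcd(n/g, k')
    is q, so the fourfold gcd collapses to gcd(v, q).\<close>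
  have ga: "gcd v q = a"
  proof -
    have "n div g = (k div v) * q"
    proof -
      have "g * ((k div v) * q) = n"
        unfolding uv(1) uv(2) q by (simp add: v_def mult_ac)
      then show ?thesis using pos(1) by (metis nonzero_mult_div_cancel_left not_gr_zero)
    qed
    then have "gcd (n div g) k' = q * gcd (k div v) u"
      unfolding q by (simp add: gcd_mult_distrib_nat mult.commute)
    also have "gcd (k div v) u = 1"
      using \<open>coprime u (k div v)\<close> by (simp add: coprime_iff_gcd_eq_1 gcd.commute)
    finally have "a = gcd v q"
      unfolding a_def v_def by (metis gcd.assoc gcd.commute mult_1_right)
    then show ?thesis ..
  qed
  have "gcd (u * gcd v j) k' = u * gcd a j" for j
  proof -
    have "gcd (u * gcd v j) k' = u * gcd (gcd v j) q"
      unfolding q by (simp add: gcd_mult_distrib_nat)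
    also have "gcd (gcd v j) q = gcd a j"
      unfolding ga[symmetric] by (simp add: gcd.assoc gcd.commute gcd.left_commute)
    finally show ?thesis .
  qed
  then have "(\<Sum>j<v. gcd (u * gcd v j) k') = u * (\<Sum>j<v. gcd a j)"
    by (simp add: sum_distrib_left)
  also have av: "a dvd v"
    unfolding ga[symmetric] by simp
  then have "(\<Sum>j<v. gcd a j) = (v div a) * (\<Sum>j<a. gcd a j)"
    by (rule sum_gcd_periodic)
  also have "u * ((v div a) * (\<Sum>j<a. gcd a j)) = (g div a) * (\<Sum>j<a. gcd a j)"
    using av by (simp add: uv(1) div_mult_swap mult.assoc[symmetric])
  finally show ?thesis
    unfolding a_def v_def u_def k'_def .
qed

section \<open>Roots of unity and the twists that occur\<close>

lemma power_Gcd_eq_1: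
  fixes z :: complex
  assumes "finite A" "\<And>m. m \<in> A \<Longrightarrow> z ^ m = 1"
  shows "z ^ Gcd A = (1 :: complex)"
proof -
  have gcd: "z ^ gcd a b = 1" if "z ^ a = 1" "z ^ b = 1" for a b :: nat
  proof (cases "z = 0")
    case True
    then have "a = 0" "b = 0"
      using that by (auto simp: power_0_left split: if_splits)
    then show ?thesis by simp
  next
    case False
    obtain u v where uv: "u * int a + v * int b = gcd (int a) (int b)"
      using bezout_int by blast
    have "z powi (int (gcd a b)) = (z powi int a) powi u * (z powi int b) powi v"
      unfolding gcd_int_int_eq [symmetric] uv [symmetric] using False
      by (simp add: power_int_add mult.commute [of u] mult.commute [of v] power_int_mult)
    then show ?thesis using that by simp
  qed
  show ?thesis
    using assms by (induction A rule: finite_induct) (simp_all add: gcd)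
qed

definition unity_root :: "nat \<Rightarrow> nat \<Rightarrow> complex" where
  "unity_root v j = cis (2 * pi * real j / real v)"

lemma unity_root_power: "unity_root v j ^ t = unity_root v (j * t)"
  by (simp add: unity_root_def Complex.DeMoivre mult_ac)

lemma bij_betw_unity_root: "v > 0 \<Longrightarrow> bij_betw (unity_root v) {..<v} {z. z ^ v = 1}"
  unfolding unity_root_def [abs_def] by (rule Complex.bij_betw_roots_unity)

lemma unity_root_mod:
  assumes v: "v > 0"
  shows "unity_root v (m mod v) = unity_root v m"
proof -
  have 1: "unity_root v 1 ^ v = 1"
    using v by (simp add: unity_root_power) (simp add: unity_root_def)
  have "unity_root v 1 ^ m = unity_root v 1 ^ (v * (m div v) + m mod v)"
    by (simp only: mult_div_mod_eq)
  also have "\<dots> = unity_root v 1 ^ (m mod v)"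
    unfolding power_add power_mult 1 by simp
  finally show ?thesis
    by (simp add: unity_root_power)
qed

lemma unity_root_eq_1_iff:
  assumes v: "v > 0"
  shows "unity_root v j = 1 \<longleftrightarrow> v dvd j"
proof -
  have "unity_root v 0 = 1" by (simp add: unity_root_def)
  then have "unity_root v j = 1 \<longleftrightarrow> unity_root v (j mod v) = unity_root v 0"
    by (simp only: unity_root_mod [OF v])
  also have "\<dots> \<longleftrightarrow> j mod v = 0"
    by (rule inj_on_eq_iff [OF bij_betw_imp_inj_on [OF bij_betw_unity_root [OF v]]]) (use v in simp_all)
  finally show ?thesis by (simp add: mod_eq_0_iff_dvd)
qed

text \<open>Provides the condition \<open>gen\<close> of the locale. Writing \<open>z\<close> as the
  root with index l, the hypothesis says that gcd(v, j) divides l, and this is the condition for j t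
  = l to be solvable modulo v.\<close>

lemma unity_root_generates:
  assumes v: "v > 0" and z: "z ^ (v div gcd v j) = 1"
  shows "\<exists>t. z = unity_root v j ^ t"
proof -
  define d where "d = v div gcd v j"
  have vd: "v = d * gcd v j" and d: "d > 0"
    using v by (simp_all add: d_def div_greater_zero_iff)
  have "z ^ v = (z ^ d) ^ gcd v j"
    by (subst vd) (rule power_mult)
  then have "z ^ v = 1"
    using z by (simp add: d_def)
  then obtain l where l: "z = unity_root v l"
    using bij_betw_imp_surj_on [OF bij_betw_unity_root [OF v]] by blast
  have "v dvd l * d"
    using z unfolding l d_def [symmetric] unity_root_power unity_root_eq_1_iff [OF v] .
  then have "d * gcd v j dvd d * l"
    using vd by (simp add: mult.commute)
  then obtain q where q: "l = gcd v j * q"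
    using d by auto
  obtain x y where xy: "x * int v + y * int j = gcd (int v) (int j)"
    using bezout_int by blast
  \<comment> \<open>The Bezout solution may be negative, so it is reduced modulo \<open>v\<close> to
    a natural exponent.\<close>
  define t where "t = nat ((y * int q) mod int v)"
  have t: "int t = (y * int q) mod int v"
    using v by (simp add: t_def)
  have "int (j * t) mod int v = int l mod int v"
  proof -
    have "int (j * t) mod int v = (int j * (y * int q)) mod int v"
      unfolding of_nat_mult t by (rule mod_mult_right_eq)
    also have "int j * (y * int q) = int l - int v * (x * int q)"
      using arg_cong [OF xy, of "\<lambda>z. z * int q"] unfolding q by (simp add: algebra_simps)
    also have "\<dots> mod int v = int l mod int v"
      by (metis mod_diff_right_eq mod_mult_self1_is_0 diff_zero)
    finally show ?thesis .
  qed
  then have "(j * t) mod v = l mod v"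
    by (metis of_nat_eq_iff zmod_int)
  then have "unity_root v (j * t) = z"
    unfolding l using unity_root_mod [OF v] by metis
  then show ?thesis
    by (intro exI[of _ t]) (simp add: unity_root_power)
qed

lemma twisted_torus_iterate:
  fixes x :: "complex^'n"
  assumes p: "bij p" and x: "x \<in> twisted_torus p \<zeta>"
  shows "x $ i = \<zeta> ^ t * x $ ((p ^^ t) i)"
proof (induction t)
  case (Suc t)
  have "permute_coords p x $ (p ((p ^^ t) i)) = \<zeta> * x $ (p ((p ^^ t) i))"
    using x by (simp add: twisted_torus_def)
  then have "x $ ((p ^^ t) i) = \<zeta> * x $ (p ((p ^^ t) i))"
    using p by (simp add: permute_coords_def bij_is_inj)
  then show ?case using Suc by simp
qed simp

text \<open>One turn round a cycle of length m multiplies a nonzero coordinate by the m-th power of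
  the twist, which must therefore be 1. This rules out all twists whose torus is empty for lack of
  divisibility.\<close>

lemma twisted_torus_root:
  assumes p: "bij p" and x: "x \<in> twisted_torus p \<zeta>"
  shows "\<zeta> ^ Gcd (cycle_length p ` cycle_reps p) = 1"
proof (rule power_Gcd_eq_1)
  fix m assume "m \<in> cycle_length p ` cycle_reps p"
  then obtain c where m: "m = cycle_length p c" by blast
  have "x $ c = \<zeta> ^ m * x $ c"
    using twisted_torus_iterate [OF p x, of c m] by (simp add: m cycle_length(2) [OF p])
  moreover have "x $ c \<noteq> 0"
    using x unit_torus_nonzero [of x c] by (simp add: twisted_torus_def)
  ultimately show "\<zeta> ^ m = 1" by simp
qed simp

text \<open>The dimension of the torus depends on the cycle lengths and not on the twist, so the
  pieces of different twists share the torus factor and their numbers of points add up.\<close>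

lemma cycle_type_piece_homotopy_equivalent:
  fixes p :: "'n::finite \<Rightarrow> 'n"
  assumes p: "bij p" and k: "k > 0" "k dvd CARD('n)"
  shows "subtopology (torus_extended_quotient k) (\<Union>\<zeta>\<in>{\<zeta>. \<zeta> ^ k = 1}. point_class k p ` twisted_torus p \<zeta>)
    homotopy_equivalent_space
    torus_times_discrete (num_distinct_parts (cycle_type p) - 1) (num_components CARD('n) k (cycle_type p))"
proof -
  define S where "S = cycle_length p ` cycle_reps p"
  have S: "set_mset (cycle_type p) = S"
    by (simp add: cycle_type_def S_def)
  define g where "g = Gcd S"
  define v where "v = gcd g k"
  let ?n = "CARD('n)" and ?E = "torus_extended_quotient k"
  define U where "U = (\<Union>\<zeta>\<in>{\<zeta>. \<zeta> ^ k = 1}. point_class k p ` twisted_torus p \<zeta>)"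
  define V where "V j = point_class k p ` twisted_torus p (unity_root v j)" for j
  have v: "v > 0" "v dvd k" "v dvd g" using k by (simp_all add: v_def)
  have "g dvd cycle_length p c" if "c \<in> cycle_reps p" for c
    using that by (simp add: g_def S_def)
  then have g_len: "g dvd cycle_length p i" for i
    using cycle_length_rep [OF p] by (metis cycle_reps_def rangeI)
  have gn: "g dvd ?n"
    unfolding sum_cycle_lengths [OF p, symmetric] by (intro dvd_sum) (simp add: g_len)
  have root_k: "unity_root v j ^ k = 1" for j
    using v(1,2) by (simp add: unity_root_power unity_root_eq_1_iff)
  have VU: "V j \<subseteq> U" for j
    using root_k by (auto simp: V_def U_def)
  \<comment> \<open>A twist with a nonempty torus satisfies \<zeta>^g = 1 as well as \<zeta>^k = 1,
    so only the roots of unity of order dividing v = gcd(g, k) contribute.\<close>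
  have UV: "U = (\<Union>j<v. V j)"
  proof (intro equalityI subsetI)
    fix y assume "y \<in> U"
    then obtain \<zeta> x where \<zeta>: "\<zeta> ^ k = 1" "x \<in> twisted_torus p \<zeta>" "y = point_class k p x" unfolding U_def by blast
    have "\<zeta> ^ g = 1"
      unfolding g_def S_def by (rule twisted_torus_root [OF p \<zeta>(2)])
    then have "\<zeta> ^ Gcd {g, k} = 1"
      using \<zeta>(1) by (intro power_Gcd_eq_1) auto
    then have "\<zeta> ^ v = 1"
      by (simp add: v_def)
    then obtain j where "j < v" "\<zeta> = unity_root v j"
      using bij_betw_imp_surj_on [OF bij_betw_unity_root [OF v(1)]] by blast
    then show "y \<in> (\<Union>j<v. V j)"
      using \<zeta> by (auto simp: V_def)
  qed (use VU in blast)
  have V_open: "openin ?E (V j)" for j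
    unfolding V_def by (rule openin_twisted_piece [OF k p root_k])
  then have U_open: "openin ?E U"
    unfolding UV by (intro openin_Union) auto
  have opn: "openin (subtopology ?E U) (V j)" for j
    unfolding openin_open_subtopology [OF U_open] using V_open VU by blast
  have top: "topspace (subtopology ?E U) = U"
    using openin_subset [OF U_open] by (simp add: inf.absorb2)
  have disj: "disjoint_family_on V {..<v}"
    unfolding disjoint_family_on_def
  proof (intro ballI impI)
    fix i j assume ij: "i \<in> {..<v}" "j \<in> {..<v}" "i \<noteq> j"
    then have ne: "unity_root v i \<noteq> unity_root v j"
      using inj_on_eq_iff [OF bij_betw_imp_inj_on [OF bij_betw_unity_root [OF v(1)]]] by blast
    show "V i \<inter> V j = {}"
    proof (rule ccontr)
      assume "V i \<inter> V j \<noteq> {}"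
      then obtain x y where "x \<in> twisted_torus p (unity_root v i)" "y \<in> twisted_torus p (unity_root v j)"
          "point_class k p x = point_class k p y"
        unfolding V_def by blast
      then show False
        using twisted_pieces_meet(1) [OF k(1) p p _ _ k(2)] ne by blast
    qed
  qed
  define d where "d j = v div gcd v j" for j
  have he: "subtopology (subtopology ?E U) (V j) homotopy_equivalent_space
      torus_times_discrete (card S - 1) (gcd (g div d j) (?n div k))" for j
  proof -
    have dv: "v = d j * gcd v j" "d j > 0"
      using v(1) by (simp_all add: d_def div_greater_zero_iff)
    have "d j dvd v" by (rule dvdI [OF dv(1)])
    interpret twisted_data p "unity_root v j" "d j" k
    proof
      show "unity_root v j ^ d j = 1"
      proof -
        have "d j * gcd v j dvd d j * j"
          by (intro mult_dvd_mono) simp_all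
        then have "v dvd j * d j"
          unfolding dv(1) [symmetric] by (simp add: mult.commute)
        then show ?thesis
          unfolding unity_root_power unity_root_eq_1_iff [OF v(1)] .
      qed
      show "\<exists>t. z = unity_root v j ^ t" if "z ^ d j = 1" for z
        using unity_root_generates [OF v(1)] that unfolding d_def .
      show "d j dvd cycle_length p i" for i
        using \<open>d j dvd v\<close> v(3) g_len [of i] by (meson dvd_trans)
    qed (use p k dv root_k in auto)
    show ?thesis
      using piece_homotopy_equivalent VU [of j]
      by (simp add: V_def S_def g_def lengths_def subtopology_subtopology inf.absorb2)
  qed
  have "subtopology ?E U homotopy_equivalent_space
      prod_topology (product_topology (\<lambda>_. punctured_plane) {..<card S - 1})
        (discrete_topology {..<\<Sum>j<v. gcd (g div d j) (?n div k)})"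
  proof (rule homotopy_equivalent_space_disjoint_union_discrete [OF opn disj])
    show "(\<Union>j<v. V j) = topspace (subtopology ?E U)"
      unfolding top by (rule UV [symmetric])
    show "subtopology (subtopology ?E U) (V j) homotopy_equivalent_space
        prod_topology (product_topology (\<lambda>_. punctured_plane) {..<card S - 1}) (discrete_topology {..<gcd (g div d j) (?n div k)})" for j
      using he unfolding torus_times_discrete_def .
  qed
  moreover have "(\<Sum>j<v. gcd (g div d j) (?n div k)) = num_components ?n k (cycle_type p)"
  proof -
    have "g div d j = g div v * gcd v j" for j
    proof -
      have "v = d j * gcd v j" "d j > 0"
        using v(1) by (simp_all add: d_def div_greater_zero_iff)
      moreover have "g = (g div v) * v"
        using v(3) by simp
      ultimately have "g = (g div v * gcd v j) * d j"
        by (metis mult.assoc mult.commute)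
      then show ?thesis
        using \<open>d j > 0\<close> by (metis nonzero_mult_div_cancel_right not_gr_zero)
    qed
    then have "(\<Sum>j<v. gcd (g div d j) (?n div k)) = (\<Sum>j<gcd g k. gcd (g div gcd g k * gcd (gcd g k) j) (?n div k))"
      by (simp add: v_def)
    also have "\<dots> = num_components ?n k (cycle_type p)"
      unfolding num_components_def parts_gcd_def S g_def [symmetric] Let_def
      by (rule sum_gcd_eq_num_components [OF _ gn k(2)]) simp
    finally show ?thesis .
  qed
  ultimately show ?thesis
    unfolding U_def torus_times_discrete_def num_distinct_parts_def S by simp
qed

lemma torus_extended_quotient_homotopy_equivalent:
  fixes k :: nat
  assumes k: "k > 0" "k dvd CARD('n::finite)"
  shows "(torus_extended_quotient k :: (('n \<Rightarrow> 'n) \<times> (complex^'n^'n) set) set topology) homotopy_equivalent_space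
    sum_topology (\<lambda>\<mu>. torus_times_discrete (num_distinct_parts \<mu> - 1) (num_components CARD('n) k \<mu>)) (partitions CARD('n))"
proof -
  let ?E = "torus_extended_quotient k :: (('n \<Rightarrow> 'n) \<times> (complex^'n^'n) set) set topology"
  have "\<exists>p :: 'n \<Rightarrow> 'n. \<mu> \<in> partitions CARD('n) \<longrightarrow> bij p \<and> cycle_type p = \<mu>" for \<mu>
    using cycle_type_exists by blast
  then obtain P :: "nat multiset \<Rightarrow> 'n \<Rightarrow> 'n"
    where P: "\<And>\<mu>. \<mu> \<in> partitions CARD('n) \<Longrightarrow> bij (P \<mu>) \<and> cycle_type (P \<mu>) = \<mu>"
    by metis
  \<comment> \<open>One permutation per partition is enough: conjugate permutations give the same
    classes, and conjugacy is equality of cycle types.\<close>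
  define U where "U \<mu> = (\<Union>\<zeta>\<in>{\<zeta>. \<zeta> ^ k = 1}. point_class k (P \<mu>) ` twisted_torus (P \<mu>) \<zeta>)" for \<mu>
  show ?thesis
  proof (rule homotopy_equivalent_space_disjoint_union)
    show op: "openin ?E (U \<mu>)" if "\<mu> \<in> partitions CARD('n)" for \<mu>
      unfolding U_def using P [OF that] by (auto intro!: openin_Union openin_twisted_piece k)
    show "subtopology ?E (U \<mu>) homotopy_equivalent_space
        torus_times_discrete (num_distinct_parts \<mu> - 1) (num_components CARD('n) k \<mu>)" if "\<mu> \<in> partitions CARD('n)" for \<mu>
      using cycle_type_piece_homotopy_equivalent [OF _ k, of "P \<mu>"] P [OF that] by (simp add: U_def)
    show "disjoint_family_on U (partitions CARD('n))"
      unfolding disjoint_family_on_def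
    proof (intro ballI impI)
      fix \<mu> \<nu> assume \<mu>: "\<mu> \<in> partitions CARD('n)" "\<nu> \<in> partitions CARD('n)" "\<mu> \<noteq> \<nu>"
      show "U \<mu> \<inter> U \<nu> = {}"
      proof (rule ccontr)
        assume "U \<mu> \<inter> U \<nu> \<noteq> {}"
        then obtain \<zeta> \<zeta>' x y where "x \<in> twisted_torus (P \<mu>) \<zeta>" "y \<in> twisted_torus (P \<nu>) \<zeta>'"
            "point_class k (P \<mu>) x = point_class k (P \<nu>) y"
          unfolding U_def by blast
        then have "\<exists>\<alpha>. bij \<alpha> \<and> P \<nu> = \<alpha> \<circ> P \<mu> \<circ> inv_into UNIV \<alpha>"
          using twisted_pieces_meet(2) [OF k(1) _ _ _ _ k(2)] P \<mu> by blast
        then have "cycle_type (P \<mu>) = cycle_type (P \<nu>)"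
          using conjugate_iff_cycle_type_eq P \<mu> by blast
        then show False
          using P \<mu> by simp
      qed
    qed
    show "(\<Union>\<mu>\<in>partitions CARD('n). U \<mu>) = topspace ?E"
    proof (intro equalityI subsetI)
      fix y assume "y \<in> topspace ?E"
      then obtain p :: "'n \<Rightarrow> 'n" and x \<zeta> where px: "bij p" "y = point_class k p x" "\<zeta> ^ k = 1" "x \<in> twisted_torus p \<zeta>"
        unfolding topspace_torus_extended_quotient [OF k(1)] fixed_torus_def by blast
      have \<mu>: "cycle_type p \<in> partitions CARD('n)"
        by (rule cycle_type_in_partitions [OF px(1)])
      then obtain \<alpha> where \<alpha>: "bij \<alpha>" "P (cycle_type p) = \<alpha> \<circ> p \<circ> inv_into UNIV \<alpha>"
        using conjugate_iff_cycle_type_eq [OF px(1), of "P (cycle_type p)"] P by metis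
      \<comment> \<open>Conjugation moves the point to the permutation chosen for its cycle type and
        keeps its twist.\<close>
      have "y \<in> point_class k (P (cycle_type p)) ` twisted_torus (P (cycle_type p)) \<zeta>"
        unfolding \<alpha>(2) px(2) by (rule point_class_conjugate [OF k(1) px(1) \<alpha>(1) k(2) px(4)])
      then show "y \<in> (\<Union>\<mu>\<in>partitions CARD('n). U \<mu>)"
        using \<mu> px(3) unfolding U_def by blast
    qed (use op openin_subset in blast)
  qed
qed

theorem corollary1p3:
  fixes k n :: nat
  assumes n: "n = CARD('n::finite)"
    and k: "k > 0" "k dvd n"
  shows "(torus_extended_quotient k :: (('n \<Rightarrow> 'n) \<times> (complex^'n^'n) set) set topology)
           homotopy_equivalent_space
         sum_topology
           (\<lambda>\<mu>. prod_topology
              (product_topology (\<lambda>_. punctured_plane) {..<num_distinct_parts \<mu> - 1})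
              (discrete_topology {..<num_components n k \<mu>}))
           (partitions n)
       \<and> (torus_extended_quotient k :: (('n \<Rightarrow> 'n) \<times> (complex^'n^'n) set) set topology)
           homotopy_equivalent_space
         (torus_extended_quotient (n div k) :: (('n \<Rightarrow> 'n) \<times> (complex^'n^'n) set) set topology)"
proof -
  let ?E = "\<lambda>k. torus_extended_quotient k :: (('n \<Rightarrow> 'n) \<times> (complex^'n^'n) set) set topology"
  let ?T = "\<lambda>k. sum_topology (\<lambda>\<mu>. torus_times_discrete (num_distinct_parts \<mu> - 1) (num_components n k \<mu>)) (partitions n)"
  have "n > 0" using n by simp
  then have k': "n div k > 0" "n div k dvd n" "n div (n div k) = k"
    using k by (auto simp: dvd_imp_le div_greater_zero_iff)
  have 1: "?E k homotopy_equivalent_space ?T k" and 2: "?E (n div k) homotopy_equivalent_space ?T (n div k)"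
    using torus_extended_quotient_homotopy_equivalent [where 'n='n] k k' n by simp_all
  have "num_components n (n div k) \<mu> = num_components n k \<mu>" for \<mu>
    unfolding num_components_def k'(3) by (simp only: gcd.commute [of "n div k" k])
  then have "?T (n div k) = ?T k" by simp
  then have "?E k homotopy_equivalent_space ?E (n div k)"
    using 1 2 homotopy_eqv_trans homotopy_equivalent_space_sym by metis
  then show ?thesis
    using 1 unfolding torus_times_discrete_def by blast
qed

end
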